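(* Let $1<\gamma<+\infty$. There exists a bounded linear operator $\mathbf{E}_+:\mathrm{BV}([1,\gamma])\to L^1([0,+\infty))$ with the following properties: (i) $\mathbf{E}_+$ is an extension operator, in the sense that $\mathbf{E}_+f(x)=f(x)$ for almost every $x\in[1,\gamma]$, for all $f\in\mathrm{BV}([1,\gamma])$. (ii) The range of $\mathbf{E}_+$ is infinite-dimensional and contained in $\mathcal{N}_{2\gamma}^\bot$.
   Context: For $\beta>0$, with $\mathbb{R}_+$ the positive half-axis, $$\mathcal{N}_\beta^\bot=\Big\{f\in L^1(\mathbb{R}_+):\ \int_{\mathbb{R}_+} f(x)e^{i 2n\pi x}\,dx=\int_{\mathbb{R}_+} f(x)e^{i n\pi\beta/x}\,dx=0\ \text{ for all } n\in\mathbb{Z}\Big\};$$ $L^1([0,+\infty))$ and $L^1(\mathbb{R}_+)$ are identified. For a closed bounded interval $I$, $\mathrm{BV}(I)$ is the space of (classes of) complex-valued functions $h\in L^1(I)$ having a representative of bounded variation, with norm $\|h\|_{\mathrm{BV}}=\|h\|_{L^1(I)}+\inf_{\tilde h\sim h}\mathrm{var}_I(\tilde h)$, the infimum being over all representatives $\tilde h$ of $h$ and $\mathrm{var}_I$ being the total variation. *)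

theory Defs
  imports "HOL-Analysis.Analysis"
begin

text \<open>
  Elements of the Lebesgue and BV spaces are represented by functions of type
  \<open>real \<Rightarrow> complex\<close>; two functions represent the same class on a set \<open>S\<close> iff they are
  related by \<open>ae_eq_on S\<close>. Values outside \<open>S\<close> are irrelevant.
\<close>

definition ae_eq_on :: "real set \<Rightarrow> (real \<Rightarrow> complex) \<Rightarrow> (real \<Rightarrow> complex) \<Rightarrow> bool" where
  "ae_eq_on S f g \<longleftrightarrow> (AE x in lebesgue. x \<in> S \<longrightarrow> f x = g x)"

definition L1 :: "real set \<Rightarrow> (real \<Rightarrow> complex) set" where
  "L1 S = {f. set_integrable lebesgue S f}"

definition L1_norm :: "real set \<Rightarrow> (real \<Rightarrow> complex) \<Rightarrow> real" where
  "L1_norm S f = (LINT x:S|lebesgue. norm (f x))"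

text \<open>The supremum runs over all finite nondecreasing sequences \<open>t 0 \<le> \<dots> \<le> t n\<close> of points of \<open>I\<close>;
  it may be infinite.\<close>

definition total_variation_on :: "real set \<Rightarrow> (real \<Rightarrow> complex) \<Rightarrow> ennreal" where
  "total_variation_on I f =
     (SUP (n, t) \<in> {(n :: nat, t :: nat \<Rightarrow> real). mono_on {..n} t \<and> t ` {..n} \<subseteq> I}.
        \<Sum>i<n. ennreal (norm (f (t (Suc i)) - f (t i))))"

definition BV :: "real set \<Rightarrow> (real \<Rightarrow> complex) set" where
  "BV I = {h \<in> L1 I. \<exists>g. ae_eq_on I g h \<and> total_variation_on I g < \<infinity>}"

text \<open>For \<open>h \<in> BV I\<close> the infimum is finite, so \<open>enn2real\<close> loses nothing.\<close>

definition BV_norm :: "real set \<Rightarrow> (real \<Rightarrow> complex) \<Rightarrow> real" where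
  "BV_norm I h = L1_norm I h + enn2real (INF g \<in> {g. ae_eq_on I g h}. total_variation_on I g)"

text \<open>A map between representatives that induces a bounded complex-linear operator from the
  classes in \<open>BV I\<close> to the classes in \<open>L1 S\<close>; the second conjunct says that it descends to
  classes.\<close>

definition bounded_linear_BV_L1 ::
    "real set \<Rightarrow> real set \<Rightarrow> ((real \<Rightarrow> complex) \<Rightarrow> (real \<Rightarrow> complex)) \<Rightarrow> bool" where
  "bounded_linear_BV_L1 I S E \<longleftrightarrow>
     (\<forall>f \<in> BV I. E f \<in> L1 S) \<and>
     (\<forall>f \<in> BV I. \<forall>g \<in> BV I. ae_eq_on I f g \<longrightarrow> ae_eq_on S (E f) (E g)) \<and>
     (\<forall>f \<in> BV I. \<forall>g \<in> BV I. ae_eq_on S (E (\<lambda>x. f x + g x)) (\<lambda>x. E f x + E g x)) \<and>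
     (\<forall>c :: complex. \<forall>f \<in> BV I. ae_eq_on S (E (\<lambda>x. c * f x)) (\<lambda>x. c * E f x)) \<and>
     (\<exists>C. \<forall>f \<in> BV I. L1_norm S (E f) \<le> C * BV_norm I f)"

text \<open>For a set \<open>V\<close> of functions whose classes on \<open>S\<close> form a complex vector space: that space has
  no finite spanning set.\<close>

definition infinite_dimensional_ae :: "real set \<Rightarrow> (real \<Rightarrow> complex) set \<Rightarrow> bool" where
  "infinite_dimensional_ae S V \<longleftrightarrow>
     \<not> (\<exists>B. finite B \<and> B \<subseteq> V \<and>
          (\<forall>f \<in> V. \<exists>c :: (real \<Rightarrow> complex) \<Rightarrow> complex. ae_eq_on S f (\<lambda>x. \<Sum>b\<in>B. c b * b x)))"

definition N_perp :: "real \<Rightarrow> (real \<Rightarrow> complex) set" where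
  "N_perp \<beta> = {f \<in> L1 {0<..}. \<forall>n :: int.
     (LINT x:{0<..}|lebesgue. f x * exp (\<i> * of_real (2 * of_int n * pi * x))) = 0 \<and>
     (LINT x:{0<..}|lebesgue. f x * exp (\<i> * of_real (of_int n * pi * \<beta> / x))) = 0}"

end

theory Submission
  imports Defs
begin

text \<open>
  Write \<open>u\<close> for \<open>f\<close> on \<open>(0,1)\<close>, \<open>g\<close> for \<open>f\<close> on \<open>[1,\<gamma>]\<close>, and \<open>T\<close> for the transfer operator of
  \<open>x \<mapsto> \<gamma> / x\<close> mod 1. The conditions defining \<open>N_perp (2 * \<gamma>)\<close> say that the periodizations of
  \<open>f\<close> and of its image under \<open>x \<mapsto> \<gamma> / x\<close> vanish; given \<open>g\<close> they determine \<open>f\<close> beyond \<open>\<gamma>\<close> from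
  \<open>u\<close> and reduce to \<open>u - T (T u) = T (T g) - P g\<close> with \<open>P\<close> the periodization. The right-hand side has
  mean zero, so it remains to sum the Neumann series, for which \<open>T\<close> must contract mean-zero
  differences exponentially fast in \<open>L\<^sup>1\<close>. It suffices to see this for indicator functions of
  intervals, where it follows by coupling. Sums of decreasing densities on arcs, weighted by the sum of
  their suprema, satisfy a Lasota--Yorke inequality with factor \<open>1 / \<gamma>\<close>: on the circle an arc
  avoiding 0 has a connected image, and one containing 0 splits into two parts of which the one to the right
  of 0 has only long images. Since every interval expands until its image is the whole circle, a fixed
  fraction of the mass becomes uniform after a fixed time and can be cancelled.
\<close>
section \<open>The transfer operator of the map x to gamma / x mod 1\<close>

text \<open>The obstacle is that \<gamma> may be close to 1. The inverse branches contract only by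
  \<open>1 / \<gamma>\<close>, so cutting an image interval at every integer it contains would
  produce a factor \<open>2 / \<gamma>\<close>, which can exceed 1. On the circle the only harmful
  cut is the one at 0, and there the piece to the right of 0 is sent to a half-line, so that its
  mass alone controls its image. The class of densities has to be preserved. Inversion turns "h
  decreasing" into "\<open>s\<^sup>2\<close> times the image increasing" and
  "\<open>x\<^sup>2\<close> times h increasing" into "image decreasing"; translation to the unit
  interval weakens the shift in the second condition, which explains the weight
  \<open>(x + 1)\<^sup>2\<close>. Indicators of intervals suffice because a function of bounded
  variation is a combination of bounded increasing functions, and an increasing function is a
  uniform limit of averages of indicators of its superlevel sets, which are intervals; the rate only
  has to be uniform in the interval. For nonnegative functions with values in [0,\<infinity>] all
  rearrangements are free, so the coupling is done there and transferred to complex functions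
  afterwards.\<close>

lemma ennreal_suminf_swap:
  fixes f :: "nat \<Rightarrow> nat \<Rightarrow> ennreal"
  shows "(\<Sum>i. \<Sum>j. f i j) = (\<Sum>j. \<Sum>i. f i j)"
proof -
  have "(\<Sum>i. \<Sum>j. f i j) = (\<Sum>i. \<integral>\<^sup>+j. f i j \<partial>count_space UNIV)"
    by (simp add: nn_integral_count_space_nat)
  also have "\<dots> = (\<integral>\<^sup>+j. (\<Sum>i. f i j) \<partial>count_space UNIV)"
    by (rule nn_integral_suminf[symmetric]) simp
  finally show ?thesis
    by (simp add: nn_integral_count_space_nat)
qed

lemma nn_integral_inversion:
  fixes f :: "real \<Rightarrow> ennreal"
  assumes [measurable]: "f \<in> borel_measurable borel" and c: "0 < c"
  shows "(\<integral>\<^sup>+s. f (c / s) * ennreal (c / s\<^sup>2) * indicator {0<..} s \<partial>lborel)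
       = (\<integral>\<^sup>+v. f v * indicator {0<..} v \<partial>lborel)"
proof -
  \<comment> \<open>\<open>A n\<close> is invariant under \<open>s |-> 1 / s\<close>, so
    \<open>s |-> c / s\<close> maps it onto \<open>B n\<close>. The offset 2 keeps the intervals
    nondegenerate already for n = 0.\<close>
  define a b A B where "a n = 1 / real (n + 2)" and "b n = real (n + 2)"
    and "A n = {a n..b n}" and "B n = {c * a n..c * b n}" for n
  have ab: "0 < a n" "a n < b n" for n
    using order.strict_trans2[of "a n" 1 "b n"] by (auto simp: a_def b_def)
  have inc: "incseq A" "incseq B"
    using c by (auto simp: incseq_def A_def B_def a_def b_def frac_le intro: order_trans order_trans[rotated]
        mult_left_mono frac_le)
  have UA: "(\<Union>n. A n) = {0<..}"
  proof safe
    fix s :: real assume "0 < s"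
    obtain n where n: "max s (1/s) \<le> real n" using real_arch_simple by blast
    then have "1 \<le> real n * s" using \<open>0 < s\<close> by (simp add: field_simps)
    then have "1 \<le> s * (2 + real n)" using \<open>0 < s\<close> by (simp add: algebra_simps)
    with n \<open>0 < s\<close> have "s \<in> A n" by (auto simp: A_def a_def b_def field_simps)
    then show "s \<in> (\<Union>n. A n)" by blast
  next
    fix s n assume "s \<in> A n" then show "0 < s" using ab(1)[of n] by (auto simp: A_def)
  qed
  have BA: "v \<in> B n \<longleftrightarrow> v / c \<in> A n" for v n
    using c by (auto simp: A_def B_def field_simps)
  have UB: "(\<Union>n. B n) = {0<..}"
  proof -
    have "v \<in> (\<Union>n. B n) \<longleftrightarrow> v / c \<in> (\<Union>n. A n)" for v using BA by auto
    then show ?thesis using c unfolding UA by (auto simp: zero_less_divide_iff)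
  qed
  have eq: "(\<integral>\<^sup>+s. f (c / s) * ennreal (c / s\<^sup>2) * indicator (A n) s \<partial>lborel)
       = (\<integral>\<^sup>+v. f v * indicator (B n) v \<partial>lborel)" for n
  proof -
    \<comment> \<open>The substitution rule is for increasing maps, hence \<open>- c / x\<close>
      followed by a reflection.\<close>
    have "(\<integral>\<^sup>+x. f (- x) * indicator {- c / a n..- c / b n} x \<partial>lborel)
        = (\<integral>\<^sup>+x. f (- (- c / x)) * ennreal (c / x\<^sup>2) * indicator {a n..b n} x \<partial>lborel)"
    proof (rule nn_integral_substitution_aux)
      show "((\<lambda>x. - c / x) has_real_derivative c / x\<^sup>2) (at x)" if "x \<in> {a n..b n}" for x
        using that ab[of n] by (auto intro!: derivative_eq_intros simp: power2_eq_square)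
      show "continuous_on {a n..b n} (\<lambda>x. c / x\<^sup>2)"
        using ab[of n] by (auto intro!: continuous_intros)
    qed (use ab c in auto)
    moreover have "(\<integral>\<^sup>+x. f (- x) * indicator {- c / a n..- c / b n} x \<partial>lborel)
        = (\<integral>\<^sup>+v. f v * indicator (B n) v \<partial>lborel)"
      by (subst nn_integral_real_affine[of _ "-1" 0])
         (auto simp: B_def a_def b_def field_simps split: split_indicator intro!: nn_integral_cong)
    ultimately show ?thesis by (simp add: A_def)
  qed
  have lim: "(SUP n. \<integral>\<^sup>+x. g x * indicator (C n) x \<partial>lborel) = (\<integral>\<^sup>+x. g x * indicator (\<Union>n. C n) x \<partial>lborel)"
    if [measurable]: "g \<in> borel_measurable borel" "\<And>n. C n \<in> sets borel" and "incseq C"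
    for g :: "real \<Rightarrow> ennreal" and C :: "nat \<Rightarrow> real set"
  proof -
    have "(SUP n. emeasure (density lborel g) (C n)) = emeasure (density lborel g) (\<Union>n. C n)"
      by (rule SUP_emeasure_incseq) (use that in auto)
    then show ?thesis by (simp add: emeasure_density)
  qed
  have "(\<integral>\<^sup>+s. f (c / s) * ennreal (c / s\<^sup>2) * indicator {0<..} s \<partial>lborel)
      = (SUP n. \<integral>\<^sup>+s. f (c / s) * ennreal (c / s\<^sup>2) * indicator (A n) s \<partial>lborel)"
    by (subst lim) (use inc UA in \<open>auto simp: A_def\<close>)
  also have "\<dots> = (SUP n. \<integral>\<^sup>+v. f v * indicator (B n) v \<partial>lborel)"
    by (simp add: eq)
  also have "\<dots> = (\<integral>\<^sup>+v. f v * indicator {0<..} v \<partial>lborel)"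
    by (subst lim) (use inc UB in \<open>auto simp: B_def\<close>)
  finally show ?thesis .
qed

text \<open>Folds the part of \<open>F\<close> on [1,\<infinity>) onto [0,1). Shifts start at 1
  because \<open>x |-> \<gamma> / x\<close> sends (0,\<gamma>] onto [1,\<infinity>).\<close>

definition per :: "(real \<Rightarrow> ennreal) \<Rightarrow> real \<Rightarrow> ennreal" where
  "per F x = indicator {0..<1} x * (\<Sum>j. F (x + real (Suc j)))"

definition inv_pf :: "real \<Rightarrow> (real \<Rightarrow> ennreal) \<Rightarrow> real \<Rightarrow> ennreal" where
  "inv_pf \<gamma> u s = u (\<gamma> / s) * ennreal (\<gamma> / s\<^sup>2)"

text \<open>For \<open>\<gamma> = 1\<close> this is the Gauss--Kuzmin--Wirsing operator of the
  continued fraction map, whence the name.\<close>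

definition gauss :: "real \<Rightarrow> (real \<Rightarrow> ennreal) \<Rightarrow> real \<Rightarrow> ennreal" where
  "gauss \<gamma> u = per (inv_pf \<gamma> u)"

lemma per_measurable [measurable]:
  assumes [measurable]: "F \<in> borel_measurable borel"
  shows "per F \<in> borel_measurable borel"
  unfolding per_def[abs_def] by measurable

lemma inv_pf_measurable [measurable]:
  assumes [measurable]: "u \<in> borel_measurable borel"
  shows "inv_pf \<gamma> u \<in> borel_measurable borel"
  unfolding inv_pf_def[abs_def] by measurable

lemma gauss_measurable [measurable]:
  "u \<in> borel_measurable borel \<Longrightarrow> gauss \<gamma> u \<in> borel_measurable borel"
  unfolding gauss_def by measurable

lemma per_suminf: "per (\<lambda>s. \<Sum>i. F i s) = (\<lambda>x. \<Sum>i. per (F i) x)"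
  by (rule ext) (simp add: per_def ennreal_suminf_swap[of "\<lambda>i j. F i (_ + real (Suc j))"] del: of_nat_Suc)

lemma per_add: "per (\<lambda>s. F s + G s) = (\<lambda>x. per F x + per G x)"
  by (rule ext) (simp add: per_def suminf_add[symmetric] distrib_left)

lemma per_cmult: "per (\<lambda>s. c * F s) = (\<lambda>x. c * per F x)"
  by (rule ext) (simp add: per_def mult_ac)

lemma gauss_suminf: "gauss \<gamma> (\<lambda>s. \<Sum>i. u i s) = (\<lambda>x. \<Sum>i. gauss \<gamma> (u i) x)"
  by (simp add: gauss_def per_suminf[symmetric] inv_pf_def[abs_def])

lemma gauss_add: "gauss \<gamma> (\<lambda>s. u s + v s) = (\<lambda>x. gauss \<gamma> u x + gauss \<gamma> v x)"
  by (simp add: gauss_def per_add[symmetric] inv_pf_def[abs_def] distrib_right)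

lemma gauss_cmult: "gauss \<gamma> (\<lambda>s. c * u s) = (\<lambda>x. c * gauss \<gamma> u x)"
  by (simp add: gauss_def per_cmult[symmetric] inv_pf_def[abs_def] mult_ac)

section \<open>Conservation of mass\<close>

lemma nn_integral_atLeast_1_decompose:
  assumes [measurable]: "F \<in> borel_measurable borel"
  shows "(\<integral>\<^sup>+s. F s * indicator {1..} s \<partial>lborel)
    = (\<Sum>j. \<integral>\<^sup>+x. F (x + real (Suc j)) * indicator {0..<1} x \<partial>lborel)"
proof -
  have ind: "indicator {1..} s = (\<Sum>j. indicator {0..<1} (s - real (Suc j)) :: ennreal)" for s :: real
  proof (cases "1 \<le> s")
    case True
    define k where "k = nat (\<lfloor>s\<rfloor> - 1)"
    have k: "real (Suc k) \<le> s" "s < real (Suc k) + 1" using True by (auto simp: k_def)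
    have "(\<Sum>j. indicator {0..<1} (s - real (Suc j)) :: ennreal)
        = (\<Sum>j\<in>{k}. indicator {0..<1} (s - real (Suc j)))"
      by (rule suminf_finite) (use k in \<open>auto split: split_indicator\<close>)
    then show ?thesis using k True by simp
  qed (auto split: split_indicator simp: not_le)
  have "(\<integral>\<^sup>+s. F s * indicator {1..} s \<partial>lborel)
      = (\<integral>\<^sup>+s. (\<Sum>j. F s * indicator {0..<1} (s - real (Suc j))) \<partial>lborel)"
    by (simp add: ind)
  also have "\<dots> = (\<Sum>j. \<integral>\<^sup>+s. F s * indicator {0..<1} (s - real (Suc j)) \<partial>lborel)"
    by (rule nn_integral_suminf) measurable
  also have "\<dots> = (\<Sum>j. \<integral>\<^sup>+x. F (x + real (Suc j)) * indicator {0..<1} x \<partial>lborel)"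
  proof (rule suminf_cong)
    fix j
    show "(\<integral>\<^sup>+s. F s * indicator {0..<1} (s - real (Suc j)) \<partial>lborel)
        = (\<integral>\<^sup>+x. F (x + real (Suc j)) * indicator {0..<1} x \<partial>lborel)"
      by (subst nn_integral_real_affine[where c=1 and t="real (Suc j)"]) (auto simp: add_ac)
  qed
  finally show ?thesis .
qed

lemma nn_integral_per:
  assumes [measurable]: "F \<in> borel_measurable borel"
  shows "(\<integral>\<^sup>+x. per F x \<partial>lborel) = (\<integral>\<^sup>+s. F s * indicator {1..} s \<partial>lborel)"
  unfolding nn_integral_atLeast_1_decompose[OF assms]
  by (subst nn_integral_suminf[symmetric]) (auto simp: per_def[abs_def] mult_ac simp del: of_nat_Suc)

text \<open>Folding sees only [1,\<infinity>), and \<open>\<gamma> / x \<ge> 1\<close> means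
  \<open>x \<le> \<gamma>\<close> for positive \<open>x\<close>; hence the condition on the support.
  Support up to \<gamma> rather than 1 is allowed so that functions on [1,\<gamma>] are covered
  too.\<close>

lemma nn_integral_gauss:
  assumes [measurable]: "u \<in> borel_measurable borel" and "0 < \<gamma>"
    and supp: "\<And>x. x \<notin> {0..\<gamma>} \<Longrightarrow> u x = 0"
  shows "(\<integral>\<^sup>+x. gauss \<gamma> u x \<partial>lborel) = (\<integral>\<^sup>+x. u x \<partial>lborel)"
proof -
  have "(\<integral>\<^sup>+x. gauss \<gamma> u x \<partial>lborel) = (\<integral>\<^sup>+s. u (\<gamma> / s) * ennreal (\<gamma> / s\<^sup>2) * indicator {1..} s \<partial>lborel)"
    by (simp add: gauss_def nn_integral_per inv_pf_def)
  also have "\<dots> = (\<integral>\<^sup>+s. u (\<gamma> / s) * ennreal (\<gamma> / s\<^sup>2) * indicator {0<..} s \<partial>lborel)"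
  proof (rule nn_integral_cong)
    fix s :: real
    have "\<gamma> / s \<notin> {0..\<gamma>}" if "0 < s" "s < 1"
      using that \<open>0 < \<gamma>\<close> by (auto simp: field_simps)
    then show "u (\<gamma> / s) * ennreal (\<gamma> / s\<^sup>2) * indicator {1..} s = u (\<gamma> / s) * ennreal (\<gamma> / s\<^sup>2) * indicator {0<..} s"
      using supp by (auto split: split_indicator)
  qed
  also have "\<dots> = (\<integral>\<^sup>+x. u x * indicator {0<..} x \<partial>lborel)"
    by (rule nn_integral_inversion) (use assms in auto)
  also have "\<dots> = (\<integral>\<^sup>+x. u x \<partial>lborel)"
  proof (rule nn_integral_cong_AE)
    show "AE x in lborel. u x * indicator {0<..} x = u x"
      using AE_lborel_singleton[of 0] by eventually_elim (use supp in \<open>auto split: split_indicator\<close>)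
  qed
  finally show ?thesis .
qed

section \<open>Sums of arc densities\<close>

text \<open>\<open>(x + b) / (x + a)\<close> is nondecreasing in \<open>x\<close> for
  \<open>b \<le> a\<close>, so monotonicity with weight \<open>(x + a)\<^sup>2\<close> passes to
  smaller shifts. The shift drops from 1 to 0 before an inversion, from \<open>j\<close> to 1 after
  translating by \<open>j\<close>, and from 2 to 1 when an arc beyond 1 is moved back.\<close>

lemma square_shift_mono:
  fixes x y a b A B :: real
  assumes "0 \<le> x" "x \<le> y" "0 \<le> b" "b \<le> a" "0 < x + a" "0 \<le> A" "0 \<le> B"
    and "(x + a)\<^sup>2 * A \<le> (y + a)\<^sup>2 * B"
  shows "(x + b)\<^sup>2 * A \<le> (y + b)\<^sup>2 * B"
proof -
  have "0 \<le> (a - b) * (y - x)" using assms by (intro mult_nonneg_nonneg) auto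
  then have "(x + b) * (y + a) \<le> (y + b) * (x + a)" by (simp add: algebra_simps)
  then have "((x + b) * (y + a))\<^sup>2 \<le> ((y + b) * (x + a))\<^sup>2"
    using assms by (intro power_mono mult_nonneg_nonneg) auto
  then have "((x + b) * (y + a))\<^sup>2 * B \<le> ((y + b) * (x + a))\<^sup>2 * B"
    using assms by (intro mult_right_mono) auto
  moreover have "(x + b)\<^sup>2 * ((x + a)\<^sup>2 * A) \<le> (x + b)\<^sup>2 * ((y + a)\<^sup>2 * B)"
    using assms by (intro mult_left_mono) auto
  ultimately have "(x + a)\<^sup>2 * ((x + b)\<^sup>2 * A) \<le> (x + a)\<^sup>2 * ((y + b)\<^sup>2 * B)"
    by (simp add: power_mult_distrib mult_ac)
  then show ?thesis using assms by (simp add: mult_le_cancel_left)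
qed

lemma is_intervalD: "is_interval (J :: real set) \<Longrightarrow> a \<in> J \<Longrightarrow> b \<in> J \<Longrightarrow> a \<le> x \<Longrightarrow> x \<le> b \<Longrightarrow> x \<in> J"
  unfolding is_interval_1 by blast

lemma is_interval_translate:
  assumes "is_interval (J :: real set)" shows "is_interval {v. v + c \<in> J}"
  unfolding is_interval_1
proof safe
  fix a b x assume "a + c \<in> J" "b + c \<in> J" "a \<le> x" "x \<le> b"
  then show "x + c \<in> J" using is_intervalD[OF assms, of "a + c" "b + c" "x + c"] by simp
qed

lemma is_interval_borel: "is_interval (J :: real set) \<Longrightarrow> J \<in> sets borel"
  using real_interval_borel_measurable by blast

text \<open>An arc of the circle \<open>\<real>/\<int>\<close> is represented by an interval \<open>J\<close> of length at most 1 in \<open>[0,2)\<close>,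
  so that it may pass through 0. The densities \<open>x \<mapsto> p / (x + d)\<^sup>2\<close> with \<open>d \<ge> 1\<close>
  satisfy the two monotonicity conditions.\<close>

definition arc_density :: "real set \<Rightarrow> (real \<Rightarrow> real) \<Rightarrow> bool" where
  "arc_density J h \<longleftrightarrow> is_interval J \<and> J \<subseteq> {0..<2} \<and> (\<forall>x\<in>J. \<forall>y\<in>J. y - x \<le> 1) \<and>
     h \<in> borel_measurable borel \<and> (\<forall>x. x \<notin> J \<longrightarrow> h x = 0) \<and> (\<forall>x. 0 \<le> h x) \<and>
     (\<forall>x\<in>J. \<forall>y\<in>J. x \<le> y \<longrightarrow> h y \<le> h x \<and> (x + 1)\<^sup>2 * h x \<le> (y + 1)\<^sup>2 * h y)"

definition wrap :: "(real \<Rightarrow> real) \<Rightarrow> real \<Rightarrow> ennreal" where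
  "wrap h x = indicator {0..<1} x * ennreal (h x + h (x + 1))"

text \<open>No infimum over decompositions is taken: \<open>arc_sum u S\<close> asserts one
  countable decomposition into arcs whose suprema are dominated by numbers with sum
  \<open>S\<close>. Linear operations and countable sums then act on the pair of function and
  weight.\<close>

inductive arc_sum :: "(real \<Rightarrow> ennreal) \<Rightarrow> ennreal \<Rightarrow> bool" where
  atom: "arc_density J h \<Longrightarrow> (\<And>x. ennreal (h x) \<le> S) \<Longrightarrow> arc_sum (wrap h) S"
| suminf: "(\<And>i :: nat. arc_sum (u i) (S i)) \<Longrightarrow> arc_sum (\<lambda>x. \<Sum>i. u i x) (\<Sum>i. S i)"

lemma arc_density_0 [simp]: "arc_density {} (\<lambda>x. 0)"
  by (simp add: arc_density_def)

lemma arc_sum_0: "arc_sum (\<lambda>x. 0) S"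
proof -
  have "wrap (\<lambda>x. 0) = (\<lambda>x. 0)" by (auto simp: wrap_def)
  then show ?thesis using atom[OF arc_density_0, of S] by simp
qed

lemma suminf_if_two:
  fixes a b :: ennreal
  shows "(\<Sum>i. if i = 0 then a else if i = Suc 0 then b else 0) = a + b"
  by (subst suminf_finite[of "{0, Suc 0}"]) auto

text \<open>Sums enter the inductive definition only as countable ones, so two summands are padded
  with zeros.\<close>

lemma arc_sum_add:
  assumes "arc_sum u S" "arc_sum v S'" shows "arc_sum (\<lambda>x. u x + v x) (S + S')"
proof -
  define w where "w = (\<lambda>i. if i = 0 then u else if i = Suc 0 then v else (\<lambda>x. 0))"
  define R where "R = (\<lambda>i. if i = 0 then S else if i = Suc 0 then S' else 0)"
  have "arc_sum (\<lambda>x. \<Sum>i. w i x) (\<Sum>i. R i)"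
    by (rule suminf) (auto simp: w_def R_def assms arc_sum_0)
  moreover have "w i x = (if i = 0 then u x else if i = Suc 0 then v x else 0)" for i x
    by (auto simp: w_def)
  ultimately show ?thesis by (simp add: R_def suminf_if_two)
qed

text \<open>The excess weight is assigned to the zero function.\<close>

lemma arc_sum_mono: "arc_sum u S \<Longrightarrow> S \<le> S' \<Longrightarrow> arc_sum u S'"
  using arc_sum_add[OF _ arc_sum_0, of u S "S' - S"] by (simp add: add_diff_inverse_ennreal)

lemma arc_sum_cmult:
  assumes "arc_sum u S" "0 \<le> c" shows "arc_sum (\<lambda>x. ennreal c * u x) (ennreal c * S)"
  using assms(1)
proof induction
  case (atom J h S)
  have "arc_density J (\<lambda>x. c * h x)"
    using atom(1) assms(2) by (auto simp: arc_density_def mult.left_commute intro: mult_left_mono)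
  moreover have "ennreal (c * h x) \<le> ennreal c * S" for x
    using atom assms(2) by (simp add: ennreal_mult' mult_left_mono)
  ultimately have "arc_sum (wrap (\<lambda>x. c * h x)) (ennreal c * S)" by (rule arc_sum.atom)
  moreover have "wrap (\<lambda>x. c * h x) = (\<lambda>x. ennreal c * wrap h x)"
    using assms(2) by (auto simp: wrap_def fun_eq_iff distrib_left[symmetric] ennreal_mult' mult_ac)
  ultimately show ?case by simp
next
  case (suminf u S)
  then show ?case using arc_sum.suminf[of "\<lambda>i x. ennreal c * u i x" "\<lambda>i. ennreal c * S i"] by simp
qed

lemma arc_density_measurable: "arc_density J h \<Longrightarrow> h \<in> borel_measurable borel"
  by (simp add: arc_density_def)

lemma wrap_measurable [measurable]:
  assumes [measurable]: "h \<in> borel_measurable borel"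
  shows "wrap h \<in> borel_measurable borel"
  unfolding wrap_def[abs_def] by measurable

lemma arc_sum_measurable: "arc_sum u S \<Longrightarrow> u \<in> borel_measurable borel"
  by (induction rule: arc_sum.induct) (auto dest: arc_density_measurable)

lemma arc_sum_eq_0: "arc_sum u S \<Longrightarrow> x \<notin> {0..<1} \<Longrightarrow> u x = 0"
  by (induction rule: arc_sum.induct) (auto simp: wrap_def)

text \<open>The factor 2 accounts for a closed arc of length exactly 1, whose two endpoints are the
  same point of the circle.\<close>

lemma arc_sum_le: "arc_sum u S \<Longrightarrow> u x \<le> 2 * S"
proof (induction rule: arc_sum.induct)
  case (atom J h S)
  have "wrap h x \<le> ennreal (h x) + ennreal (h (x + 1))"
    using atom(1) by (auto simp: wrap_def arc_density_def split: split_indicator)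
  also have "\<dots> \<le> S + S" by (intro add_mono atom)
  finally show ?case by (simp add: mult_2)
next
  case (suminf u S)
  have "(\<Sum>i. u i x) \<le> (\<Sum>i. 2 * S i)" by (intro suminf_le suminf summableI)
  then show ?case by simp
qed

section \<open>Mass, supremum and length of an arc\<close>

lemma nn_integral_wrap:
  assumes "arc_density J h"
  shows "(\<integral>\<^sup>+x. wrap h x \<partial>lborel) = (\<integral>\<^sup>+x. ennreal (h x) \<partial>lborel)"
proof -
  note [measurable] = arc_density_measurable[OF assms]
  have h: "0 \<le> h x" "x \<notin> {0..<2} \<Longrightarrow> h x = 0" for x using assms by (auto simp: arc_density_def)
  have "(\<integral>\<^sup>+x. wrap h x \<partial>lborel)
     = (\<integral>\<^sup>+x. ennreal (h x) * indicator {0..<1} x + ennreal (h (x + 1)) * indicator {0..<1} x \<partial>lborel)"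
    using h by (intro nn_integral_cong) (auto simp: wrap_def split: split_indicator)
  also have "\<dots> = (\<integral>\<^sup>+x. ennreal (h x) * indicator {0..<1} x \<partial>lborel)
      + (\<integral>\<^sup>+x. ennreal (h (x + 1)) * indicator {0..<1} x \<partial>lborel)"
    by (rule nn_integral_add) auto
  also have "(\<integral>\<^sup>+x. ennreal (h (x + 1)) * indicator {0..<1} x \<partial>lborel)
      = (\<integral>\<^sup>+x. ennreal (h x) * indicator {1..<2} x \<partial>lborel)"
    by (subst (2) nn_integral_real_affine[where c=1 and t=1])
       (auto simp: add_ac split: split_indicator intro!: nn_integral_cong)
  also have "(\<integral>\<^sup>+x. ennreal (h x) * indicator {0..<1} x \<partial>lborel) + \<dots>
      = (\<integral>\<^sup>+x. ennreal (h x) * indicator {0..<1} x + ennreal (h x) * indicator {1..<2} x \<partial>lborel)"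
    by (rule nn_integral_add[symmetric]) auto
  also have "\<dots> = (\<integral>\<^sup>+x. ennreal (h x) \<partial>lborel)"
    using h(2) by (intro nn_integral_cong) (auto split: split_indicator)
  finally show ?thesis .
qed

lemma short_interval_subset:
  fixes J :: "real set"
  assumes "\<And>x y. x \<in> J \<Longrightarrow> y \<in> J \<Longrightarrow> y - x \<le> l" and "J \<noteq> {}"
  shows "bdd_below J" "J \<subseteq> {Inf J..Inf J + l}"
proof -
  obtain z where z: "z \<in> J" using assms by blast
  have b: "z - l \<le> y" if "y \<in> J" for y using assms(1)[OF that z] by simp
  then show bb: "bdd_below J" by (auto simp: bdd_below_def)
  show "J \<subseteq> {Inf J..Inf J + l}"
  proof
    fix y assume y: "y \<in> J"
    have "y - l \<le> Inf J" using assms(1)[OF _ y] by (intro cInf_greatest[OF assms(2)]) (auto simp: algebra_simps)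
    then show "y \<in> {Inf J..Inf J + l}" using cInf_lower[OF y bb] by auto
  qed
qed

lemma emeasure_short_interval:
  fixes J :: "real set"
  assumes "\<And>x y. x \<in> J \<Longrightarrow> y \<in> J \<Longrightarrow> y - x \<le> l" "0 \<le> l"
  shows "emeasure lborel J \<le> ennreal l"
proof (cases "J = {}")
  case False
  have "emeasure lborel J \<le> emeasure lborel {Inf J..Inf J + l}"
    using short_interval_subset(2)[OF assms(1) False] by (intro emeasure_mono) auto
  then show ?thesis using assms(2) by simp
qed simp

lemma nn_integral_arc_density_le:
  assumes "arc_density J h" "\<And>x. x \<in> J \<Longrightarrow> ennreal (h x) \<le> S" 
    and "\<And>x y. x \<in> J \<Longrightarrow> y \<in> J \<Longrightarrow> y - x \<le> l" "0 \<le> l"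
  shows "(\<integral>\<^sup>+x. ennreal (h x) \<partial>lborel) \<le> S * ennreal l"
proof -
  have J[measurable]: "J \<in> sets borel" using assms(1) by (auto simp: arc_density_def is_interval_borel)
  have "(\<integral>\<^sup>+x. ennreal (h x) \<partial>lborel) \<le> (\<integral>\<^sup>+x. S * indicator J x \<partial>lborel)"
    using assms(1,2) by (intro nn_integral_mono) (auto simp: arc_density_def split: split_indicator)
  also have "\<dots> = S * emeasure lborel J" by (simp add: nn_integral_cmult)
  also have "\<dots> \<le> S * ennreal l"
    by (intro mult_left_mono emeasure_short_interval) (use assms in auto)
  finally show ?thesis .
qed

text \<open>Arcs have length at most 1, so mass never exceeds weight.\<close>

lemma arc_sum_integral_le: "arc_sum u S \<Longrightarrow> (\<integral>\<^sup>+x. u x \<partial>lborel) \<le> S"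
proof (induction rule: arc_sum.induct)
  case (atom J h S)
  then show ?case
    using nn_integral_arc_density_le[OF atom(1), of S 1] by (auto simp: nn_integral_wrap arc_density_def)
next
  case (suminf u S)
  have "(\<integral>\<^sup>+x. (\<Sum>i. u i x) \<partial>lborel) = (\<Sum>i. \<integral>\<^sup>+x. u i x \<partial>lborel)"
    by (rule nn_integral_suminf) (use arc_sum_measurable suminf in auto)
  also have "\<dots> \<le> (\<Sum>i. S i)" by (intro suminf_le suminf summableI)
  finally show ?case .
qed

text \<open>Densities on the half-line, after inversion and before folding. The second monotonicity
  has shift 0 here; folding by an integer shift \<open>j\<close> turns it into shift
  \<open>j\<close>.\<close>

definition ray_density :: "real set \<Rightarrow> (real \<Rightarrow> real) \<Rightarrow> bool" where
  "ray_density P G \<longleftrightarrow> is_interval P \<and> P \<subseteq> {1..} \<and> G \<in> borel_measurable borel \<and> (\<forall>x\<in>P. 0 \<le> G x) \<and>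
     (\<forall>x\<in>P. \<forall>y\<in>P. x \<le> y \<longrightarrow> G y \<le> G x \<and> x\<^sup>2 * G x \<le> y\<^sup>2 * G y)"

lemma ray_densityD:
  assumes "ray_density P G"
  shows "is_interval P" "P \<subseteq> {1..}" "G \<in> borel_measurable borel" "\<And>x. x \<in> P \<Longrightarrow> 0 \<le> G x"
    "\<And>x y. x \<in> P \<Longrightarrow> y \<in> P \<Longrightarrow> x \<le> y \<Longrightarrow> G y \<le> G x"
    "\<And>x y. x \<in> P \<Longrightarrow> y \<in> P \<Longrightarrow> x \<le> y \<Longrightarrow> x\<^sup>2 * G x \<le> y\<^sup>2 * G y"
    "P \<in> sets borel"
  using assms by (auto simp: ray_density_def is_interval_borel)

lemma ray_density_subset: "ray_density P G \<Longrightarrow> is_interval Q \<Longrightarrow> Q \<subseteq> P \<Longrightarrow> ray_density Q G"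
  unfolding ray_density_def by (meson subset_iff)

text \<open>An interval of length at most 1 folds to a single arc even if an integer lies inside it;
  this is what the range [0,2) in \<open>arc_density\<close> is for.\<close>

lemma arc_sum_per_short:
  assumes ray: "ray_density P G"
    and diam: "\<And>x y. x \<in> P \<Longrightarrow> y \<in> P \<Longrightarrow> y - x \<le> 1"
    and S: "\<And>x. x \<in> P \<Longrightarrow> ennreal (G x) \<le> S"
  shows "arc_sum (per (\<lambda>s. ennreal (G s) * indicator P s)) S"
proof (cases "P = {}")
  case True
  then have "per (\<lambda>s. ennreal (G s) * indicator P s) = (\<lambda>x. 0)" by (auto simp: per_def)
  then show ?thesis by (simp add: arc_sum_0)
next
  case False
  note P = ray_densityD(1,2)[OF ray] diam and G0 = ray_densityD(4)[OF ray]
    and mono = ray_densityD(5,6)[OF ray] and [measurable] = ray_densityD(3,7)[OF ray]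
  \<comment> \<open>\<open>Suc k\<close> is the integer part of \<open>Inf P\<close>, so the
    translate of \<open>P\<close> by it starts in [0,1) and ends before 2.\<close>
  define k where "k = nat \<lfloor>Inf P\<rfloor> - 1"
  have "1 \<le> Inf P" using P(2) False by (intro cInf_greatest) auto
  then have k: "real (Suc k) \<le> Inf P" "Inf P < real (Suc k) + 1" by (auto simp: k_def)
  have Pk: "real (Suc k) \<le> s" "s < real (Suc k) + 2" if "s \<in> P" for s
    using short_interval_subset(2)[OF P(3) False] that k by auto
  define J where "J = {x. x + real (Suc k) \<in> P}"
  define h where "h x = (if x \<in> J then G (x + real (Suc k)) else 0)" for x
  have "arc_density J h"
    unfolding arc_density_def
  proof (intro conjI ballI impI allI)
    show "is_interval J" unfolding J_def by (rule is_interval_translate) (rule P(1))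
    show "J \<subseteq> {0..<2}" 
    proof
      fix x assume "x \<in> J"
      then show "x \<in> {0..<2}" using Pk[of "x + real (Suc k)"] by (simp add: J_def)
    qed
    show "y - x \<le> 1" if "x \<in> J" "y \<in> J" for x y
      using P(3)[of "x + real (Suc k)" "y + real (Suc k)"] that by (simp add: J_def)
    show "h \<in> borel_measurable borel" unfolding h_def[abs_def] J_def by measurable
    show "h x = 0" if "x \<notin> J" for x using that by (simp add: h_def)
    show "0 \<le> h x" for x using G0 by (auto simp: h_def J_def)
    fix x y assume xy: "x \<in> J" "y \<in> J" "x \<le> y"
    then show "h y \<le> h x" using mono(1) by (simp add: h_def J_def)
    have "0 \<le> x" using xy(1) Pk[of "x + real (Suc k)"] by (simp add: J_def)
    then show "(x + 1)\<^sup>2 * h x \<le> (y + 1)\<^sup>2 * h y"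
      using xy G0 mono(2)[of "x + real (Suc k)" "y + real (Suc k)"]
      by (intro square_shift_mono[where a="real (Suc k)" and b=1]) (auto simp: h_def J_def)
  qed
  moreover have "ennreal (h x) \<le> S" for x using S by (auto simp: h_def J_def)
  ultimately have "arc_sum (wrap h) S" by (rule arc_sum.atom)
  also have "wrap h = per (\<lambda>s. ennreal (G s) * indicator P s)"
  proof
    fix x
    show "wrap h x = per (\<lambda>s. ennreal (G s) * indicator P s) x"
    proof (cases "x \<in> {0..<1}")
      case True
      have two: "(\<Sum>j\<in>{k, Suc k}. A j) = A k + A (Suc k)" for A :: "nat \<Rightarrow> ennreal" by simp
      have "(\<Sum>j. ennreal (G (x + real (Suc j))) * indicator P (x + real (Suc j)))
          = (\<Sum>j\<in>{k, Suc k}. ennreal (G (x + real (Suc j))) * indicator P (x + real (Suc j)))"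
      proof (rule suminf_finite)
        fix j assume "j \<notin> {k, Suc k}"
        then have "x + real (Suc j) \<notin> P" using Pk[of "x + real (Suc j)"] True by auto
        then show "ennreal (G (x + real (Suc j))) * indicator P (x + real (Suc j)) = 0" by simp
      qed simp
      also have "\<dots> = ennreal (G (x + real (Suc k))) * indicator P (x + real (Suc k))
          + ennreal (G (x + real (Suc (Suc k)))) * indicator P (x + real (Suc (Suc k)))"
        using two[of "\<lambda>j. ennreal (G (x + real (Suc j))) * indicator P (x + real (Suc j))"] .
      also have "\<dots> = ennreal (h x) + ennreal (h (x + 1))"
        by (simp add: h_def J_def add_ac split: split_indicator)
      finally show ?thesis using True G0 by (auto simp: wrap_def per_def h_def J_def)
    qed (auto simp: wrap_def per_def)
  qed
  finally show ?thesis .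
qed

section \<open>Lasota--Yorke inequality\<close>

lemma indicator_unit_pieces:
  fixes P :: "real set"
  assumes "\<And>s. s \<in> P \<Longrightarrow> \<sigma> \<le> s"
  shows "(indicator P s :: ennreal) = (\<Sum>i. indicator (P \<inter> {\<sigma> + real i..<\<sigma> + real i + 1}) s)"
proof (cases "s \<in> P")
  case True
  define k where "k = nat \<lfloor>s - \<sigma>\<rfloor>"
  have k: "\<sigma> + real k \<le> s" "s < \<sigma> + real k + 1" using assms[OF True] by (auto simp: k_def) linarith+
  have "(\<Sum>i. indicator (P \<inter> {\<sigma> + real i..<\<sigma> + real i + 1}) s :: ennreal)
      = (\<Sum>i\<in>{k}. indicator (P \<inter> {\<sigma> + real i..<\<sigma> + real i + 1}) s)"
    by (rule suminf_finite) (use k in \<open>auto split: split_indicator\<close>)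
  then show ?thesis using k True by simp
qed simp

lemma arc_sum_per_pieces:
  assumes ray: "ray_density P G"
    and \<sigma>: "\<And>s. s \<in> P \<Longrightarrow> \<sigma> \<le> s"
    and S: "\<And>i x. x \<in> P \<Longrightarrow> \<sigma> + real i \<le> x \<Longrightarrow> x < \<sigma> + real i + 1 \<Longrightarrow> ennreal (G x) \<le> S i"
  shows "arc_sum (per (\<lambda>s. ennreal (G s) * indicator P s)) (\<Sum>i. S i)"
proof -
  let ?P = "\<lambda>i. P \<inter> {\<sigma> + real i..<\<sigma> + real i + 1}"
  have "arc_sum (per (\<lambda>s. ennreal (G s) * indicator (?P i) s)) (S i)" for i
  proof (rule arc_sum_per_short)
    show "ray_density (?P i) G"
      by (rule ray_density_subset[OF ray is_interval_Int[OF ray_densityD(1)[OF ray]]]) (auto simp: is_interval_1)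
  qed (use S in auto)
  then have "arc_sum (\<lambda>x. \<Sum>i. per (\<lambda>s. ennreal (G s) * indicator (?P i) s) x) (\<Sum>i. S i)"
    by (rule arc_sum.suminf)
  then show ?thesis by (simp add: per_suminf[symmetric] indicator_unit_pieces[OF \<sigma>, symmetric])
qed

text \<open>Cutting at the integers gives pieces of length 1 whose suprema form a convergent series
  of inverse squares.\<close>

lemma arc_sum_per_decay:
  assumes ray: "ray_density P G" and B: "\<And>x. x \<in> P \<Longrightarrow> G x \<le> B / x\<^sup>2" and "0 \<le> B"
  shows "arc_sum (per (\<lambda>s. ennreal (G s) * indicator P s)) (\<Sum>i. ennreal (B / (1 + real i)\<^sup>2))"
proof (rule arc_sum_per_pieces[OF ray, of 1])
  fix i x assume x: "x \<in> P" "1 + real i \<le> x"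
  have "G x \<le> B / x\<^sup>2" by (rule B) fact
  also have "\<dots> \<le> B / (1 + real i)\<^sup>2" using x \<open>0 \<le> B\<close> by (intro divide_left_mono power_mono) auto
  finally show "ennreal (G x) \<le> ennreal (B / (1 + real i)\<^sup>2)" by (rule ennreal_leI)
qed (use ray_densityD(2)[OF ray] in auto)

lemma suminf_case_nat_ennreal:
  fixes f :: "nat \<Rightarrow> ennreal"
  shows "(\<Sum>i. case i of 0 \<Rightarrow> a | Suc j \<Rightarrow> f j) = a + (\<Sum>j. f j)"
  by (subst suminf_offset[where i=1]) (auto simp: add_ac)

text \<open>Cut into unit pieces from the left end. As \<open>G\<close> decreases, its supremum on
  each later piece is at most the mass of the full piece before it. On the first piece, itself full,
  \<open>G\<close> varies by a factor of at most 4. The weight is thus at most 4 + 1 times the mass,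
  with no reference to the supremum.\<close>

lemma arc_sum_per_long:
  assumes ray: "ray_density P G" and xy: "x0 \<in> P" "y0 \<in> P" "1 < y0 - x0"
  shows "arc_sum (per (\<lambda>s. ennreal (G s) * indicator P s))
    (5 * (\<integral>\<^sup>+x. per (\<lambda>s. ennreal (G s) * indicator P s) x \<partial>lborel))"
proof -
  note [measurable] = ray_densityD(3,7)[OF ray]
  define \<sigma> where "\<sigma> = Inf P"
  have bdd: "bdd_below P" using ray_densityD(2)[OF ray] by (auto intro: bdd_below_mono)
  have \<sigma>: "\<sigma> \<le> s" if "s \<in> P" for s using cInf_lower[OF that bdd] by (simp add: \<sigma>_def)
  have inP: "s \<in> P" if st: "\<sigma> < s" "s < t" "t \<in> P" for s t
  proof -
    obtain z where "z \<in> P" "z < s" using cInf_lessD[of P s] st(1) xy(1) by (auto simp: \<sigma>_def)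
    then show ?thesis using ray_densityD(1)[OF ray] st(2,3) by (meson is_intervalD less_imp_le)
  qed
  define m where "m i = (\<integral>\<^sup>+s. ennreal (G s) * indicator (P \<inter> {\<sigma> + real i..<\<sigma> + real i + 1}) s \<partial>lborel)" for i :: nat
  have le_m: "ennreal c \<le> m i" if "\<And>s. \<sigma> + real i < s \<Longrightarrow> s < \<sigma> + real i + 1 \<Longrightarrow> s \<in> P \<and> c \<le> G s" for c i
  proof -
    have "ennreal c = (\<integral>\<^sup>+s. ennreal c * indicator {\<sigma> + real i<..<\<sigma> + real i + 1} s \<partial>lborel)"
      by (simp add: nn_integral_cmult_indicator)
    also have "\<dots> \<le> m i"
      unfolding m_def using that by (intro nn_integral_mono) (auto split: split_indicator intro: ennreal_leI)
    finally show ?thesis .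
  qed
  have bound: "ennreal (G x) \<le> (case i of 0 \<Rightarrow> 4 * m 0 | Suc j \<Rightarrow> m j)"
    if x: "x \<in> P" "\<sigma> + real i \<le> x" "x < \<sigma> + real i + 1" for i x
  proof (cases i)
    case 0
    have "ennreal (G x / 4) \<le> m 0"
    proof (rule le_m)
      fix s assume s: "\<sigma> + real 0 < s" "s < \<sigma> + real 0 + 1"
      then have sP: "s \<in> P" using inP[of s y0] xy \<sigma>[OF xy(1)] by auto
      have "1 \<le> x" "1 \<le> s" using ray_densityD(2)[OF ray] x sP by auto
      have "G x \<le> 4 * G s"
      proof (cases "s \<le> x")
        case True
        then show ?thesis using ray_densityD(5)[OF ray sP x(1)] ray_densityD(4)[OF ray x(1)] by auto
      next
        case False
        \<comment> \<open>Both points lie within distance 1 and \<open>x \<ge> 1\<close>; squaring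
          gives the factor 4.\<close>
        have "s \<le> 2 * x" using s x 0 \<open>1 \<le> x\<close> by auto
        have "x\<^sup>2 * G x \<le> s\<^sup>2 * G s" using ray_densityD(6)[OF ray x(1) sP] False by simp
        also have "\<dots> \<le> (2 * x)\<^sup>2 * G s"
          using \<open>s \<le> 2 * x\<close> \<open>1 \<le> s\<close> ray_densityD(4)[OF ray sP] by (intro mult_right_mono power_mono) auto
        finally show ?thesis using \<open>1 \<le> x\<close> by (simp add: power_mult_distrib)
      qed
      then show "s \<in> P \<and> G x / 4 \<le> G s" using sP by simp
    qed
    then have "4 * ennreal (G x / 4) \<le> 4 * m 0" by (rule mult_left_mono) simp
    moreover have "4 * ennreal (G x / 4) = ennreal (G x)"
      using ennreal_mult[of 4 "G x / 4"] ray_densityD(4)[OF ray x(1)] by simp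
    ultimately show ?thesis using 0 by simp
  next
    case (Suc j)
    have "ennreal (G x) \<le> m j"
    proof (rule le_m)
      fix s assume s: "\<sigma> + real j < s" "s < \<sigma> + real j + 1"
      then have "\<sigma> < s" "s < x" using x Suc by auto
      then have sP: "s \<in> P" using inP x(1) by blast
      then show "s \<in> P \<and> G x \<le> G s" using ray_densityD(5)[OF ray sP x(1)] \<open>s < x\<close> by simp
    qed
    then show ?thesis using Suc by simp
  qed
  have tot: "(\<Sum>i. m i) = (\<integral>\<^sup>+x. per (\<lambda>s. ennreal (G s) * indicator P s) x \<partial>lborel)"
  proof -
    have "(\<Sum>i. m i) = (\<integral>\<^sup>+s. (\<Sum>i. ennreal (G s) * indicator (P \<inter> {\<sigma> + real i..<\<sigma> + real i + 1}) s) \<partial>lborel)"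
      unfolding m_def by (rule nn_integral_suminf[symmetric]) measurable
    also have "\<dots> = (\<integral>\<^sup>+s. ennreal (G s) * indicator P s \<partial>lborel)"
      by (simp add: indicator_unit_pieces[OF \<sigma>, symmetric])
    also have "\<dots> = (\<integral>\<^sup>+s. ennreal (G s) * indicator P s * indicator {1..} s \<partial>lborel)"
      using ray_densityD(2)[OF ray] by (intro nn_integral_cong) (auto split: split_indicator)
    also have "\<dots> = (\<integral>\<^sup>+x. per (\<lambda>s. ennreal (G s) * indicator P s) x \<partial>lborel)"
      by (rule nn_integral_per[symmetric]) measurable
    finally show ?thesis .
  qed
  have "m 0 \<le> (\<Sum>i. m i)" using sum_le_suminf[OF summableI, of "{0}" m] by simp
  then have "(\<Sum>i. case i of 0 \<Rightarrow> 4 * m 0 | Suc j \<Rightarrow> m j) \<le> 4 * (\<Sum>i. m i) + (\<Sum>i. m i)"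
    by (subst suminf_case_nat_ennreal) (intro add_mono mult_left_mono, auto)
  also have "4 * (\<Sum>i. m i) + (\<Sum>i. m i) = 5 * (\<Sum>i. m i)"
    using distrib_right[of 4 1 "\<Sum>i. m i"] by simp
  finally have le: "(\<Sum>i. case i of 0 \<Rightarrow> 4 * m 0 | Suc j \<Rightarrow> m j) \<le> 5 * (\<Sum>i. m i)" .
  have "arc_sum (per (\<lambda>s. ennreal (G s) * indicator P s)) (\<Sum>i. case i of 0 \<Rightarrow> 4 * m 0 | Suc j \<Rightarrow> m j)"
    by (rule arc_sum_per_pieces[OF ray \<sigma> bound])
  from arc_sum_mono[OF this le] show ?thesis unfolding tot .
qed

definition inv_set :: "real \<Rightarrow> real set \<Rightarrow> real set" where
  "inv_set \<gamma> J = {s. 1 \<le> s \<and> \<gamma> / s \<in> J}"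

lemma gauss_eq_per:
  assumes "\<And>v. v \<in> J \<Longrightarrow> 0 \<le> h v" "0 < \<gamma>"
  shows "gauss \<gamma> (\<lambda>v. ennreal (h v) * indicator J v)
    = per (\<lambda>s. ennreal (h (\<gamma> / s) * (\<gamma> / s\<^sup>2)) * indicator (inv_set \<gamma> J) s)"
proof -
  have "ennreal (h (\<gamma> / s)) * indicator J (\<gamma> / s) * ennreal (\<gamma> / s\<^sup>2)
     = ennreal (h (\<gamma> / s) * (\<gamma> / s\<^sup>2)) * indicator (inv_set \<gamma> J) s" if "1 \<le> s" for s
    using assms that by (auto simp: inv_set_def ennreal_mult[symmetric] split: split_indicator)
  then show ?thesis by (intro ext) (simp add: gauss_def per_def inv_pf_def split: split_indicator)
qed

lemma is_interval_inv_set: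
  assumes J: "is_interval J" "0 < \<gamma>" shows "is_interval (inv_set \<gamma> J)"
  unfolding is_interval_1 inv_set_def
proof safe
  fix a b x assume *: "1 \<le> a" "\<gamma> / a \<in> J" "\<gamma> / b \<in> J" "a \<le> x" "x \<le> b"
  then show "1 \<le> x" by simp
  show "\<gamma> / x \<in> J"
    by (rule is_intervalD[OF J(1) *(3) *(2)]) (use * J(2) in \<open>auto intro!: divide_left_mono\<close>)
qed

text \<open>The new density equals \<open>(\<gamma> / s)\<^sup>2 * h (\<gamma> / s)\<close> divided
  by \<gamma>, and \<open>s\<^sup>2\<close> times it is \<open>\<gamma> * h (\<gamma> / s)\<close>.
  Since \<open>\<gamma> / s\<close> decreases in \<open>s\<close>, each monotonicity condition on
  \<open>h\<close> yields the other one for the image.\<close>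

lemma ray_density_inversion:
  assumes J: "is_interval J" "J \<subseteq> {0..}" and \<gamma>: "0 < \<gamma>"
    and h: "h \<in> borel_measurable borel" "\<And>x. x \<in> J \<Longrightarrow> 0 \<le> h x"
    and mono: "\<And>x y. x \<in> J \<Longrightarrow> y \<in> J \<Longrightarrow> x \<le> y \<Longrightarrow> h y \<le> h x \<and> (x + 1)\<^sup>2 * h x \<le> (y + 1)\<^sup>2 * h y"
  shows "ray_density (inv_set \<gamma> J) (\<lambda>s. h (\<gamma> / s) * (\<gamma> / s\<^sup>2))"
  unfolding ray_density_def
proof (intro conjI ballI impI)
  note [measurable] = h(1)
  show "(\<lambda>s. h (\<gamma> / s) * (\<gamma> / s\<^sup>2)) \<in> borel_measurable borel" by measurable
  show "is_interval (inv_set \<gamma> J)" by (rule is_interval_inv_set) fact+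
  fix s t assume "s \<in> inv_set \<gamma> J" "t \<in> inv_set \<gamma> J" "s \<le> t"
  then have s: "1 \<le> s" "\<gamma> / s \<in> J" and t: "1 \<le> t" "\<gamma> / t \<in> J" and ts: "\<gamma> / t \<le> \<gamma> / s"
    using \<gamma> by (auto simp: inv_set_def intro!: divide_left_mono)
  have "(\<gamma> / t + 0)\<^sup>2 * h (\<gamma> / t) \<le> (\<gamma> / s + 0)\<^sup>2 * h (\<gamma> / s)"
    by (rule square_shift_mono[where a=1]) (use mono[OF t(2) s(2) ts] h(2) s t ts \<gamma> in \<open>auto intro: add_nonneg_pos\<close>)
  then show "h (\<gamma> / t) * (\<gamma> / t\<^sup>2) \<le> h (\<gamma> / s) * (\<gamma> / s\<^sup>2)"
    using \<gamma> mult_left_mono[of "(\<gamma> / t)\<^sup>2 * h (\<gamma> / t)" "(\<gamma> / s)\<^sup>2 * h (\<gamma> / s)" "1 / \<gamma>"]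
    by (simp add: power_divide power2_eq_square mult_ac)
  show "s\<^sup>2 * (h (\<gamma> / s) * (\<gamma> / s\<^sup>2)) \<le> t\<^sup>2 * (h (\<gamma> / t) * (\<gamma> / t\<^sup>2))"
    using mono[OF t(2) s(2) ts] s t \<gamma> by simp
qed (use \<gamma> h(2) in \<open>auto simp: inv_set_def\<close>)

text \<open>A piece that does not pass through 0 has an interval as image. If the image is longer
  than 1, its weight is bounded by mass alone; otherwise it is one arc whose supremum has shrunk by
  the factor \<open>1 / \<gamma>\<close>.\<close>

lemma arc_sum_gauss_part:
  assumes J: "is_interval J" "J \<subseteq> {0..1}" and \<gamma>: "1 < \<gamma>"
    and h: "h \<in> borel_measurable borel" "\<And>x. x \<in> J \<Longrightarrow> 0 \<le> h x"
    and mono: "\<And>x y. x \<in> J \<Longrightarrow> y \<in> J \<Longrightarrow> x \<le> y \<Longrightarrow> h y \<le> h x \<and> (x + 1)\<^sup>2 * h x \<le> (y + 1)\<^sup>2 * h y"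
    and S: "\<And>x. x \<in> J \<Longrightarrow> ennreal (h x) \<le> S"
  defines "u \<equiv> (\<lambda>v. ennreal (h v) * indicator J v)"
  shows "x0 \<in> inv_set \<gamma> J \<Longrightarrow> y0 \<in> inv_set \<gamma> J \<Longrightarrow> 1 < y0 - x0 \<Longrightarrow>
      arc_sum (gauss \<gamma> u) (5 * (\<integral>\<^sup>+x. u x \<partial>lborel))"
    and "arc_sum (gauss \<gamma> u) (ennreal (1 / \<gamma>) * S + 5 * (\<integral>\<^sup>+x. u x \<partial>lborel))"
proof -
  have ray: "ray_density (inv_set \<gamma> J) (\<lambda>s. h (\<gamma> / s) * (\<gamma> / s\<^sup>2))"
    by (rule ray_density_inversion) (use assms in auto)
  have eq: "gauss \<gamma> u = per (\<lambda>s. ennreal (h (\<gamma> / s) * (\<gamma> / s\<^sup>2)) * indicator (inv_set \<gamma> J) s)"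
    unfolding u_def by (rule gauss_eq_per) (use assms in auto)
  have int: "(\<integral>\<^sup>+x. gauss \<gamma> u x \<partial>lborel) = (\<integral>\<^sup>+x. u x \<partial>lborel)"
  proof (rule nn_integral_gauss)
    note [measurable] = h(1) is_interval_borel[OF J(1)]
    show "u \<in> borel_measurable borel" unfolding u_def by measurable
    show "u x = 0" if "x \<notin> {0..\<gamma>}" for x using that J(2) \<gamma> by (auto simp: u_def split: split_indicator)
  qed (use \<gamma> in simp)
  show *: "arc_sum (gauss \<gamma> u) (5 * (\<integral>\<^sup>+x. u x \<partial>lborel))"
    if "x0 \<in> inv_set \<gamma> J" "y0 \<in> inv_set \<gamma> J" "1 < y0 - x0" for x0 y0
    using arc_sum_per_long[OF ray that] unfolding eq[symmetric] int .
  show "arc_sum (gauss \<gamma> u) (ennreal (1 / \<gamma>) * S + 5 * (\<integral>\<^sup>+x. u x \<partial>lborel))"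
  proof (cases "\<exists>x0\<in>inv_set \<gamma> J. \<exists>y0\<in>inv_set \<gamma> J. 1 < y0 - x0")
    case True
    then show ?thesis using * arc_sum_mono by (metis le_iff_add add.commute)
  next
    case False
    have "arc_sum (gauss \<gamma> u) (ennreal (1 / \<gamma>) * S)"
      unfolding eq
    proof (rule arc_sum_per_short[OF ray])
      show "y - x \<le> 1" if "x \<in> inv_set \<gamma> J" "y \<in> inv_set \<gamma> J" for x y
        using False that by (meson not_less)
      fix s assume s: "s \<in> inv_set \<gamma> J"
      then have "\<gamma> / s \<le> 1" "1 \<le> s" "\<gamma> / s \<in> J" using J by (auto simp: inv_set_def)
      then have "\<gamma> \<le> s" by (simp add: field_simps)
      \<comment> \<open>\<open>s \<ge> \<gamma>\<close> because \<open>J\<close> lies in [0,1]; this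
        is the contraction of the inverse branches.\<close>
      have "\<gamma> / s\<^sup>2 \<le> \<gamma> / \<gamma>\<^sup>2" using \<gamma> \<open>\<gamma> \<le> s\<close> by (intro divide_left_mono power_mono) auto
      then have "h (\<gamma> / s) * (\<gamma> / s\<^sup>2) \<le> h (\<gamma> / s) * (1 / \<gamma>)"
        using h(2)[OF \<open>\<gamma> / s \<in> J\<close>] \<gamma> by (intro mult_left_mono) (auto simp: power2_eq_square)
      then have "ennreal (h (\<gamma> / s) * (\<gamma> / s\<^sup>2)) \<le> ennreal (1 / \<gamma>) * ennreal (h (\<gamma> / s))"
        using h(2)[OF \<open>\<gamma> / s \<in> J\<close>] \<gamma> by (subst ennreal_mult[symmetric]) (auto simp: mult_ac intro: ennreal_leI)
      also have "\<dots> \<le> ennreal (1 / \<gamma>) * S" by (intro mult_left_mono S) (fact, simp)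
      finally show "ennreal (h (\<gamma> / s) * (\<gamma> / s\<^sup>2)) \<le> ennreal (1 / \<gamma>) * S" .
    qed
    then show ?thesis using arc_sum_mono by (metis le_iff_add)
  qed
qed

lemma wrap_split:
  assumes "arc_density J h"
  shows "wrap h = (\<lambda>v. ennreal (h v) * indicator (J \<inter> {0..<1}) v
    + ennreal (h (v + 1)) * indicator {v. 0 \<le> v \<and> v + 1 \<in> J} v)"
proof
  fix v
  show "wrap h v = ennreal (h v) * indicator (J \<inter> {0..<1}) v
    + ennreal (h (v + 1)) * indicator {v. 0 \<le> v \<and> v + 1 \<in> J} v"
    using assms by (cases "v \<in> {0..<1}") (auto simp: wrap_def arc_density_def split: split_indicator)
qed

text \<open>Each of the two pieces could contribute \<open>S / \<gamma>\<close>. If both are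
  present, the arc passes through 0, so \<open>J2\<close> contains an interval (0,y] whose image is
  a half-line; only \<open>J1\<close> then contributes the supremum term, and the factor stays
  \<open>1 / \<gamma>\<close>.\<close>

lemma arc_sum_gauss_atom:
  assumes \<gamma>: "1 < \<gamma>" and arc: "arc_density J h" and S: "\<And>x. ennreal (h x) \<le> S"
  shows "arc_sum (gauss \<gamma> (wrap h)) (ennreal (1 / \<gamma>) * S + 5 * (\<integral>\<^sup>+x. wrap h x \<partial>lborel))"
proof -
  define J1 J2 where "J1 = J \<inter> {0..<1}" and "J2 = {v. 0 \<le> v \<and> v + 1 \<in> J}"
  define u1 u2 where "u1 = (\<lambda>v. ennreal (h v) * indicator J1 v)" and "u2 = (\<lambda>v. ennreal (h (v + 1)) * indicator J2 v)"
  have J: "is_interval J" "J \<subseteq> {0..<2}" and [measurable]: "h \<in> borel_measurable borel" and h0: "\<And>x. 0 \<le> h x"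
    and mono: "\<And>x y. x \<in> J \<Longrightarrow> y \<in> J \<Longrightarrow> x \<le> y \<Longrightarrow> h y \<le> h x \<and> (x + 1)\<^sup>2 * h x \<le> (y + 1)\<^sup>2 * h y"
    using arc by (auto simp: arc_density_def)
  have J1: "is_interval J1" "J1 \<subseteq> {0..1}" and J2: "is_interval J2" "J2 \<subseteq> {0..1}"
  proof -
    show "is_interval J1"
      unfolding J1_def by (rule is_interval_Int[OF J(1)]) (auto simp: is_interval_1)
    have "J2 = {0..} \<inter> {v. v + 1 \<in> J}" by (auto simp: J2_def)
    moreover have "is_interval {0 :: real..}" by (auto simp: is_interval_1)
    ultimately show "is_interval J2" using is_interval_translate[OF J(1)] by (simp add: is_interval_Int)
  qed (use J in \<open>auto simp: J1_def J2_def\<close>)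
  note [measurable] = is_interval_borel[OF J1(1)] is_interval_borel[OF J2(1)]
  have mono2: "h (y + 1) \<le> h (x + 1) \<and> (x + 1)\<^sup>2 * h (x + 1) \<le> (y + 1)\<^sup>2 * h (y + 1)"
    if "x \<in> J2" "y \<in> J2" "x \<le> y" for x y
  proof
    have *: "x + 1 \<in> J" "y + 1 \<in> J" "x + 1 \<le> y + 1" "0 \<le> x" using that by (auto simp: J2_def)
    show "h (y + 1) \<le> h (x + 1)" using mono[OF *(1-3)] by simp
    show "(x + 1)\<^sup>2 * h (x + 1) \<le> (y + 1)\<^sup>2 * h (y + 1)"
      by (rule square_shift_mono[where a=2]) (use mono[OF *(1-3)] * h0 in \<open>auto simp: add_ac\<close>)
  qed
  have split: "wrap h = (\<lambda>v. u1 v + u2 v)"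
    by (simp add: wrap_split[OF arc] u1_def u2_def J1_def J2_def)
  have [measurable]: "u1 \<in> borel_measurable borel" "u2 \<in> borel_measurable borel"
    unfolding u1_def u2_def by measurable
  have "5 * (\<integral>\<^sup>+x. wrap h x \<partial>lborel) = 5 * (\<integral>\<^sup>+x. u1 x \<partial>lborel) + 5 * (\<integral>\<^sup>+x. u2 x \<partial>lborel)"
    by (simp add: split nn_integral_add distrib_left)
  moreover have "arc_sum (gauss \<gamma> (wrap h))
    (ennreal (1 / \<gamma>) * S + (5 * (\<integral>\<^sup>+x. u1 x \<partial>lborel) + 5 * (\<integral>\<^sup>+x. u2 x \<partial>lborel)))"
  proof -
    have p1: "arc_sum (gauss \<gamma> u1) (ennreal (1 / \<gamma>) * S + 5 * (\<integral>\<^sup>+x. u1 x \<partial>lborel))"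
      unfolding u1_def by (rule arc_sum_gauss_part(2)[OF J1 \<gamma>]) (use h0 mono S in \<open>auto simp: J1_def\<close>)
    have p2: "arc_sum (gauss \<gamma> u2) (ennreal (1 / \<gamma>) * S + 5 * (\<integral>\<^sup>+x. u2 x \<partial>lborel))"
      unfolding u2_def by (rule arc_sum_gauss_part(2)[OF J2 \<gamma>]) (use h0 mono2 S in \<open>auto simp: J2_def\<close>)
    consider "J1 = {}" | "J2 \<subseteq> {0}" | x y where "x \<in> J1" "y \<in> J2" "0 < y"
      using J2(2) by force
    then show ?thesis
    proof cases
      case 1
      then have "u1 = (\<lambda>x. 0)" by (auto simp: u1_def)
      then show ?thesis using p2 split by simp
    next
      case 2
      \<comment> \<open>\<open>\<gamma> / s\<close> is positive for \<open>s \<ge> 1\<close>, so the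
        single point 0 has no image at all.\<close>
      have "inv_set \<gamma> J2 = {}" using 2 \<gamma> by (auto simp: inv_set_def)
      then have "gauss \<gamma> u2 = (\<lambda>x. 0)"
        unfolding u2_def using h0 \<gamma> by (subst gauss_eq_per) (auto simp: per_def)
      then have "arc_sum (gauss \<gamma> (wrap h)) (ennreal (1 / \<gamma>) * S + 5 * (\<integral>\<^sup>+x. u1 x \<partial>lborel))"
        unfolding split gauss_add using p1 by simp
      then show ?thesis by (rule arc_sum_mono) (simp add: add_left_mono)
    next
      case (3 x y)
      have "z \<in> J2" if "0 < z" "z \<le> y" for z
        using is_intervalD[OF J(1), of x "y + 1" "z + 1"] 3 that by (auto simp: J1_def J2_def)
      moreover have "y < 1" using 3(2) J(2) by (auto simp: J2_def)
      moreover have "\<gamma> / (\<gamma> / y + 2) \<le> y" "1 \<le> \<gamma> / y" using 3(3) \<gamma> \<open>y < 1\<close> by (auto simp: field_simps)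
      moreover have "0 < \<gamma> / (\<gamma> / y + 2)" using 3(3) \<gamma> by (intro divide_pos_pos add_pos_pos) auto
      \<comment> \<open>The image of (0,y] is everything from \<open>\<gamma> / y\<close> on; any
        two points of it more than 1 apart show that it is long.\<close>
      ultimately have "\<gamma> / y \<in> inv_set \<gamma> J2" "\<gamma> / y + 2 \<in> inv_set \<gamma> J2"
        using 3(3) \<gamma> by (auto simp: inv_set_def)
      then have "arc_sum (gauss \<gamma> u2) (5 * (\<integral>\<^sup>+x. u2 x \<partial>lborel))"
        unfolding u2_def using arc_sum_gauss_part(1)[OF J2 \<gamma>, of "\<lambda>v. h (v + 1)" S "\<gamma> / y" "\<gamma> / y + 2"] h0 mono2 S
        by auto
      from arc_sum_add[OF p1 this] show ?thesis by (simp add: split gauss_add add_ac)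
    qed
  qed
  ultimately show ?thesis by simp
qed

text \<open>Weight plays the part of the strong norm and mass that of the weak norm. Mass is
  conserved, so iterating keeps the weight bounded by a multiple of the mass plus a geometrically
  vanishing term.\<close>

theorem arc_sum_gauss:
  assumes \<gamma>: "1 < \<gamma>" and "arc_sum u S"
  shows "arc_sum (gauss \<gamma> u) (ennreal (1 / \<gamma>) * S + 5 * (\<integral>\<^sup>+x. u x \<partial>lborel))"
  using assms(2)
proof induction
  case (atom J h S)
  then show ?case using arc_sum_gauss_atom[OF \<gamma>] by blast
next
  case (suminf u S)
  have "arc_sum (\<lambda>x. \<Sum>i. gauss \<gamma> (u i) x) (\<Sum>i. ennreal (1 / \<gamma>) * S i + 5 * (\<integral>\<^sup>+x. u i x \<partial>lborel))"
    by (rule arc_sum.suminf) (rule suminf)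
  moreover have "(\<integral>\<^sup>+x. (\<Sum>i. u i x) \<partial>lborel) = (\<Sum>i. \<integral>\<^sup>+x. u i x \<partial>lborel)"
    by (rule nn_integral_suminf) (use arc_sum_measurable suminf in auto)
  ultimately show ?case by (simp add: gauss_suminf suminf_add[symmetric])
qed

section \<open>Spreading of mass\<close>

lemma gauss_funpow_add: "(gauss \<gamma> ^^ n) (\<lambda>x. u x + v x) = (\<lambda>x. (gauss \<gamma> ^^ n) u x + (gauss \<gamma> ^^ n) v x)"
  by (induction n) (simp_all add: gauss_add)

lemma gauss_funpow_cmult: "(gauss \<gamma> ^^ n) (\<lambda>x. c * u x) = (\<lambda>x. c * (gauss \<gamma> ^^ n) u x)"
  by (induction n) (simp_all add: gauss_cmult)

lemma gauss_funpow_suminf: "(gauss \<gamma> ^^ n) (\<lambda>x. \<Sum>i. u i x) = (\<lambda>x. \<Sum>i. (gauss \<gamma> ^^ n) (u i) x)"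
  by (induction n) (simp_all add: gauss_suminf)

text \<open>Crude growth for boundedly many steps: mass is at most weight, so one step costs a
  factor of at most 1 + 5.\<close>

lemma arc_sum_gauss_funpow:
  assumes "1 < \<gamma>" "arc_sum u S"
  shows "arc_sum ((gauss \<gamma> ^^ n) u) (6 ^ n * S)"
proof (induction n)
  case (Suc n)
  let ?u = "(gauss \<gamma> ^^ n) u"
  have "ennreal (1 / \<gamma>) * (6 ^ n * S) + 5 * (\<integral>\<^sup>+x. ?u x \<partial>lborel) \<le> 1 * (6 ^ n * S) + 5 * (6 ^ n * S)"
    using assms(1) arc_sum_integral_le[OF Suc] by (intro add_mono mult_mono) (auto simp: ennreal_le_1)
  also have "\<dots> = 6 ^ Suc n * S" using distrib_right[of 1 5 "6 ^ n * S"] by (simp add: mult_ac)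
  finally show ?case using arc_sum_mono[OF arc_sum_gauss[OF assms(1) Suc]] by simp
qed (use assms in simp)

definition unif :: "real \<Rightarrow> ennreal" where
  "unif = indicator {0<..<1}"

lemma arc_density_restrict:
  assumes "arc_density J h" "is_interval Q" "Q \<subseteq> J"
  shows "arc_density Q (\<lambda>x. h x * indicator Q x)"
proof -
  note [measurable] = arc_density_measurable[OF assms(1)] is_interval_borel[OF assms(2)]
  have "(\<lambda>x. h x * indicator Q x) \<in> borel_measurable borel" by measurable
  moreover have "(\<forall>x\<in>Q. \<forall>y\<in>Q. y - x \<le> 1)"
    and "\<forall>x\<in>Q. \<forall>y\<in>Q. x \<le> y \<longrightarrow> h y \<le> h x \<and> (x + 1)\<^sup>2 * h x \<le> (y + 1)\<^sup>2 * h y"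
    and "Q \<subseteq> {0..<2}" and "\<forall>x. 0 \<le> h x"
    using assms(1,3) unfolding arc_density_def by (meson subset_iff)+
  ultimately show ?thesis using assms(2) by (simp add: arc_density_def)
qed

lemma arc_density_const:
  assumes "0 \<le> a" "b \<le> 1" "0 \<le> c"
  shows "arc_density {a<..<b} (\<lambda>x. c * indicator {a<..<b} x)"
  unfolding arc_density_def
proof (intro conjI ballI impI allI)
  show "is_interval {a<..<b}" by (auto simp: is_interval_1)
qed (use assms in \<open>auto intro!: mult_right_mono mult_left_mono power_mono split: split_indicator\<close>)

lemma unif_eq_wrap: "unif = wrap (\<lambda>x. 1 * indicator {0<..<1} x)"
  by (auto simp: unif_def wrap_def fun_eq_iff split: split_indicator)

lemma arc_sum_unif: "arc_sum unif 1"
  unfolding unif_eq_wrap by (rule arc_sum.atom[OF arc_density_const]) (auto split: split_indicator)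

lemma nn_integral_unif: "(\<integral>\<^sup>+x. unif x \<partial>lborel) = 1"
  by (simp add: unif_def)

text \<open>The value of the Riemann zeta function at 2; it collects the weights of a density with
  inverse-square decay.\<close>

definition zeta2 :: real where "zeta2 = (\<Sum>i. 1 / (1 + real i)\<^sup>2)"

lemma summable_zeta2: "summable (\<lambda>i. 1 / (1 + real i)\<^sup>2)"
  using inverse_squares_sums sums_summable by (auto simp: add_ac)

lemma zeta2_nonneg: "0 \<le> zeta2"
  unfolding zeta2_def by (intro suminf_nonneg summable_zeta2) auto

lemma suminf_decay: "0 \<le> B \<Longrightarrow> (\<Sum>i. ennreal (B / (1 + real i)\<^sup>2)) = ennreal (B * zeta2)"
  using suminf_mult[OF summable_zeta2, of B] summable_mult[OF summable_zeta2, of B]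
  by (subst suminf_ennreal2) (auto simp: zeta2_def)

text \<open>A quantitative form of "the image of \<open>I\<close> becomes the whole circle". A lower
  bound for the iterate would not be enough: what remains after removing the uniform part must again
  be a sum of arcs, since the removal is repeated later. The constants are uniform over all
  densities on \<open>I\<close>.\<close>

definition spreads :: "real \<Rightarrow> nat \<Rightarrow> real set \<Rightarrow> real \<Rightarrow> real \<Rightarrow> bool" where
  "spreads \<gamma> n I c C \<longleftrightarrow> 0 < c \<and> 0 \<le> C \<and>
    (\<forall>h p S. arc_density I h \<longrightarrow> 0 \<le> p \<longrightarrow> 0 \<le> S \<longrightarrow> (\<forall>x\<in>I. p \<le> h x \<and> h x \<le> S) \<longrightarrow>
      (\<exists>r. (gauss \<gamma> ^^ n) (wrap h) = (\<lambda>x. ennreal (c * p) * unif x + r x) \<and> arc_sum r (ennreal (C * S))))"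

lemma spreadsE:
  assumes "spreads \<gamma> n I c C" "arc_density I h" "0 \<le> p" "0 \<le> S" "\<And>x. x \<in> I \<Longrightarrow> p \<le> h x \<and> h x \<le> S"
  obtains r where "(gauss \<gamma> ^^ n) (wrap h) = (\<lambda>x. ennreal (c * p) * unif x + r x)" "arc_sum r (ennreal (C * S))"
proof -
  have "\<forall>x\<in>I. p \<le> h x \<and> h x \<le> S" using assms(5) by blast
  with assms(1-4) have "\<exists>r. (gauss \<gamma> ^^ n) (wrap h) = (\<lambda>x. ennreal (c * p) * unif x + r x) \<and> arc_sum r (ennreal (C * S))"
    unfolding spreads_def by blast
  then show thesis using that by blast
qed

section \<open>Following one branch of the map\<close>

lemma wrap_Ioo:
  assumes "arc_density {a<..<b} h" "0 \<le> a" "b \<le> 1"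
  shows "wrap h = (\<lambda>x. ennreal (h x) * indicator {a<..<b} x)"
proof
  fix x
  have "h x = 0" if "x \<notin> {a<..<b}" for x using assms(1) that unfolding arc_density_def by blast
  then show "wrap h x = ennreal (h x) * indicator {a<..<b} x"
    using assms(2,3) by (auto simp: wrap_def split: split_indicator)
qed

lemma per_translate:
  assumes "0 \<le> \<alpha>" "\<beta> \<le> 1" "1 \<le> j"
  shows "per (\<lambda>s. F s * indicator {real j + \<alpha><..<real j + \<beta>} s)
    = (\<lambda>x. F (x + real j) * indicator {\<alpha><..<\<beta>} x)"
proof
  fix x
  show "per (\<lambda>s. F s * indicator {real j + \<alpha><..<real j + \<beta>} s) x = F (x + real j) * indicator {\<alpha><..<\<beta>} x"
  proof (cases "x \<in> {0..<1}")
    case True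
    have "(\<Sum>i. F (x + real (Suc i)) * indicator {real j + \<alpha><..<real j + \<beta>} (x + real (Suc i)))
       = (\<Sum>i\<in>{j - 1}. F (x + real (Suc i)) * indicator {real j + \<alpha><..<real j + \<beta>} (x + real (Suc i)))"
    proof (rule suminf_finite)
      fix i assume "i \<notin> {j - 1}"
      then have "Suc i < j \<or> j < Suc i" using assms(3) by auto
      then have "real (Suc i) + 1 \<le> real j \<or> real j + 1 \<le> real (Suc i)" by linarith
      then have "x + real (Suc i) \<notin> {real j + \<alpha><..<real j + \<beta>}" using True assms by auto
      then show "F (x + real (Suc i)) * indicator {real j + \<alpha><..<real j + \<beta>} (x + real (Suc i)) = 0" by simp
    qed simp
    also have "\<dots> = F (x + real j) * indicator {\<alpha><..<\<beta>} x"
      using assms(3) by (auto simp: of_nat_diff add_ac split: split_indicator)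
    finally show ?thesis using True by (simp add: per_def)
  next
    case False
    then show ?thesis using assms by (auto simp: per_def)
  qed
qed

text \<open>Singles out the part of the image of (a,b) in branch \<open>j\<close> over
  (\<alpha>,\<beta>). The rest lies to its left and right, two intervals on which the density is at
  most \<open>\<gamma> * S / s\<^sup>2\<close>, whence the weight
  \<open>2 * \<gamma> * zeta2 * S\<close>. The last conclusion retains the shift \<open>j\<close>,
  which for \<open>j \<ge> 2\<close> is stronger than the shift 1 in \<open>arc_density\<close>;
  \<open>spreads_near_0\<close> exploits the surplus.\<close>

lemma gauss_branch:
  assumes \<gamma>: "1 < \<gamma>" and arc: "arc_density {a<..<b} h" and ab: "0 \<le> a" "b \<le> 1"
    and pS: "0 \<le> p" "0 \<le> S" "\<And>x. x \<in> {a<..<b} \<Longrightarrow> p \<le> h x \<and> h x \<le> S"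
    and j: "1 \<le> j" and \<alpha>\<beta>: "0 \<le> \<alpha>" "\<alpha> < \<beta>" "\<beta> \<le> 1" "{real j + \<alpha><..<real j + \<beta>} \<subseteq> inv_set \<gamma> {a<..<b}"
  obtains h' r where "gauss \<gamma> (wrap h) = (\<lambda>x. wrap h' x + r x)" "arc_density {\<alpha><..<\<beta>} h'"
    "\<And>x. x \<in> {\<alpha><..<\<beta>} \<Longrightarrow> p * (\<gamma> / (real j + 1)\<^sup>2) \<le> h' x \<and> h' x \<le> S * \<gamma>"
    "arc_sum r (ennreal (2 * \<gamma> * zeta2 * S))"
    "\<And>x. x \<in> {\<alpha><..<\<beta>} \<Longrightarrow> \<gamma> * p \<le> (x + real j)\<^sup>2 * h' x"
    "\<And>x y. x \<in> {\<alpha><..<\<beta>} \<Longrightarrow> y \<in> {\<alpha><..<\<beta>} \<Longrightarrow> x \<le> y \<Longrightarrow> (x + real j)\<^sup>2 * h' x \<le> (y + real j)\<^sup>2 * h' y"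
proof -
  define L where "L = inv_set \<gamma> {a<..<b}"
  define G where "G s = h (\<gamma> / s) * (\<gamma> / s\<^sup>2)" for s
  have h0: "0 \<le> h x" for x using arc unfolding arc_density_def by blast
  have ray: "ray_density L G"
    unfolding L_def G_def
  proof (rule ray_density_inversion)
    show "is_interval {a<..<b}" using arc unfolding arc_density_def by blast
    show "h \<in> borel_measurable borel" by (rule arc_density_measurable[OF arc])
    show "h y \<le> h x \<and> (x + 1)\<^sup>2 * h x \<le> (y + 1)\<^sup>2 * h y"
      if "x \<in> {a<..<b}" "y \<in> {a<..<b}" "x \<le> y" for x y using arc that unfolding arc_density_def by blast
  qed (use ab h0 \<gamma> in auto)
  note [measurable] = ray_densityD(3,7)[OF ray]
  have L1: "1 \<le> s" "\<gamma> / s \<in> {a<..<b}" if "s \<in> L" for s using that by (auto simp: L_def inv_set_def)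
  have GS: "G s \<le> (\<gamma> * S) / s\<^sup>2" and Gp: "\<gamma> * p \<le> s\<^sup>2 * G s" if "s \<in> L" for s
  proof -
    have *: "p \<le> h (\<gamma> / s)" "h (\<gamma> / s) \<le> S" using pS(3) L1(2)[OF that] by auto
    show "G s \<le> (\<gamma> * S) / s\<^sup>2"
      using * \<gamma> L1(1)[OF that] by (auto simp: G_def mult.commute intro!: divide_right_mono mult_left_mono)
    show "\<gamma> * p \<le> s\<^sup>2 * G s" using * \<gamma> L1(1)[OF that] by (auto simp: G_def)
  qed
  let ?Q = "{real j + \<alpha><..<real j + \<beta>}" and ?L1 = "L \<inter> {..real j + \<alpha>}" and ?L2 = "L \<inter> {real j + \<beta>..}"
  have QL: "?Q \<subseteq> L" using \<alpha>\<beta>(4) by (simp add: L_def)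
  define h' where "h' x = G (x + real j) * indicator {\<alpha><..<\<beta>} x" for x
  define r where "r x = per (\<lambda>s. ennreal (G s) * indicator ?L1 s) x + per (\<lambda>s. ennreal (G s) * indicator ?L2 s) x" for x
  have Q: "x + real j \<in> L" if "x \<in> {\<alpha><..<\<beta>}" for x using that QL by auto
  have h'G: "h' x = G (x + real j)" if "x \<in> {\<alpha><..<\<beta>}" for x using that by (simp add: h'_def)
  show thesis
  proof
    have "gauss \<gamma> (wrap h) = per (\<lambda>s. ennreal (G s) * indicator L s)"
      unfolding wrap_Ioo[OF arc ab] G_def L_def by (rule gauss_eq_per) (use h0 \<gamma> in auto)
    also have "(\<lambda>s. ennreal (G s) * indicator L s) = (\<lambda>s. ennreal (G s) * indicator ?Q s
        + (ennreal (G s) * indicator ?L1 s + ennreal (G s) * indicator ?L2 s))"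
      using \<alpha>\<beta> QL by (auto simp: fun_eq_iff split: split_indicator)
    also have "per \<dots> = (\<lambda>x. per (\<lambda>s. ennreal (G s) * indicator ?Q s) x + r x)"
      unfolding per_add r_def ..
    also have "per (\<lambda>s. ennreal (G s) * indicator ?Q s) = wrap h'"
      using \<alpha>\<beta> j by (subst per_translate) (auto simp: h'_def wrap_def fun_eq_iff split: split_indicator)
    finally show "gauss \<gamma> (wrap h) = (\<lambda>x. wrap h' x + r x)" .
    show inc: "(x + real j)\<^sup>2 * h' x \<le> (y + real j)\<^sup>2 * h' y"
      if "x \<in> {\<alpha><..<\<beta>}" "y \<in> {\<alpha><..<\<beta>}" "x \<le> y" for x y
      using ray_densityD(6)[OF ray Q[OF that(1)] Q[OF that(2)]] that by (simp add: h'G)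
    show "arc_density {\<alpha><..<\<beta>} h'"
      unfolding arc_density_def
    proof (intro conjI ballI impI allI)
      show "is_interval {\<alpha><..<\<beta>}" by (auto simp: is_interval_1)
      show "h' \<in> borel_measurable borel" unfolding h'_def[abs_def] by measurable
      show "0 \<le> h' x" for x using Q ray_densityD(4)[OF ray] by (auto simp: h'_def split: split_indicator)
      fix x y assume xy: "x \<in> {\<alpha><..<\<beta>}" "y \<in> {\<alpha><..<\<beta>}" "x \<le> y"
      show "h' y \<le> h' x" using ray_densityD(5)[OF ray Q[OF xy(1)] Q[OF xy(2)]] xy by (simp add: h'G)
      show "(x + 1)\<^sup>2 * h' x \<le> (y + 1)\<^sup>2 * h' y"
        by (rule square_shift_mono[where a="real j"])
           (use inc[OF xy] xy j \<alpha>\<beta> ray_densityD(4)[OF ray Q] in \<open>auto simp: h'G\<close>)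
    qed (use \<alpha>\<beta> in \<open>auto simp: h'_def\<close>)
    fix x assume x: "x \<in> {\<alpha><..<\<beta>}"
    show *: "\<gamma> * p \<le> (x + real j)\<^sup>2 * h' x" using Gp[OF Q[OF x]] by (simp add: h'G[OF x])
    show "p * (\<gamma> / (real j + 1)\<^sup>2) \<le> h' x \<and> h' x \<le> S * \<gamma>"
    proof
      have "0 \<le> h' x" using ray_densityD(4)[OF ray Q[OF x]] by (simp add: h'G[OF x])
      then have "\<gamma> * p \<le> (real j + 1)\<^sup>2 * h' x"
        using * x \<alpha>\<beta> j by (elim order_trans) (auto intro!: mult_right_mono power_mono)
      then show "p * (\<gamma> / (real j + 1)\<^sup>2) \<le> h' x" by (simp add: field_simps)
      have "1 \<le> x + real j" using x \<alpha>\<beta> j by simp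
      have "h' x \<le> \<gamma> * S / (x + real j)\<^sup>2" using GS[OF Q[OF x]] by (simp add: h'G[OF x])
      also have "\<dots> \<le> \<gamma> * S / 1" using \<open>1 \<le> x + real j\<close> \<gamma> pS(2) by (intro divide_left_mono) auto
      finally show "h' x \<le> S * \<gamma>" by (simp add: mult.commute)
    qed
  next
    have "arc_sum (per (\<lambda>s. ennreal (G s) * indicator Q s)) (ennreal (\<gamma> * S * zeta2))" if "is_interval Q" "Q \<subseteq> L" for Q
    proof -
      have "0 \<le> \<gamma> * S" using \<gamma> pS(2) by simp
      show ?thesis
        unfolding suminf_decay[OF \<open>0 \<le> \<gamma> * S\<close>, symmetric]
        by (rule arc_sum_per_decay[OF ray_density_subset[OF ray that]]) (use GS that \<open>0 \<le> \<gamma> * S\<close> in auto)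
    qed
    moreover have "is_interval ?L1" "is_interval ?L2"
      by (rule is_interval_Int[OF ray_densityD(1)[OF ray]], simp add: is_interval_1)+
    ultimately have "arc_sum r (ennreal (\<gamma> * S * zeta2) + ennreal (\<gamma> * S * zeta2))"
      unfolding r_def[abs_def] by (intro arc_sum_add) simp_all
    then show "arc_sum r (ennreal (2 * \<gamma> * zeta2 * S))"
      using \<gamma> pS(2) zeta2_nonneg by (subst (asm) ennreal_plus[symmetric]) (auto simp: mult_ac)
  qed
qed

text \<open>One step onto the branch piece, then the assumed \<open>n\<close> steps. On branch
  \<open>j\<close> a lower bound shrinks by at most \<open>\<gamma> / (real j + 1)\<^sup>2\<close>,
  an upper bound grows by at most \<gamma>, and the other branches evolve for \<open>n\<close> steps
  at cost \<open>6 ^ n\<close>.\<close>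

lemma spreads_Suc_branch:
  assumes \<gamma>: "1 < \<gamma>" and ab: "0 \<le> a" "b \<le> 1"
    and j: "1 \<le> j" and \<alpha>\<beta>: "0 \<le> \<alpha>" "\<alpha> < \<beta>" "\<beta> \<le> 1" "{real j + \<alpha><..<real j + \<beta>} \<subseteq> inv_set \<gamma> {a<..<b}"
    and sp: "spreads \<gamma> n {\<alpha><..<\<beta>} c C"
  shows "spreads \<gamma> (Suc n) {a<..<b} (c * (\<gamma> / (real j + 1)\<^sup>2)) (C * \<gamma> + 6 ^ n * (2 * \<gamma> * zeta2))"
  unfolding spreads_def
proof (intro conjI allI impI)
  have cC: "0 < c" "0 \<le> C" using sp by (auto simp: spreads_def)
  then show "0 < c * (\<gamma> / (real j + 1)\<^sup>2)" "0 \<le> C * \<gamma> + 6 ^ n * (2 * \<gamma> * zeta2)"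
    using \<gamma> zeta2_nonneg by (auto intro!: mult_pos_pos divide_pos_pos zero_less_power)
  fix h p S assume arc: "arc_density {a<..<b} h" and pS: "0 \<le> p" "0 \<le> S" "\<forall>x\<in>{a<..<b}. p \<le> h x \<and> h x \<le> S"
  obtain h' r where h': "gauss \<gamma> (wrap h) = (\<lambda>x. wrap h' x + r x)" "arc_density {\<alpha><..<\<beta>} h'"
    "\<And>x. x \<in> {\<alpha><..<\<beta>} \<Longrightarrow> p * (\<gamma> / (real j + 1)\<^sup>2) \<le> h' x \<and> h' x \<le> S * \<gamma>"
    "arc_sum r (ennreal (2 * \<gamma> * zeta2 * S))"
    by (rule gauss_branch[OF \<gamma> arc ab pS(1,2) bspec[OF pS(3)] j \<alpha>\<beta>]) blast+
  have "0 \<le> p * (\<gamma> / (real j + 1)\<^sup>2)" "0 \<le> S * \<gamma>" using pS \<gamma> by auto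
  then obtain r' where r': "(gauss \<gamma> ^^ n) (wrap h') = (\<lambda>x. ennreal (c * (p * (\<gamma> / (real j + 1)\<^sup>2))) * unif x + r' x)"
    "arc_sum r' (ennreal (C * (S * \<gamma>)))"
    by (rule spreadsE[OF sp h'(2) _ _ h'(3)])
  have "(gauss \<gamma> ^^ Suc n) (wrap h) = (\<lambda>x. (gauss \<gamma> ^^ n) (wrap h') x + (gauss \<gamma> ^^ n) r x)"
    by (simp add: funpow_Suc_right h'(1) gauss_funpow_add del: funpow.simps)
  also have "\<dots> = (\<lambda>x. ennreal (c * (\<gamma> / (real j + 1)\<^sup>2) * p) * unif x + (r' x + (gauss \<gamma> ^^ n) r x))"
    by (simp add: r'(1) add_ac mult_ac)
  finally have eq: "(gauss \<gamma> ^^ Suc n) (wrap h)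
      = (\<lambda>x. ennreal (c * (\<gamma> / (real j + 1)\<^sup>2) * p) * unif x + (r' x + (gauss \<gamma> ^^ n) r x))" .
  have "6 ^ n * ennreal (2 * \<gamma> * zeta2 * S) = ennreal (6 ^ n * (2 * \<gamma> * zeta2 * S))"
    by (simp add: ennreal_mult' ennreal_power[symmetric])
  moreover have "ennreal (C * (S * \<gamma>)) + ennreal (6 ^ n * (2 * \<gamma> * zeta2 * S)) = ennreal ((C * \<gamma> + 6 ^ n * (2 * \<gamma> * zeta2)) * S)"
    using cC \<gamma> zeta2_nonneg pS by (subst ennreal_plus[symmetric]) (auto simp: algebra_simps)
  ultimately have "arc_sum (\<lambda>x. r' x + (gauss \<gamma> ^^ n) r x) (ennreal ((C * \<gamma> + 6 ^ n * (2 * \<gamma> * zeta2)) * S))"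
    using arc_sum_add[OF r'(2) arc_sum_gauss_funpow[OF \<gamma> h'(4), of n]] by simp
  with eq show "\<exists>r. (gauss \<gamma> ^^ Suc n) (wrap h) = (\<lambda>x. ennreal (c * (\<gamma> / (real j + 1)\<^sup>2) * p) * unif x + r x)
      \<and> arc_sum r (ennreal ((C * \<gamma> + 6 ^ n * (2 * \<gamma> * zeta2)) * S))" by (intro exI conjI)
qed

text \<open>\<open>a * s < \<gamma>\<close> instead of \<open>s < \<gamma> / a\<close> covers
  \<open>a = 0\<close>, where the image is unbounded.\<close>

lemma inv_set_Ioo:
  assumes "1 < \<gamma>" "0 \<le> a" "a < b" "b \<le> 1"
  shows "s \<in> inv_set \<gamma> {a<..<b} \<longleftrightarrow> \<gamma> / b < s \<and> a * s < \<gamma>"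
proof
  assume "s \<in> inv_set \<gamma> {a<..<b}"
  then show "\<gamma> / b < s \<and> a * s < \<gamma>" using assms by (auto simp: inv_set_def field_simps)
next
  assume s: "\<gamma> / b < s \<and> a * s < \<gamma>"
  have "1 < \<gamma> / b" using assms by (auto simp: field_simps)
  with s have "1 \<le> s" by linarith
  with s assms show "s \<in> inv_set \<gamma> {a<..<b}"
    by (auto simp: inv_set_def pos_divide_less_eq pos_less_divide_eq mult.commute)
qed

text \<open>A right neighbourhood of 0 covers a full branch \<open>j \<ge> 2\<close>; on it the density
  increases fast enough after multiplication with \<open>(x + 1)\<^sup>2\<close> that a constant can be subtracted.\<close>

lemma spreads_near_0:
  assumes \<gamma>: "1 < \<gamma>" and b: "0 < b" "b \<le> 1"
  obtains c C where "spreads \<gamma> 1 {0<..<b} c C"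
proof -
  \<comment> \<open>Branch \<open>j\<close> lies entirely beyond \<open>\<gamma> / b\<close>, hence
    inside the image. The summand 2 secures \<open>j \<ge> 2\<close>: for \<open>j = 1\<close> the
    quotients in \<open>key\<close> are constant and nothing could be subtracted.\<close>
  define j where "j = nat \<lceil>\<gamma> / b\<rceil> + 2"
  have j: "2 \<le> real j" "\<gamma> / b < real j" by (simp_all add: j_def) linarith
  have sub: "{real j + 0<..<real j + 1} \<subseteq> inv_set \<gamma> {0<..<b}"
    using j \<gamma> b by (auto simp: inv_set_Ioo)
  \<comment> \<open>Read off from \<open>key\<close>: the difference of the quotients is at least
    \<open>(j - 1) * (y - x) / (j + 1)\<^sup>2\<close>, their sum is at least
    \<open>2 / (j + 1)\<close>, and the difference of the squares on the left is at most
    \<open>4 * (y - x)\<close>.\<close>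
  define c' where "c' = (real j - 1) / (2 * (real j + 1) ^ 3)"
  have c': "0 < c'" using j by (auto simp: c'_def)
  have c'_le: "c' \<le> 1 / (real j + 1)\<^sup>2"
  proof -
    have "c' = (real j - 1) / (2 * (real j + 1)) * (1 / (real j + 1)\<^sup>2)"
      by (simp add: c'_def power3_eq_cube power2_eq_square)
    also have "\<dots> \<le> 1 * (1 / (real j + 1)\<^sup>2)"
      using j by (intro mult_right_mono) (auto simp: divide_simps)
    finally show ?thesis by simp
  qed
  have key: "c' * ((y + 1)\<^sup>2 - (x + 1)\<^sup>2) \<le> ((y + 1) / (y + real j))\<^sup>2 - ((x + 1) / (x + real j))\<^sup>2"
    if xy: "0 < x" "x \<le> y" "y < 1" for x y
  proof -
    define A B where "A = (x + 1) / (x + real j)" and "B = (y + 1) / (y + real j)"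
    have "B - A = (real j - 1) * (y - x) / ((x + real j) * (y + real j))"
      using xy j by (simp add: A_def B_def divide_simps) (simp add: algebra_simps)
    also have "\<dots> \<ge> (real j - 1) * (y - x) / ((real j + 1) * (real j + 1))"
      using xy j by (intro divide_left_mono mult_mono mult_pos_pos) auto
    finally have 1: "(real j - 1) * (y - x) / ((real j + 1) * (real j + 1)) \<le> B - A" .
    have "1 / (real j + 1) \<le> A" "1 / (real j + 1) \<le> B"
      unfolding A_def B_def using xy j by (intro frac_le; auto)+
    then have 2: "2 / (real j + 1) \<le> B + A" by simp
    have "c' * ((y + 1)\<^sup>2 - (x + 1)\<^sup>2) = c' * (y - x) * (x + y + 2)"
      by (simp add: power2_eq_square algebra_simps)
    also have "\<dots> \<le> c' * (y - x) * 4" using xy c' by (intro mult_left_mono) auto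
    also have "\<dots> = ((real j - 1) * (y - x) / ((real j + 1) * (real j + 1))) * (2 / (real j + 1))"
      using j by (simp add: c'_def power3_eq_cube divide_simps)
    also have "\<dots> \<le> (B - A) * (B + A)"
    proof (rule mult_mono[OF 1 2])
      have "0 \<le> (real j - 1) * (y - x) / ((real j + 1) * (real j + 1))" using xy j by simp
      with 1 show "0 \<le> B - A" by linarith
    qed simp
    also have "\<dots> = B\<^sup>2 - A\<^sup>2" by (simp add: power2_eq_square algebra_simps)
    finally show ?thesis by (simp add: A_def B_def)
  qed
  have "spreads \<gamma> 1 {0<..<b} (\<gamma> * c') (\<gamma> + 2 * \<gamma> * zeta2)"
    unfolding spreads_def
  proof (intro conjI allI impI)
    show "0 < \<gamma> * c'" "0 \<le> \<gamma> + 2 * \<gamma> * zeta2" using \<gamma> c' zeta2_nonneg by auto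
    fix h p S assume arc: "arc_density {0<..<b} h" and pS: "0 \<le> p" "0 \<le> S" "\<forall>x\<in>{0<..<b}. p \<le> h x \<and> h x \<le> S"
    have j1: "1 \<le> j" using j by linarith
    obtain h' r where h': "gauss \<gamma> (wrap h) = (\<lambda>x. wrap h' x + r x)" "arc_density {0<..<1} h'"
      "\<And>x. x \<in> {0<..<1} \<Longrightarrow> p * (\<gamma> / (real j + 1)\<^sup>2) \<le> h' x \<and> h' x \<le> S * \<gamma>"
      "arc_sum r (ennreal (2 * \<gamma> * zeta2 * S))"
      "\<And>x. x \<in> {0<..<1} \<Longrightarrow> \<gamma> * p \<le> (x + real j)\<^sup>2 * h' x"
      "\<And>x y. x \<in> {0<..<1} \<Longrightarrow> y \<in> {0<..<1} \<Longrightarrow> x \<le> y \<Longrightarrow> (x + real j)\<^sup>2 * h' x \<le> (y + real j)\<^sup>2 * h' y"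
      by (rule gauss_branch[OF \<gamma> arc order.refl b(2) pS(1,2) bspec[OF pS(3)] j1 _ _ _ sub]) auto
    \<comment> \<open>A constant is decreasing, but \<open>(x + 1)\<^sup>2\<close> times it
      increases, so subtracting it endangers only the second monotonicity condition.\<close>
    define g where "g x = (h' x - \<gamma> * c' * p) * indicator {0<..<1} x" for x
    have ge: "\<gamma> * c' * p \<le> h' x" if "x \<in> {0<..<1}" for x
    proof -
      have "\<gamma> * c' * p \<le> \<gamma> * (1 / (real j + 1)\<^sup>2) * p"
        using c'_le \<gamma> pS(1) by (intro mult_right_mono mult_left_mono) auto
      also have "\<dots> \<le> h' x" using h'(3)[OF that] by (simp add: mult_ac)
      finally show ?thesis .
    qed
    have h'_meas[measurable]: "h' \<in> borel_measurable borel" by (rule arc_density_measurable[OF h'(2)])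
    have h'_out: "h' x = 0" if "x \<notin> {0<..<1}" for x using h'(2) that unfolding arc_density_def by blast
    have "arc_density {0<..<1} g"
      unfolding arc_density_def
    proof (intro conjI ballI impI allI)
      show "is_interval {0<..<1::real}" by (auto simp: is_interval_1)
      show "g \<in> borel_measurable borel" unfolding g_def[abs_def] by measurable
      show "0 \<le> g x" for x using ge by (auto simp: g_def split: split_indicator)
      fix x y :: real assume xy: "x \<in> {0<..<1}" "y \<in> {0<..<1}" "x \<le> y"
      have "h' y \<le> h' x" using h'(2) xy unfolding arc_density_def by blast
      then show "g y \<le> g x" using xy by (simp add: g_def)
      let ?A = "(x + 1) / (x + real j)" and ?B = "(y + 1) / (y + real j)"
      \<comment> \<open>\<open>(x + 1)\<^sup>2 * h' x\<close> is the squared quotient times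
        \<open>q\<close>. Since \<open>q\<close> is nondecreasing in \<open>x\<close> and at least
        \<open>\<gamma> * p\<close>, the growth of the squared quotient in \<open>key\<close>
        absorbs that of \<open>\<gamma> * c' * p * (x + 1)\<^sup>2\<close>.\<close>
      define q where "q = (x + real j)\<^sup>2 * h' x"
      have "0 < x + real j" "0 < y + real j" using xy j by auto
      then have "(x + 1)\<^sup>2 * h' x = ?A\<^sup>2 * q" by (simp add: q_def power_divide)
      have "?B\<^sup>2 * q \<le> ?B\<^sup>2 * ((y + real j)\<^sup>2 * h' y)"
        unfolding q_def by (intro mult_left_mono h'(6) xy) auto
      also have "\<dots> = (y + 1)\<^sup>2 * h' y" using \<open>0 < y + real j\<close> by (simp add: power_divide)
      finally have "?B\<^sup>2 * q - ?A\<^sup>2 * q \<le> (y + 1)\<^sup>2 * h' y - (x + 1)\<^sup>2 * h' x"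
        using \<open>(x + 1)\<^sup>2 * h' x = ?A\<^sup>2 * q\<close> by simp
      moreover have k: "c' * ((y + 1)\<^sup>2 - (x + 1)\<^sup>2) \<le> ?B\<^sup>2 - ?A\<^sup>2" using key[of x y] xy by auto
      moreover have "0 \<le> c' * ((y + 1)\<^sup>2 - (x + 1)\<^sup>2)"
        using c' xy by (intro mult_nonneg_nonneg) (auto intro: power_mono)
      moreover have "\<gamma> * p \<le> q" unfolding q_def by (rule h'(5)[OF xy(1)])
      ultimately have "c' * ((y + 1)\<^sup>2 - (x + 1)\<^sup>2) * (\<gamma> * p) \<le> (y + 1)\<^sup>2 * h' y - (x + 1)\<^sup>2 * h' x"
        using mult_mono[OF k \<open>\<gamma> * p \<le> q\<close>] \<gamma> pS(1) by (simp add: left_diff_distrib)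
      then show "(x + 1)\<^sup>2 * g x \<le> (y + 1)\<^sup>2 * g y"
        using xy by (simp add: g_def algebra_simps)
    qed (auto simp: g_def)
    moreover have "ennreal (g x) \<le> ennreal (\<gamma> * S)" for x
    proof (rule ennreal_leI)
      have "0 \<le> \<gamma> * c' * p" using \<gamma> c' pS(1) by simp
      then show "g x \<le> \<gamma> * S"
        using h'(3)[of x] \<gamma> pS(2) by (auto simp: g_def mult.commute split: split_indicator)
    qed
    ultimately have "arc_sum (wrap g) (ennreal (\<gamma> * S))" by (rule arc_sum.atom)
    from arc_sum_add[OF this h'(4)] have "arc_sum (\<lambda>x. wrap g x + r x) (ennreal ((\<gamma> + 2 * \<gamma> * zeta2) * S))"
      using \<gamma> pS(2) zeta2_nonneg by (subst (asm) ennreal_plus[symmetric]) (auto simp: distrib_right)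
    moreover have "wrap h' x = ennreal (\<gamma> * c' * p) * unif x + wrap g x" for x
      using ge[of x] h'_out[of x] h'_out[of "x + 1"] \<gamma> c' pS(1)
      by (auto simp: wrap_def unif_def g_def split: split_indicator simp flip: ennreal_plus)
    ultimately show "\<exists>r. (gauss \<gamma> ^^ 1) (wrap h) = (\<lambda>x. ennreal (\<gamma> * c' * p) * unif x + r x)
        \<and> arc_sum r (ennreal ((\<gamma> + 2 * \<gamma> * zeta2) * S))"
      using h'(1) by (intro exI[of _ "\<lambda>x. wrap g x + r x"]) (simp add: add_ac)
  qed
  then show thesis by (rule that)
qed

text \<open>Induction on the number of expansions still allowed. As long as the image stays between
  two consecutive integers, its length grows by at least \<gamma>; this cannot last beyond length 1.
  Otherwise the image contains an integer in its interior and folds to a set containing a right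
  neighbourhood of 0, where \<open>spreads_near_0\<close> applies.\<close>

lemma spreads_interval:
  assumes \<gamma>: "1 < \<gamma>" and "0 \<le> a" "a < b" "b \<le> 1"
  obtains n c C where "spreads \<gamma> n {a<..<b} c C"
proof -
  have "\<exists>n c C. spreads \<gamma> n {a<..<b} c C" if "1 \<le> \<gamma> ^ k * (b - a)" "0 \<le> a" "a < b" "b \<le> 1" for k a b
    using that
  proof (induction k arbitrary: a b)
    case 0
    \<comment> \<open>Length at least 1 inside [0,1] forces the full interval.\<close>
    then have "a = 0" by simp
    then show ?case using spreads_near_0[OF \<gamma>, of b] 0 by metis
  next
    case (Suc k)
    show ?case
    proof (cases "a = 0")
      case True
      then show ?thesis using spreads_near_0[OF \<gamma>, of b] Suc.prems by metis
    next
      case False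
      then have a: "0 < a" using Suc.prems by simp
      have inv: "s \<in> inv_set \<gamma> {a<..<b} \<longleftrightarrow> \<gamma> / b < s \<and> s < \<gamma> / a" for s
        using inv_set_Ioo[OF \<gamma> Suc.prems(2-4)] a by (simp add: pos_less_divide_eq mult.commute)
      have gb: "1 < \<gamma> / b" using \<gamma> Suc.prems a by (simp add: field_simps)
      define j where "j = nat \<lfloor>\<gamma> / b\<rfloor>"
      have j: "1 \<le> j" "real j \<le> \<gamma> / b" "\<gamma> / b < real j + 1" 
        using gb by (auto simp: j_def le_nat_iff)
      show ?thesis
      proof (cases "real j + 1 < \<gamma> / a")
        case True
        \<comment> \<open>\<open>real j + 1\<close> is interior to the image, so branch
          \<open>Suc j\<close> is covered from its left end up to \<beta>.\<close>
        define \<beta> where "\<beta> = min 1 (\<gamma> / a - (real j + 1))"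
        have \<beta>: "0 < \<beta>" "\<beta> \<le> 1" using True by (auto simp: \<beta>_def)
        obtain c C where "spreads \<gamma> 1 {0<..<\<beta>} c C" by (rule spreads_near_0[OF \<gamma> \<beta>])
        moreover have "{real (Suc j) + 0<..<real (Suc j) + \<beta>} \<subseteq> inv_set \<gamma> {a<..<b}"
          using j by (auto simp: inv \<beta>_def)
        ultimately show ?thesis
          using spreads_Suc_branch[OF \<gamma> Suc.prems(2,4), of "Suc j" 0 \<beta>] \<beta> by fastforce
      next
        case False
        define \<alpha> \<beta> where "\<alpha> = \<gamma> / b - real j" and "\<beta> = \<gamma> / a - real j"
        have "\<gamma> * (b - a) \<le> \<beta> - \<alpha>"
        proof -
          \<comment> \<open>The length of (\<gamma>/b, \<gamma>/a), which is at least
            \<open>\<gamma> * (b - a)\<close> because \<open>a * b \<le> 1\<close>.\<close>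
          have "\<beta> - \<alpha> = \<gamma> * (b - a) / (a * b)" using a Suc.prems by (simp add: \<alpha>_def \<beta>_def field_simps)
          moreover have "\<gamma> * (b - a) / 1 \<le> \<gamma> * (b - a) / (a * b)"
            using a \<gamma> Suc.prems by (intro divide_left_mono mult_le_one) auto
          ultimately show ?thesis by simp
        qed
        then have "\<gamma> ^ k * (\<gamma> * (b - a)) \<le> \<gamma> ^ k * (\<beta> - \<alpha>)" using \<gamma> by (intro mult_left_mono) auto
        then have "1 \<le> \<gamma> ^ k * (\<beta> - \<alpha>)" using Suc.prems(1) by (simp add: mult_ac)
        moreover have \<alpha>\<beta>: "0 \<le> \<alpha>" "\<beta> \<le> 1" "\<alpha> < \<beta>"
          using j False a \<gamma> Suc.prems by (auto simp: \<alpha>_def \<beta>_def intro!: divide_strict_left_mono)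
        ultimately obtain n c C where "spreads \<gamma> n {\<alpha><..<\<beta>} c C" using Suc.IH by blast
        moreover have "{real j + \<alpha><..<real j + \<beta>} \<subseteq> inv_set \<gamma> {a<..<b}"
          by (auto simp: inv \<alpha>_def \<beta>_def)
        ultimately show ?thesis
          using spreads_Suc_branch[OF \<gamma> Suc.prems(2,4) j(1) \<alpha>\<beta>(1,3,2)] by blast
      qed
    qed
  qed
  moreover obtain k where "1 / (b - a) < \<gamma> ^ k" using real_arch_pow[OF \<gamma>] by blast
  then have "1 \<le> \<gamma> ^ k * (b - a)" using assms by (simp add: field_simps)
  ultimately show thesis using assms that by blast
qed

text \<open>The part of the uniform mass no longer claimed joins the remainder. Its weight is at
  most \<open>c * S\<close>, since \<open>p \<le> S\<close> on a nonempty interval, whence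
  \<open>C + c \<le> C'\<close>.\<close>

lemma spreads_mono:
  assumes sp: "spreads \<gamma> n I c C" and I: "I \<noteq> {}" and c': "0 < c'" "c' \<le> c" and C': "C + c \<le> C'"
  shows "spreads \<gamma> n I c' C'"
  unfolding spreads_def
proof (intro conjI allI impI)
  have cC: "0 < c" "0 \<le> C" using sp by (auto simp: spreads_def)
  then show "0 < c'" "0 \<le> C'" using c' C' by auto
  fix h p S assume *: "arc_density I h" "0 \<le> p" "0 \<le> S" "\<forall>x\<in>I. p \<le> h x \<and> h x \<le> S"
  obtain r where r: "(gauss \<gamma> ^^ n) (wrap h) = (\<lambda>x. ennreal (c * p) * unif x + r x)" "arc_sum r (ennreal (C * S))"
    by (rule spreadsE[OF sp *(1-3) bspec[OF *(4)]])
  have pS: "p \<le> S" using *(4) I by force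
  have "arc_sum (\<lambda>x. ennreal ((c - c') * p) * unif x + r x) (ennreal ((c - c') * p) * 1 + ennreal (C * S))"
    using * c' by (intro arc_sum_add arc_sum_cmult arc_sum_unif r(2)) auto
  moreover have "ennreal ((c - c') * p) * 1 + ennreal (C * S) \<le> ennreal (C' * S)"
  proof -
    have "(c - c') * p + C * S \<le> c * S + C * S"
      using c' cC * pS by (intro add_right_mono mult_mono) auto
    also have "\<dots> \<le> C' * S" using C' *(3) by (simp flip: distrib_right add: mult_right_mono add.commute)
    finally show ?thesis using * c' cC by (auto simp flip: ennreal_plus intro: ennreal_leI)
  qed
  ultimately have "arc_sum (\<lambda>x. ennreal ((c - c') * p) * unif x + r x) (ennreal (C' * S))" by (rule arc_sum_mono)
  moreover have "ennreal (c * p) = ennreal (c' * p) + ennreal ((c - c') * p)"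
    using * c' by (subst ennreal_plus[symmetric]) (auto simp: algebra_simps intro: mult_right_mono)
  then have "(gauss \<gamma> ^^ n) (wrap h) = (\<lambda>x. ennreal (c' * p) * unif x + (ennreal ((c - c') * p) * unif x + r x))"
    by (simp add: r(1) distrib_right add_ac)
  ultimately show "\<exists>r. (gauss \<gamma> ^^ n) (wrap h) = (\<lambda>x. ennreal (c' * p) * unif x + r x) \<and> arc_sum r (ennreal (C' * S))"
    by (intro exI conjI)
qed

text \<open>Spreading persists because \<open>gauss \<gamma> unif\<close> again dominates a multiple
  of \<open>unif\<close>. This makes it possible to synchronize intervals that spread at different
  times.\<close>

lemma spreads_Suc:
  assumes \<gamma>: "1 < \<gamma>" and sp: "spreads \<gamma> n I c C" and I: "I \<noteq> {}"
  obtains c' C' where "spreads \<gamma> (Suc n) I c' C'"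
proof -
  obtain c1 C1 where sp1: "spreads \<gamma> 1 {0<..<1} c1 C1" by (rule spreads_near_0[OF \<gamma>, of 1]) auto
  have cC: "0 < c" "0 \<le> C" "0 < c1" "0 \<le> C1" using sp sp1 by (auto simp: spreads_def)
  obtain r1 where "(gauss \<gamma> ^^ 1) (wrap (\<lambda>x. 1 * indicator {0<..<1} x)) = (\<lambda>x. ennreal (c1 * 1) * unif x + r1 x)" "arc_sum r1 (ennreal (C1 * 1))"
    by (rule spreadsE[OF sp1 arc_density_const[of 0 1 1], of 1 1]) auto
  note r1 = this[folded unif_eq_wrap]
  have "spreads \<gamma> (Suc n) I (c * c1) (c * C1 + 6 * C)"
    unfolding spreads_def
  proof (intro conjI allI impI)
    show "0 < c * c1" "0 \<le> c * C1 + 6 * C" using cC by auto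
    fix h p S assume *: "arc_density I h" "0 \<le> p" "0 \<le> S" "\<forall>x\<in>I. p \<le> h x \<and> h x \<le> S"
    obtain r where r: "(gauss \<gamma> ^^ n) (wrap h) = (\<lambda>x. ennreal (c * p) * unif x + r x)" "arc_sum r (ennreal (C * S))"
      by (rule spreadsE[OF sp *(1-3) bspec[OF *(4)]])
    have pS: "p \<le> S" using *(4) I by force
    have "arc_sum (\<lambda>x. ennreal (c * p) * r1 x + (gauss \<gamma> ^^ 1) r x)
        (ennreal (c * p) * ennreal (C1 * 1) + 6 ^ 1 * ennreal (C * S))"
      using * cC by (intro arc_sum_add arc_sum_cmult arc_sum_gauss_funpow \<gamma> r r1) auto
    moreover have "ennreal (c * p) * ennreal (C1 * 1) + 6 ^ 1 * ennreal (C * S) \<le> ennreal ((c * C1 + 6 * C) * S)"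
    proof -
      have "c * p * C1 + 6 * (C * S) \<le> c * S * C1 + 6 * (C * S)"
        using cC * pS by (intro add_right_mono mult_right_mono mult_left_mono) auto
      also have "\<dots> = (c * C1 + 6 * C) * S" by (simp add: algebra_simps)
      finally show ?thesis using cC *
        by (simp add: ennreal_mult[symmetric] ennreal_mult'[symmetric] ennreal_plus[symmetric] ennreal_leI
            flip: ennreal_numeral del: ennreal_plus)
    qed
    ultimately have "arc_sum (\<lambda>x. ennreal (c * p) * r1 x + (gauss \<gamma> ^^ 1) r x) (ennreal ((c * C1 + 6 * C) * S))"
      by (rule arc_sum_mono)
    moreover have "(gauss \<gamma> ^^ Suc n) (wrap h)
        = (\<lambda>x. ennreal (c * c1 * p) * unif x + (ennreal (c * p) * r1 x + (gauss \<gamma> ^^ 1) r x))"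
    proof -
      have "ennreal (c * c1 * p) = ennreal (c * p) * ennreal c1"
        using cC * by (subst ennreal_mult[symmetric]) (auto simp: mult_ac)
      moreover have "(gauss \<gamma> ^^ Suc n) (wrap h) = (\<lambda>x. ennreal (c * p) * (gauss \<gamma> ^^ 1) unif x + (gauss \<gamma> ^^ 1) r x)"
        by (simp add: r(1) gauss_add gauss_cmult)
      ultimately show ?thesis
        by (simp only: r1(1)) (simp add: distrib_left mult_ac add_ac)
    qed
    ultimately show "\<exists>r. (gauss \<gamma> ^^ Suc n) (wrap h) = (\<lambda>x. ennreal (c * c1 * p) * unif x + r x)
        \<and> arc_sum r (ennreal ((c * C1 + 6 * C) * S))"
      by (intro exI conjI)
  qed
  then show thesis by (rule that)
qed

text \<open>The claim is made for all late times, not for one, so that the induction can pass to the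
  larger of two thresholds.\<close>

lemma spreads_uniform:
  assumes \<gamma>: "1 < \<gamma>" and "finite F" and "\<And>I. I \<in> F \<Longrightarrow> \<exists>n c C. spreads \<gamma> n I c C" and "{} \<notin> F"
  shows "\<exists>n. \<forall>m\<ge>n. \<exists>c C. 0 < c \<and> (\<forall>I\<in>F. spreads \<gamma> m I c C)"
  using assms(2-4)
proof (induction F)
  case empty
  then show ?case by (intro exI[of _ 0] allI impI exI[of _ 1]) auto
next
  case (insert I F)
  obtain n1 where n1: "\<And>m. m \<ge> n1 \<Longrightarrow> \<exists>c C. 0 < c \<and> (\<forall>I\<in>F. spreads \<gamma> m I c C)" using insert by auto
  obtain n2 c C where sp2: "spreads \<gamma> n2 I c C" using insert.prems(1)[of I] by blast
  have n2: "\<exists>c C. spreads \<gamma> m I c C" if "m \<ge> n2" for m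
    using that
  proof (induction m rule: dec_induct)
    case (step m)
    then obtain c C where "spreads \<gamma> m I c C" by blast
    then show ?case using spreads_Suc[OF \<gamma>, of m I c C] insert.prems(2) by auto
  qed (use sp2 in blast)
  have "\<exists>c C. 0 < c \<and> (\<forall>I\<in>insert I F. spreads \<gamma> m I c C)" if m: "m \<ge> max n1 n2" for m
  proof -
    obtain c1 C1 where 1: "0 < c1" "\<And>I. I \<in> F \<Longrightarrow> spreads \<gamma> m I c1 C1" using n1[of m] m by auto
    obtain c2 C2 where 2: "spreads \<gamma> m I c2 C2" using n2[of m] m by auto
    then have "0 < c2" by (simp add: spreads_def)
    define c C where "c = min c1 c2" and "C = max (C1 + c1) (C2 + c2)"
    have c: "0 < c" "c \<le> c1" "c \<le> c2" using 1 \<open>0 < c2\<close> by (auto simp: c_def)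
    have C: "C1 + c1 \<le> C" "C2 + c2 \<le> C" by (auto simp: C_def)
    have "spreads \<gamma> m J c C" if "J \<in> F" for J
      using spreads_mono[OF 1(2)[OF that] _ c(1,2) C(1)] that insert.prems(2) by auto
    moreover have "spreads \<gamma> m I c C" using spreads_mono[OF 2 _ c(1,3) C(2)] insert.prems(2) by auto
    ultimately show ?thesis using c(1) by auto
  qed
  then show ?case by blast
qed

lemma spreads_grid:
  assumes \<gamma>: "1 < \<gamma>" and M: "0 < M"
  obtains n c C where "\<And>i. i < M \<Longrightarrow> spreads \<gamma> n {real i / real M<..<(real i + 1) / real M} c C" "0 < c" "0 \<le> C"
proof -
  let ?I = "\<lambda>i. {real i / real M<..<(real i + 1) / real M}"
  have ne: "real i / real M < (real i + 1) / real M" for i using M by (simp add: divide_strict_right_mono)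
  have "\<exists>n. \<forall>m\<ge>n. \<exists>c C. 0 < c \<and> (\<forall>I\<in>?I ` {..<M}. spreads \<gamma> m I c C)"
  proof (rule spreads_uniform[OF \<gamma>])
    fix I assume "I \<in> ?I ` {..<M}"
    then obtain i where i: "i < M" "I = ?I i" by blast
    then have "real i + 1 \<le> real M" by linarith
    then have "(real i + 1) / real M \<le> 1" using M by simp
    then obtain n c C where "spreads \<gamma> n (?I i) c C"
      using spreads_interval[OF \<gamma> _ ne[of i], of thesis] by auto
    then show "\<exists>n c C. spreads \<gamma> n I c C" using i(2) by blast
  next
    have ne': "?I i \<noteq> {}" for i using ne[of i] by (simp add: not_le)
    show "{} \<notin> ?I ` {..<M}"
    proof
      assume "{} \<in> ?I ` {..<M}"
      then obtain i where "{} = ?I i" by (rule imageE)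
      with ne'[of i] show False by argo
    qed
  qed simp
  then obtain n where "\<exists>c C. 0 < c \<and> (\<forall>I\<in>?I ` {..<M}. spreads \<gamma> n I c C)" by blast
  then obtain c C where *: "0 < c" "\<And>i. i < M \<Longrightarrow> spreads \<gamma> n (?I i) c C" by blast
  moreover have "0 \<le> C" using *(2)[OF M] by (simp add: spreads_def)
  ultimately show thesis using that by blast
qed

section \<open>Minorization and coupling\<close>

lemma unit_interval_contains_grid:
  fixes x y :: real
  assumes "0 \<le> x" "y \<le> 1" "2 / real M \<le> y - x" "0 < M"
  obtains i where "i < M" "{real i / real M<..<(real i + 1) / real M} \<subseteq> {x<..<y}"
proof -
  \<comment> \<open>Rounding \<open>x\<close> up to the grid costs less than \<open>1 / M\<close>
    and the cell itself another \<open>1 / M\<close>.\<close>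
  define i where "i = nat \<lceil>x * real M\<rceil>"
  have "0 \<le> x * real M" using assms by simp
  then have i: "x * real M \<le> real i" "real i < x * real M + 1" by (auto simp: i_def) linarith+
  have "2 \<le> (y - x) * real M" using assms(3,4) by (simp add: field_simps)
  then have "real i + 1 \<le> y * real M" using i by (simp add: algebra_simps)
  moreover have "y * real M \<le> 1 * real M" using assms by (intro mult_right_mono) auto
  ultimately have "real i + 1 \<le> real M" by simp
  then have "i < M" by linarith
  moreover have "x \<le> real i / real M" "(real i + 1) / real M \<le> y"
    using i(1) \<open>real i + 1 \<le> y * real M\<close> assms(4) by (auto simp: field_simps)
  then have "{real i / real M<..<(real i + 1) / real M} \<subseteq> {x<..<y}" by auto
  ultimately show thesis using that by blast
qed

lemma arc_density_shift:
  assumes "arc_density J h" "\<And>x. x \<in> J \<Longrightarrow> 1 \<le> x"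
  shows "arc_density {x. x + 1 \<in> J} (\<lambda>x. h (x + 1))"
  unfolding arc_density_def
proof (intro conjI ballI impI allI)
  note [measurable] = arc_density_measurable[OF assms(1)]
  show "(\<lambda>x. h (x + 1)) \<in> borel_measurable borel" by measurable
  show "is_interval {x. x + 1 \<in> J}" using assms(1) by (intro is_interval_translate) (simp add: arc_density_def)
  have J: "J \<subseteq> {0..<2}" "\<And>x y. x \<in> J \<Longrightarrow> y \<in> J \<Longrightarrow> y - x \<le> 1" "\<And>x. x \<notin> J \<Longrightarrow> h x = 0" "\<And>x. 0 \<le> h x"
    using assms(1) unfolding arc_density_def by blast+
  show "{x. x + 1 \<in> J} \<subseteq> {0..<2}" using J(1) assms(2) by force
  show "y - x \<le> 1" if "x \<in> {x. x + 1 \<in> J}" "y \<in> {x. x + 1 \<in> J}" for x y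
    using J(2)[of "x + 1" "y + 1"] that by simp
  show "h (x + 1) = 0" if "x \<notin> {x. x + 1 \<in> J}" for x using J(3) that by simp
  show "0 \<le> h (x + 1)" for x by (rule J(4))
  fix x y assume xy: "x \<in> {x. x + 1 \<in> J}" "y \<in> {x. x + 1 \<in> J}" "x \<le> y"
  then have *: "x + 1 \<in> J" "y + 1 \<in> J" "x + 1 \<le> y + 1" "0 \<le> x" using assms(2)[of "x + 1"] by auto
  then have **: "h (y + 1) \<le> h (x + 1) \<and> (x + 1 + 1)\<^sup>2 * h (x + 1) \<le> (y + 1 + 1)\<^sup>2 * h (y + 1)"
    using assms(1) unfolding arc_density_def by blast
  then show "h (y + 1) \<le> h (x + 1)" by simp
  show "(x + 1)\<^sup>2 * h (x + 1) \<le> (y + 1)\<^sup>2 * h (y + 1)"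
    by (rule square_shift_mono[where a=2]) (use * ** J(4) xy(3) in \<open>auto simp: add_ac\<close>)
qed

text \<open>Bounded distortion: on an arc \<open>y + 1 \<le> 2 * (x + 1)\<close>, so the weighted
  monotonicity limits the decrease to a factor 4.\<close>

lemma arc_density_quarter:
  assumes "arc_density J h" "x \<in> J" "y \<in> J"
  shows "h x \<le> 4 * h y"
proof (cases "y \<le> x")
  case True
  then have "h x \<le> h y" "0 \<le> h y" using assms unfolding arc_density_def by blast+
  then show ?thesis by linarith
next
  case False
  then have xy: "x \<le> y" by simp
  have "J \<subseteq> {0..<2}" "y - x \<le> 1" "0 \<le> h y" "(x + 1)\<^sup>2 * h x \<le> (y + 1)\<^sup>2 * h y"
    using assms xy unfolding arc_density_def by blast+
  moreover from this(1) have "0 \<le> x" using assms(2) by auto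
  moreover have "(y + 1)\<^sup>2 * h y \<le> (2 * (x + 1))\<^sup>2 * h y"
    using calculation False by (intro mult_right_mono power_mono) auto
  moreover have "(2 * (x + 1))\<^sup>2 * h y = (x + 1)\<^sup>2 * (4 * h y)" by (simp only: power_mult_distrib) simp
  ultimately have "(x + 1)\<^sup>2 * h x \<le> (x + 1)\<^sup>2 * (4 * h y)" by linarith
  moreover have "0 < (x + 1)\<^sup>2" using \<open>0 \<le> x\<close> by simp
  ultimately show ?thesis by (simp add: mult_le_cancel_left)
qed

lemma arc_sum_restrict:
  assumes "arc_density J h" "\<And>x. ennreal (h x) \<le> S" "is_interval Q" "Q \<subseteq> J"
  shows "arc_sum (wrap (\<lambda>x. h x * indicator Q x)) S"
  by (rule arc_sum.atom[OF arc_density_restrict[OF assms(1,3,4)]])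
     (use assms(2) in \<open>auto split: split_indicator\<close>)

lemma wrap_add:
  assumes "\<And>x. 0 \<le> f x" "\<And>x. 0 \<le> g x"
  shows "wrap (\<lambda>x. f x + g x) = (\<lambda>x. wrap f x + wrap g x)"
  using assms by (auto simp: wrap_def fun_eq_iff add_ac split: split_indicator simp flip: ennreal_plus)

lemma arc_split_at_subinterval:
  assumes arc: "arc_density J h" and S: "\<And>x. ennreal (h x) \<le> S" and ab: "{a<..<b} \<subseteq> J" "a < b"
  obtains r where "wrap h = (\<lambda>x. wrap (\<lambda>x. h x * indicator {a<..<b} x) x + r x)" "arc_sum r (S + S)"
proof -
  let ?L = "J \<inter> {..a}" and ?R = "J \<inter> {b..}"
  define f where "f Q x = h x * indicator Q x" for Q x
  have h: "0 \<le> h x" "x \<notin> J \<Longrightarrow> h x = 0" for x using arc unfolding arc_density_def by blast+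
  have J: "is_interval J" using arc unfolding arc_density_def by blast
  have "is_interval ?L" "is_interval ?R"
    by (rule is_interval_Int[OF J], simp add: is_interval_1)+
  then have "arc_sum (wrap (f ?L)) S" "arc_sum (wrap (f ?R)) S"
    unfolding f_def[abs_def] by (auto intro!: arc_sum_restrict[OF arc S])
  then have K: "arc_sum (\<lambda>x. wrap (f ?L) x + wrap (f ?R) x) (S + S)" by (rule arc_sum_add)
  have "h x = f {a<..<b} x + (f ?L x + f ?R x)" for x
    using h(2)[of x] ab by (auto simp: f_def split: split_indicator)
  then have "wrap h = wrap (\<lambda>x. f {a<..<b} x + (f ?L x + f ?R x))" by presburger
  also have "0 \<le> f Q x" for Q x using h(1) by (simp add: f_def)
  then have "wrap (\<lambda>x. f {a<..<b} x + (f ?L x + f ?R x)) = (\<lambda>x. wrap (f {a<..<b}) x + (wrap (f ?L) x + wrap (f ?R) x))"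
    by (simp add: wrap_add)
  finally have "wrap h = (\<lambda>x. wrap (f {a<..<b}) x + (wrap (f ?L) x + wrap (f ?R) x))" .
  from that[OF this[unfolded f_def[abs_def]] K[unfolded f_def[abs_def]]] show thesis .
qed

text \<open>Reduces arcs of arbitrary position to finitely many intervals, for which
  \<open>spreads\<close> has common constants. The two leftover parts of the arc account for the
  weight \<open>S + S\<close>.\<close>

lemma arc_contains_grid_piece:
  assumes arc: "arc_density J h" and S: "\<And>x. ennreal (h x) \<le> S"
    and xy: "x \<in> J" "y \<in> J" "4 / real M < y - x" and M: "0 < M"
  obtains i g r where "i < M" "arc_density {real i / real M<..<(real i + 1) / real M} g"
    "wrap h = (\<lambda>x. wrap g x + r x)" "arc_sum r (S + S)"
    "\<And>z. z \<in> {real i / real M<..<(real i + 1) / real M} \<Longrightarrow> \<exists>v\<in>J. g z = h v"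
proof -
  have J: "J \<subseteq> {0..<2}" "is_interval J" using arc unfolding arc_density_def by blast+
  have yx: "x < y" using xy(3) M by (smt (verit) divide_nonneg_nonneg of_nat_0_le_iff)
  have sub: "{x<..<y} \<subseteq> J" using is_intervalD[OF J(2) xy(1,2)] by auto
  have xy02: "0 \<le> x" "y < 2" using xy J by auto
  \<comment> \<open>The point 1 leaves at least half of (x,y) on one side, enough for a cell of the
    grid or for its translate by 1.\<close>
  have "4 / real M = 2 * (2 / real M)" by simp
  then have "2 / real M \<le> min y 1 - x \<or> 2 / real M \<le> y - max x 1" using xy(3) yx by (simp add: min_def max_def) linarith
  then show thesis
  proof
    assume *: "2 / real M \<le> min y 1 - x"
    obtain i where i: "i < M" "{real i / real M<..<(real i + 1) / real M} \<subseteq> {x<..<min y 1}"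
      by (rule unit_interval_contains_grid[OF xy02(1) _ * M]) auto
    let ?I = "{real i / real M<..<(real i + 1) / real M}"
    have "{x<..<min y 1} \<subseteq> {x<..<y}" by auto
    with i(2) sub have IJ: "?I \<subseteq> J" by blast
    have ne: "real i / real M < (real i + 1) / real M" using M by (simp add: divide_strict_right_mono)
    obtain r where r: "wrap h = (\<lambda>x. wrap (\<lambda>x. h x * indicator ?I x) x + r x)" "arc_sum r (S + S)"
      by (rule arc_split_at_subinterval[OF arc S IJ ne])
    show thesis
    proof (rule that[OF i(1) arc_density_restrict[OF arc _ IJ] r])
      show "is_interval ?I" by (auto simp: is_interval_1)
      show "\<exists>v\<in>J. h z * indicator ?I z = h v" if "z \<in> ?I" for z
        using that IJ by (intro bexI[of _ z]) auto
    qed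
  next
    assume *: "2 / real M \<le> y - max x 1"
    obtain i where i: "i < M" "{real i / real M<..<(real i + 1) / real M} \<subseteq> {max x 1 - 1<..<y - 1}"
      by (rule unit_interval_contains_grid[of "max x 1 - 1" "y - 1" M]) (use * M xy02 in auto)
    let ?I = "{real i / real M<..<(real i + 1) / real M}"
    let ?J = "{real i / real M + 1<..<(real i + 1) / real M + 1}"
    have I: "z - 1 \<in> ?I" if "z \<in> ?J" for z using that by auto
    have IJ: "?J \<subseteq> J"
    proof
      fix z assume "z \<in> ?J"
      from subsetD[OF i(2) I[OF this]] have "z \<in> {x<..<y}" by auto
      then show "z \<in> J" using sub by blast
    qed
    have ne: "real i / real M + 1 < (real i + 1) / real M + 1" using M by (simp add: divide_strict_right_mono)
    have intJ: "is_interval ?J" by (auto simp: is_interval_1)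
    obtain r where r: "wrap h = (\<lambda>x. wrap (\<lambda>x. h x * indicator ?J x) x + r x)" "arc_sum r (S + S)"
      by (rule arc_split_at_subinterval[OF arc S IJ ne])
    define g where "g z = h (z + 1) * indicator ?J (z + 1)" for z
    have I_eq: "?I = {z. z + 1 \<in> ?J}" by auto
    have arcg: "arc_density ?I g"
      unfolding I_eq g_def
    proof (rule arc_density_shift[OF arc_density_restrict[OF arc intJ IJ]])
      fix z assume "z \<in> ?J"
      moreover have "0 \<le> real i / real M" by simp
      ultimately show "1 \<le> z" unfolding greaterThanLessThan_iff by linarith
    qed
    have wg: "wrap g = wrap (\<lambda>x. h x * indicator ?J x)"
    proof
      fix v
      have "(real i + 1) / real M \<le> 1" using i(1) by simp
      moreover have "0 \<le> real i / real M" by simp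
      ultimately have "v < 1 \<longrightarrow> v \<notin> ?J" and "0 \<le> v \<longrightarrow> v + 1 + 1 \<notin> ?J"
        unfolding greaterThanLessThan_iff by linarith+
      then show "wrap g v = wrap (\<lambda>x. h x * indicator ?J x) v"
        by (auto simp: wrap_def g_def split: split_indicator simp del: greaterThanLessThan_iff)
    qed
    show thesis
    proof (rule that[OF i(1) arcg _ r(2)])
      show "wrap h = (\<lambda>x. wrap g x + r x)" unfolding wg by (rule r(1))
      show "\<exists>v\<in>J. g z = h v" if "z \<in> ?I" for z
        using that IJ unfolding I_eq by (intro bexI[of _ "z + 1"]) (auto simp: g_def)
    qed
  qed
qed

text \<open>\<open>t\<close> is a part of the mass for which spreading is guaranteed. An arc of
  length at most \<open>1 / R\<close> carries mass at most \<open>S / R\<close> and may be ignored.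
  A longer arc with mass \<open>m\<close> has density at least \<open>m / 4\<close> everywhere and
  contains a grid cell, so after the common time \<open>n\<close> it yields \<open>c * m / 4\<close>
  times \<open>unif\<close>.\<close>

lemma arc_sum_minorization:
  assumes \<gamma>: "1 < \<gamma>" and R: "0 < R"
  obtains n c C where "0 < c" "0 \<le> C"
    "\<And>u S. arc_sum u S \<Longrightarrow> \<exists>t r. (\<integral>\<^sup>+x. u x \<partial>lborel) \<le> t + ennreal (1 / R) * S \<and>
        (gauss \<gamma> ^^ n) u = (\<lambda>x. ennreal c * t * unif x + r x) \<and> arc_sum r (ennreal C * S)"
proof -
  define M where "M = nat \<lceil>4 * R\<rceil>"
  have M: "0 < M" "4 * R \<le> real M" using R by (auto simp: M_def)
  have MR: "4 / real M \<le> 1 / R" using M R by (simp add: field_simps)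
  obtain n c C where sp: "\<And>i. i < M \<Longrightarrow> spreads \<gamma> n {real i / real M<..<(real i + 1) / real M} c C" "0 < c" "0 \<le> C"
    by (rule spreads_grid[OF \<gamma> M(1)]) blast
  \<comment> \<open>The remainder of the cell, plus the two leftover parts of the arc evolved for
    \<open>n\<close> steps.\<close>
  define C' where "C' = C + 2 * 6 ^ n"
  have C': "ennreal C * S + 6 ^ n * (S + S) = ennreal C' * S" for S
  proof -
    have "ennreal C' = ennreal C + 2 * 6 ^ n"
      unfolding C'_def using sp(3) by (subst ennreal_plus) (auto simp: ennreal_mult' ennreal_power[symmetric])
    then show ?thesis by (simp add: distrib_left distrib_right mult_2 mult_2_right mult_ac)
  qed
  have "\<exists>t r. (\<integral>\<^sup>+x. u x \<partial>lborel) \<le> t + ennreal (1 / R) * S \<and>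
        (gauss \<gamma> ^^ n) u = (\<lambda>x. ennreal (c / 4) * t * unif x + r x) \<and> arc_sum r (ennreal C' * S)"
    if "arc_sum u S" for u S
    using that
  proof induction
    case (atom J h S)
    define \<mu> where "\<mu> = (\<integral>\<^sup>+x. wrap h x \<partial>lborel)"
    have K: "arc_sum (wrap h) S" by (rule arc_sum.atom) fact+
    show ?case
    proof (cases "\<mu> \<le> ennreal (1 / R) * S")
      case True
      \<comment> \<open>An atom of small mass contributes \<open>t = 0\<close>; all of its iterate
        stays in the remainder.\<close>
      have "6 ^ n * S \<le> ennreal C' * S"
      proof -
        have "6 ^ n * S \<le> 6 ^ n * (S + S)" by (intro mult_left_mono) auto
        also have "\<dots> \<le> ennreal C' * S" unfolding C'[symmetric] by simp
        finally show ?thesis .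
      qed
      with arc_sum_gauss_funpow[OF \<gamma> K, of n] have "arc_sum ((gauss \<gamma> ^^ n) (wrap h)) (ennreal C' * S)"
        by (rule arc_sum_mono)
      then show ?thesis using True unfolding \<mu>_def by (intro exI[of _ 0] exI[of _ "(gauss \<gamma> ^^ n) (wrap h)"]) simp
    next
      case False
      then have S: "S \<noteq> top" using R by (auto simp: ennreal_mult_top top_unique)
      then obtain s where s: "S = ennreal s" "0 \<le> s" by (cases S) auto
      have "\<exists>x\<in>J. \<exists>y\<in>J. 1 / R < y - x"
      proof (rule ccontr)
        assume "\<not> ?thesis"
        then have "\<mu> \<le> S * ennreal (1 / R)"
          unfolding \<mu>_def nn_integral_wrap[OF atom(1)] using R atom
          by (intro nn_integral_arc_density_le[OF atom(1)]) (auto simp: not_less)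
        with False show False by (simp add: mult.commute)
      qed
      then obtain x y where "x \<in> J" "y \<in> J" "4 / real M < y - x" using MR by force
      then obtain i g r where i: "i < M" and g: "arc_density {real i / real M<..<(real i + 1) / real M} g"
        and r: "wrap h = (\<lambda>x. wrap g x + r x)" "arc_sum r (S + S)"
        and gh: "\<And>z. z \<in> {real i / real M<..<(real i + 1) / real M} \<Longrightarrow> \<exists>v\<in>J. g z = h v"
        by (rule arc_contains_grid_piece[OF atom _ _ _ M(1)]) blast
      have "\<mu> \<le> S" unfolding \<mu>_def by (rule arc_sum_integral_le[OF K])
      then obtain m where m: "\<mu> = ennreal m" "0 \<le> m" using S by (cases \<mu>) (auto simp: top_unique)
      have h_le: "h v \<le> s" for v using atom(2)[of v] s by simp
      \<comment> \<open>The mass is at most the supremum on an arc of length at most 1, and the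
        supremum is at most \<open>4 * h v\<close>.\<close>
      have h_ge: "m / 4 \<le> h v" if "v \<in> J" for v
      proof -
        have hv: "0 \<le> h v" using atom(1) unfolding arc_density_def by blast
        have "\<mu> \<le> ennreal (4 * h v) * ennreal 1"
          unfolding \<mu>_def nn_integral_wrap[OF atom(1)]
        proof (rule nn_integral_arc_density_le[OF atom(1)])
          show "ennreal (h x) \<le> ennreal (4 * h v)" if "x \<in> J" for x
            by (rule ennreal_leI) (rule arc_density_quarter[OF atom(1) that \<open>v \<in> J\<close>])
          show "y - x \<le> 1" if "x \<in> J" "y \<in> J" for x y
            using atom(1) that unfolding arc_density_def by blast
        qed simp
        then show ?thesis using m hv by simp
      qed
      obtain r' where r': "(gauss \<gamma> ^^ n) (wrap g) = (\<lambda>x. ennreal (c * (m / 4)) * unif x + r' x)"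
        "arc_sum r' (ennreal (C * s))"
      proof (rule spreadsE[OF sp(1)[OF i] g])
        show "m / 4 \<le> g z \<and> g z \<le> s" if "z \<in> {real i / real M<..<(real i + 1) / real M}" for z
          using gh[OF that] h_le h_ge by force
      qed (use m s in auto)
      have "arc_sum (\<lambda>x. r' x + (gauss \<gamma> ^^ n) r x) (ennreal C' * S)"
        using arc_sum_add[OF r'(2) arc_sum_gauss_funpow[OF \<gamma> r(2), of n]] s sp(3)
        by (simp add: C'[symmetric] ennreal_mult)
      moreover have "ennreal (c * (m / 4)) = ennreal (c / 4) * \<mu>"
        using m sp(2) by (simp add: ennreal_mult[symmetric])
      then have "(gauss \<gamma> ^^ n) (wrap h) = (\<lambda>x. ennreal (c / 4) * \<mu> * unif x + (r' x + (gauss \<gamma> ^^ n) r x))"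
        by (simp only: r(1) gauss_funpow_add r'(1)) (simp add: add_ac)
      ultimately show ?thesis
        unfolding \<mu>_def[symmetric] by (intro exI[of _ \<mu>] exI[of _ "\<lambda>x. r' x + (gauss \<gamma> ^^ n) r x"]) simp
    qed
  next
    case (suminf u S)
    let ?P = "\<lambda>i t r. (\<integral>\<^sup>+x. u i x \<partial>lborel) \<le> t + ennreal (1 / R) * S i \<and>
        (gauss \<gamma> ^^ n) (u i) = (\<lambda>x. ennreal (c / 4) * t * unif x + r x) \<and> arc_sum r (ennreal C' * S i)"
    have "\<forall>i. \<exists>t r. ?P i t r" by (intro allI suminf.IH)
    from choice[OF this] obtain t where "\<forall>i. \<exists>r. ?P i (t i) r" ..
    from choice[OF this] obtain r where "\<forall>i. ?P i (t i) (r i)" ..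
    then have tr: "\<And>i. (\<integral>\<^sup>+x. u i x \<partial>lborel) \<le> t i + ennreal (1 / R) * S i"
      "\<And>i. (gauss \<gamma> ^^ n) (u i) = (\<lambda>x. ennreal (c / 4) * t i * unif x + r i x)"
      "\<And>i. arc_sum (r i) (ennreal C' * S i)"
      by simp_all
    have "(\<integral>\<^sup>+x. (\<Sum>i. u i x) \<partial>lborel) = (\<Sum>i. \<integral>\<^sup>+x. u i x \<partial>lborel)"
      by (rule nn_integral_suminf) (use arc_sum_measurable suminf in auto)
    also have "\<dots> \<le> (\<Sum>i. t i + ennreal (1 / R) * S i)" by (intro suminf_le tr summableI)
    also have "\<dots> = (\<Sum>i. t i) + ennreal (1 / R) * (\<Sum>i. S i)" by (simp add: suminf_add[symmetric])
    finally have 1: "(\<integral>\<^sup>+x. (\<Sum>i. u i x) \<partial>lborel) \<le> (\<Sum>i. t i) + ennreal (1 / R) * (\<Sum>i. S i)" .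
    have 2: "(gauss \<gamma> ^^ n) (\<lambda>x. \<Sum>i. u i x) = (\<lambda>x. ennreal (c / 4) * (\<Sum>i. t i) * unif x + (\<Sum>i. r i x))"
      by (simp add: gauss_funpow_suminf tr(2) suminf_add[symmetric])
    have 3: "arc_sum (\<lambda>x. \<Sum>i. r i x) (ennreal C' * (\<Sum>i. S i))"
      using arc_sum.suminf[OF tr(3)] by simp
    show ?case using 1 2 3 by (intro exI conjI)
  qed
  note main = this
  show thesis
  proof (rule that)
    show "0 < c / 4" "0 \<le> C'" using sp(2,3) by (auto simp: C'_def)
  qed (rule main)
qed

lemma nn_integral_gauss_funpow:
  assumes "1 < \<gamma>" "arc_sum u S"
  shows "(\<integral>\<^sup>+x. (gauss \<gamma> ^^ n) u x \<partial>lborel) = (\<integral>\<^sup>+x. u x \<partial>lborel)"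
proof (induction n)
  case (Suc n)
  note K = arc_sum_gauss_funpow[OF assms, of n]
  have "(\<integral>\<^sup>+x. gauss \<gamma> ((gauss \<gamma> ^^ n) u) x \<partial>lborel) = (\<integral>\<^sup>+x. (gauss \<gamma> ^^ n) u x \<partial>lborel)"
  proof (rule nn_integral_gauss[OF arc_sum_measurable[OF K]])
    fix x assume "x \<notin> {0..\<gamma>}"
    then show "(gauss \<gamma> ^^ n) u x = 0" using assms(1) by (intro arc_sum_eq_0[OF K]) auto
  qed (use assms in simp)
  with Suc show ?case by simp
qed simp

text \<open>\<open>5 * \<gamma> / (\<gamma> - 1)\<close> is the fixed point of
  \<open>z |-> z / \<gamma> + 5\<close>, the recursion for the coefficient of the mass.\<close>

lemma arc_sum_gauss_iterate:
  assumes \<gamma>: "1 < \<gamma>" and u: "arc_sum u S"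
  shows "arc_sum ((gauss \<gamma> ^^ k) u) (ennreal ((1 / \<gamma>) ^ k) * S + ennreal (5 * \<gamma> / (\<gamma> - 1)) * (\<integral>\<^sup>+x. u x \<partial>lborel))"
proof (induction k)
  case 0
  show ?case using arc_sum_mono[OF u] by simp
next
  case (Suc k)
  let ?A = "5 * \<gamma> / (\<gamma> - 1)" and ?m = "\<integral>\<^sup>+x. u x \<partial>lborel"
  have "ennreal (1 / \<gamma>) * (ennreal ((1 / \<gamma>) ^ k) * S + ennreal ?A * ?m) + 5 * ?m
      = (ennreal (1 / \<gamma>) * ennreal ((1 / \<gamma>) ^ k)) * S + (ennreal (1 / \<gamma>) * ennreal ?A + 5) * ?m"
    by (simp only: distrib_left distrib_right mult.assoc add.assoc)
  also have "ennreal (1 / \<gamma>) * ennreal ((1 / \<gamma>) ^ k) = ennreal ((1 / \<gamma>) ^ Suc k)"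
    using \<gamma> by (subst ennreal_mult[symmetric]) auto
  also have "ennreal (1 / \<gamma>) * ennreal ?A + 5 = ennreal (1 / \<gamma> * ?A + 5)"
  proof -
    have "0 \<le> 1 / \<gamma>" "0 \<le> ?A" using \<gamma> by auto
    then have "ennreal (1 / \<gamma> * ?A + 5) = ennreal (1 / \<gamma> * ?A) + ennreal 5"
      "ennreal (1 / \<gamma> * ?A) = ennreal (1 / \<gamma>) * ennreal ?A"
      by (intro ennreal_plus mult_nonneg_nonneg ennreal_mult; simp)+
    then show ?thesis by (simp only: ennreal_numeral)
  qed
  also have "1 / \<gamma> * ?A + 5 = ?A" using \<gamma> by (simp add: field_simps)
  finally show ?case
    using arc_sum_gauss[OF \<gamma> Suc] by (simp add: nn_integral_gauss_funpow[OF \<gamma> u])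
qed

text \<open>Works in the cone of sums of arcs with weight at most \<open>A\<close> times mass.
  Minorization splits off a fixed fraction of the mass, which may push the remainder out of the
  cone; \<open>k\<close> further steps of the Lasota--Yorke inequality bring it back, as
  \<open>A\<close> exceeds the limiting ratio \<open>A0\<close>. The removed part is carried along
  and becomes \<kappa>, the \<open>k\<close>-th image of \<open>unif\<close>, which is the same for
  all densities: this is what can be cancelled.\<close>

lemma coupling_step:
  assumes \<gamma>: "1 < \<gamma>" and A: "5 * \<gamma> / (\<gamma> - 1) < A"
  obtains m c \<kappa> where "0 < m" "0 < c" "c < 1"
    "\<And>u \<mu>. 0 \<le> \<mu> \<Longrightarrow> (\<integral>\<^sup>+x. u x \<partial>lborel) = ennreal \<mu> \<Longrightarrow> arc_sum u (ennreal (A * \<mu>)) \<Longrightarrow>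
      \<exists>r. (gauss \<gamma> ^^ m) u = (\<lambda>x. ennreal (c * \<mu>) * \<kappa> x + r x) \<and>
        arc_sum r (ennreal (A * ((1 - c) * \<mu>))) \<and> (\<integral>\<^sup>+x. r x \<partial>lborel) = ennreal ((1 - c) * \<mu>)"
proof -
  define A0 where "A0 = 5 * \<gamma> / (\<gamma> - 1)"
  have A0: "0 < A0" "A0 < A" using A \<gamma> by (auto simp: A0_def)
  \<comment> \<open>For weight \<open>A * \<mu>\<close> the mass ignored in the minorization is at
    most \<open>\<mu> / 2\<close>, so \<open>t\<close> is at least \<open>\<mu> / 2\<close>.\<close>
  have R: "0 < 2 * A" using A0 by simp
  obtain c0 C n where c0: "0 < c0" "0 \<le> C" and minor: "\<And>u S. arc_sum u S \<Longrightarrow>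
      \<exists>t r. (\<integral>\<^sup>+x. u x \<partial>lborel) \<le> t + ennreal (1 / (2 * A)) * S \<and>
        (gauss \<gamma> ^^ n) u = (\<lambda>x. ennreal c0 * t * unif x + r x) \<and> arc_sum r (ennreal C * S)"
    by (rule arc_sum_minorization[OF \<gamma> R]) blast
  define c where "c = min (c0 / 2) (1 / 2)"
  have c: "0 < c" "c \<le> c0 / 2" "c \<le> 1 / 2" using c0 by (auto simp: c_def)
  obtain k0 where "((1 + C * A) / ((A - A0) / 2)) < \<gamma> ^ k0" using real_arch_pow[OF \<gamma>] by blast
  \<comment> \<open>The successor makes the duration \<open>n + k\<close> positive, since a root of
    that order is taken later.\<close>
  define k where "k = Suc k0"
  have "\<gamma> ^ k0 \<le> \<gamma> ^ k" using \<gamma> unfolding k_def by (intro power_increasing) auto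
  with \<open>_ < \<gamma> ^ k0\<close> have "(1 + C * A) / ((A - A0) / 2) < \<gamma> ^ k" by linarith
  then have k: "(1 / \<gamma>) ^ k * (1 + C * A) \<le> (A - A0) / 2"
    using \<gamma> A0 by (simp add: power_one_over field_simps)
  show thesis
  proof (rule that)
    show "0 < n + k" by (simp add: k_def)
    show "0 < c" "c < 1" using c by auto
    fix u \<mu> assume \<mu>: "0 \<le> \<mu>" "(\<integral>\<^sup>+x. u x \<partial>lborel) = ennreal \<mu>" and u: "arc_sum u (ennreal (A * \<mu>))"
    obtain t r0 where t: "ennreal \<mu> \<le> t + ennreal (1 / (2 * A)) * ennreal (A * \<mu>)"
      and eq0: "(gauss \<gamma> ^^ n) u = (\<lambda>x. ennreal c0 * t * unif x + r0 x)"
      and r0: "arc_sum r0 (ennreal C * ennreal (A * \<mu>))"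
      using minor[OF u] \<mu>(2) by auto
    note [measurable] = arc_sum_measurable[OF r0] arc_sum_measurable[OF arc_sum_unif]
    have "(\<integral>\<^sup>+x. (gauss \<gamma> ^^ n) u x \<partial>lborel) = ennreal c0 * t + (\<integral>\<^sup>+x. r0 x \<partial>lborel)"
      unfolding eq0 by (simp add: nn_integral_add nn_integral_cmult nn_integral_unif)
    then have mass0: "ennreal \<mu> = ennreal c0 * t + (\<integral>\<^sup>+x. r0 x \<partial>lborel)"
      by (simp add: nn_integral_gauss_funpow[OF \<gamma> u] \<mu>(2))
    then have "ennreal c0 * t + (\<integral>\<^sup>+x. r0 x \<partial>lborel) \<noteq> top" by (metis ennreal_neq_top)
    then have "ennreal c0 * t \<noteq> top" "(\<integral>\<^sup>+x. r0 x \<partial>lborel) \<noteq> top" by (auto simp: ennreal_add_eq_top)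
    then obtain \<tau> \<rho> where \<tau>: "t = ennreal \<tau>" "0 \<le> \<tau>" and \<rho>: "(\<integral>\<^sup>+x. r0 x \<partial>lborel) = ennreal \<rho>" "0 \<le> \<rho>"
      using c0 by (cases t; cases "\<integral>\<^sup>+x. r0 x \<partial>lborel") (auto simp: ennreal_mult_top)
    have mass: "\<mu> = c0 * \<tau> + \<rho>"
      using mass0 c0 \<tau> \<rho> \<mu> by (simp add: ennreal_mult[symmetric] ennreal_plus[symmetric] del: ennreal_plus)
    have "ennreal \<mu> \<le> ennreal (\<tau> + 1 / (2 * A) * (A * \<mu>))"
      using t \<tau> \<mu> A0 by (simp add: ennreal_mult[symmetric] ennreal_plus[symmetric] del: ennreal_plus)
    then have "\<mu> \<le> \<tau> + 1 / (2 * A) * (A * \<mu>)" using A0 \<tau> \<mu> by (subst (asm) ennreal_le_iff) auto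
    then have "\<mu> \<le> 2 * \<tau>" using A0 by simp
    then have "c * \<mu> \<le> c0 / 2 * (2 * \<tau>)" using c \<mu> by (intro mult_mono) auto
    then have c\<mu>: "c * \<mu> \<le> c0 * \<tau>" by simp
    \<comment> \<open>Exactly \<open>c * \<mu>\<close> is removed and the surplus \<open>d\<close>
      is handed back, so that the mass of the remainder depends on \<mu> alone and two densities of
      equal mass remain equal in mass.\<close>
    define d where "d = c0 * \<tau> - c * \<mu>"
    have d: "0 \<le> d" "d \<le> \<mu>" "d + \<rho> = (1 - c) * \<mu>"
    proof -
      have "0 \<le> c * \<mu>" "(1 - c) * \<mu> = \<mu> - c * \<mu>" using c \<mu> by (auto simp: left_diff_distrib)
      then show "0 \<le> d" "d \<le> \<mu>" "d + \<rho> = (1 - c) * \<mu>" using c\<mu> mass \<rho>(2) unfolding d_def by linarith+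
    qed
    define r1 where "r1 x = ennreal d * unif x + r0 x" for x
    have "arc_sum r1 (ennreal d * 1 + ennreal C * ennreal (A * \<mu>))"
      unfolding r1_def[abs_def] by (intro arc_sum_add arc_sum_cmult arc_sum_unif r0 d)
    moreover have "ennreal d * 1 + ennreal C * ennreal (A * \<mu>) \<le> ennreal ((1 + C * A) * \<mu>)"
    proof -
      have "d + C * (A * \<mu>) \<le> (1 + C * A) * \<mu>" using d by (simp add: algebra_simps)
      then show ?thesis using d c0 A0 \<mu>
        by (simp add: ennreal_mult[symmetric] ennreal_plus[symmetric] ennreal_leI del: ennreal_plus)
    qed
    ultimately have r1: "arc_sum r1 (ennreal ((1 + C * A) * \<mu>))" by (rule arc_sum_mono)
    have "(\<integral>\<^sup>+x. r1 x \<partial>lborel) = ennreal d + ennreal \<rho>"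
      unfolding r1_def by (simp add: nn_integral_add nn_integral_cmult nn_integral_unif \<rho>)
    then have mass1: "(\<integral>\<^sup>+x. r1 x \<partial>lborel) = ennreal ((1 - c) * \<mu>)"
      using d \<rho> by (simp add: ennreal_plus[symmetric] del: ennreal_plus)
    have "ennreal (c0 * \<tau>) = ennreal (c * \<mu>) + ennreal d"
      using d c \<mu> by (subst ennreal_plus[symmetric]) (auto simp: d_def)
    then have eq1: "(gauss \<gamma> ^^ n) u = (\<lambda>x. ennreal (c * \<mu>) * unif x + r1 x)"
      using c0 \<tau> by (simp add: eq0 r1_def ennreal_mult[symmetric] distrib_right add_ac)
    have "(gauss \<gamma> ^^ (n + k)) u = (gauss \<gamma> ^^ k) ((gauss \<gamma> ^^ n) u)"
      by (simp add: add.commute[of n k] funpow_add)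
    also have "\<dots> = (\<lambda>x. ennreal (c * \<mu>) * (gauss \<gamma> ^^ k) unif x + (gauss \<gamma> ^^ k) r1 x)"
      unfolding eq1 gauss_funpow_add gauss_funpow_cmult ..
    finally have eq2: "(gauss \<gamma> ^^ (n + k)) u = (\<lambda>x. ennreal (c * \<mu>) * (gauss \<gamma> ^^ k) unif x + (gauss \<gamma> ^^ k) r1 x)" .
    have "arc_sum ((gauss \<gamma> ^^ k) r1) (ennreal ((1 / \<gamma>) ^ k) * ennreal ((1 + C * A) * \<mu>) + ennreal A0 * ennreal ((1 - c) * \<mu>))"
      using arc_sum_gauss_iterate[OF \<gamma> r1, of k] by (simp add: mass1 A0_def)
    moreover have "ennreal ((1 / \<gamma>) ^ k) * ennreal ((1 + C * A) * \<mu>) + ennreal A0 * ennreal ((1 - c) * \<mu>) \<le> ennreal (A * ((1 - c) * \<mu>))"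
    proof -
      have "(1 / \<gamma>) ^ k * ((1 + C * A) * \<mu>) + A0 * ((1 - c) * \<mu>) \<le> (A - A0) / 2 * \<mu> + A0 * ((1 - c) * \<mu>)"
        using mult_right_mono[OF k \<mu>(1)] by (simp add: mult_ac)
      also have "(A - A0) / 2 * \<mu> \<le> (A - A0) * (1 - c) * \<mu>"
        using A0 c \<mu> by (intro mult_right_mono) auto
      finally have "(1 / \<gamma>) ^ k * ((1 + C * A) * \<mu>) + A0 * ((1 - c) * \<mu>) \<le> A * ((1 - c) * \<mu>)"
        by (simp add: algebra_simps)
      then have "ennreal ((1 / \<gamma>) ^ k * ((1 + C * A) * \<mu>) + A0 * ((1 - c) * \<mu>)) \<le> ennreal (A * ((1 - c) * \<mu>))"
        by (rule ennreal_leI)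
      moreover have "0 \<le> (1 + C * A) * \<mu>" "0 \<le> (1 - c) * \<mu>" "0 \<le> (1 / \<gamma>) ^ k"
        using c0 A0 c \<mu> \<gamma> by auto
      ultimately show ?thesis using A0
        by (subst (asm) ennreal_plus) (auto simp: ennreal_mult)
    qed
    ultimately have r2: "arc_sum ((gauss \<gamma> ^^ k) r1) (ennreal (A * ((1 - c) * \<mu>)))" by (rule arc_sum_mono)
    have "(\<integral>\<^sup>+x. (gauss \<gamma> ^^ k) r1 x \<partial>lborel) = ennreal ((1 - c) * \<mu>)"
      by (simp add: nn_integral_gauss_funpow[OF \<gamma> r1] mass1)
    with eq2 r2 show "\<exists>r. (gauss \<gamma> ^^ (n + k)) u = (\<lambda>x. ennreal (c * \<mu>) * (gauss \<gamma> ^^ k) unif x + r x) \<and>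
        arc_sum r (ennreal (A * ((1 - c) * \<mu>))) \<and> (\<integral>\<^sup>+x. r x \<partial>lborel) = ennreal ((1 - c) * \<mu>)"
      by (intro exI conjI)
  qed
qed

text \<open>The step is repeated on both remainders at once; what they lose is identical and
  accumulates in \<open>P\<close>. After each block the remainders have common mass
  \<open>(1 - c)\<close> times the previous one.\<close>

theorem gauss_coupling:
  assumes \<gamma>: "1 < \<gamma>"
  obtains C l where "0 \<le> C" "0 \<le> l" "l < 1"
    "\<And>u v \<mu> n. 0 \<le> \<mu> \<Longrightarrow> (\<integral>\<^sup>+x. u x \<partial>lborel) = ennreal \<mu> \<Longrightarrow> (\<integral>\<^sup>+x. v x \<partial>lborel) = ennreal \<mu> \<Longrightarrow>
      arc_sum u (ennreal (B * \<mu>)) \<Longrightarrow> arc_sum v (ennreal (B * \<mu>)) \<Longrightarrow>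
      \<exists>P r s. (gauss \<gamma> ^^ n) u = (\<lambda>x. P x + r x) \<and> (gauss \<gamma> ^^ n) v = (\<lambda>x. P x + s x) \<and>
        r \<in> borel_measurable borel \<and> s \<in> borel_measurable borel \<and>
        (\<integral>\<^sup>+x. r x \<partial>lborel) \<le> ennreal (C * l ^ n * \<mu>) \<and> (\<integral>\<^sup>+x. s x \<partial>lborel) \<le> ennreal (C * l ^ n * \<mu>)"
proof -
  \<comment> \<open>Large enough to contain the initial data and to exceed the limiting ratio
    required by \<open>coupling_step\<close>.\<close>
  define A where "A = max B (5 * \<gamma> / (\<gamma> - 1) + 1)"
  have A: "5 * \<gamma> / (\<gamma> - 1) < A" "B \<le> A" by (auto simp: A_def)
  obtain m c \<kappa> where m: "0 < m" and c: "0 < c" "c < 1" and step: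
    "\<And>u \<mu>. 0 \<le> \<mu> \<Longrightarrow> (\<integral>\<^sup>+x. u x \<partial>lborel) = ennreal \<mu> \<Longrightarrow> arc_sum u (ennreal (A * \<mu>)) \<Longrightarrow>
      \<exists>r. (gauss \<gamma> ^^ m) u = (\<lambda>x. ennreal (c * \<mu>) * \<kappa> x + r x) \<and>
        arc_sum r (ennreal (A * ((1 - c) * \<mu>))) \<and> (\<integral>\<^sup>+x. r x \<partial>lborel) = ennreal ((1 - c) * \<mu>)"
    by (rule coupling_step[OF \<gamma> A(1)]) blast
  \<comment> \<open>Rate per single step; the constant \<open>1 / (1 - c)\<close> pays for an
    incomplete last block.\<close>
  define l where "l = root m (1 - c)"
  have l: "0 < l" "l < 1" "l ^ m = 1 - c" using m c by (auto simp: l_def)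
  show thesis
  proof (rule that)
    show "0 \<le> 1 / (1 - c)" "0 \<le> l" "l < 1" using l c by auto
    fix u v \<mu> n
    assume \<mu>: "0 \<le> \<mu>" "(\<integral>\<^sup>+x. u x \<partial>lborel) = ennreal \<mu>" "(\<integral>\<^sup>+x. v x \<partial>lborel) = ennreal \<mu>"
      and K: "arc_sum u (ennreal (B * \<mu>))" "arc_sum v (ennreal (B * \<mu>))"
    have AB: "ennreal (B * \<mu>) \<le> ennreal (A * \<mu>)" using A \<mu> by (intro ennreal_leI mult_right_mono)
    have "\<exists>P r s. (gauss \<gamma> ^^ (m * N)) u = (\<lambda>x. P x + r x) \<and> (gauss \<gamma> ^^ (m * N)) v = (\<lambda>x. P x + s x) \<and>
        arc_sum r (ennreal (A * ((1 - c) ^ N * \<mu>))) \<and> arc_sum s (ennreal (A * ((1 - c) ^ N * \<mu>))) \<and>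
        (\<integral>\<^sup>+x. r x \<partial>lborel) = ennreal ((1 - c) ^ N * \<mu>) \<and> (\<integral>\<^sup>+x. s x \<partial>lborel) = ennreal ((1 - c) ^ N * \<mu>)" for N
    proof (induction N)
      case 0
      have "u = (\<lambda>x. 0 + u x)" "v = (\<lambda>x. 0 + v x)" by simp_all
      then show ?case
        using \<mu> arc_sum_mono[OF K(1) AB] arc_sum_mono[OF K(2) AB]
        by (intro exI[of _ "\<lambda>x. 0"] exI[of _ u] exI[of _ v]) simp
    next
      case (Suc N)
      let ?\<mu> = "(1 - c) ^ N * \<mu>"
      have \<mu>N: "0 \<le> ?\<mu>" using c \<mu> by simp
      from Suc obtain P r s where IH: "(gauss \<gamma> ^^ (m * N)) u = (\<lambda>x. P x + r x)" "(gauss \<gamma> ^^ (m * N)) v = (\<lambda>x. P x + s x)"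
        "arc_sum r (ennreal (A * ?\<mu>))" "arc_sum s (ennreal (A * ?\<mu>))"
        "(\<integral>\<^sup>+x. r x \<partial>lborel) = ennreal ?\<mu>" "(\<integral>\<^sup>+x. s x \<partial>lborel) = ennreal ?\<mu>" by blast
      obtain r' where r': "(gauss \<gamma> ^^ m) r = (\<lambda>x. ennreal (c * ?\<mu>) * \<kappa> x + r' x)"
        "arc_sum r' (ennreal (A * ((1 - c) * ?\<mu>)))" "(\<integral>\<^sup>+x. r' x \<partial>lborel) = ennreal ((1 - c) * ?\<mu>)"
        using step[OF \<mu>N IH(5,3)] by blast
      obtain s' where s': "(gauss \<gamma> ^^ m) s = (\<lambda>x. ennreal (c * ?\<mu>) * \<kappa> x + s' x)"
        "arc_sum s' (ennreal (A * ((1 - c) * ?\<mu>)))" "(\<integral>\<^sup>+x. s' x \<partial>lborel) = ennreal ((1 - c) * ?\<mu>)"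
        using step[OF \<mu>N IH(6,4)] by blast
      have "gauss \<gamma> ^^ (m * Suc N) = gauss \<gamma> ^^ m \<circ> gauss \<gamma> ^^ (m * N)" by (simp add: funpow_add)
      then have "(gauss \<gamma> ^^ (m * Suc N)) u = (\<lambda>x. ((gauss \<gamma> ^^ m) P x + ennreal (c * ?\<mu>) * \<kappa> x) + r' x)"
        "(gauss \<gamma> ^^ (m * Suc N)) v = (\<lambda>x. ((gauss \<gamma> ^^ m) P x + ennreal (c * ?\<mu>) * \<kappa> x) + s' x)"
        by (simp_all add: IH(1,2) gauss_funpow_add r'(1) s'(1) add_ac)
      moreover have "(1 - c) * ?\<mu> = (1 - c) ^ Suc N * \<mu>" by simp
      ultimately show ?case using r'(2,3) s'(2,3)
        by (intro exI[of _ "\<lambda>x. (gauss \<gamma> ^^ m) P x + ennreal (c * ?\<mu>) * \<kappa> x"] exI[of _ r'] exI[of _ s'] conjI) (simp_all only:)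
    qed
    from this[of "n div m"] obtain P r s where
      eq: "(gauss \<gamma> ^^ (m * (n div m))) u = (\<lambda>x. P x + r x)" "(gauss \<gamma> ^^ (m * (n div m))) v = (\<lambda>x. P x + s x)"
      and rs: "arc_sum r (ennreal (A * ((1 - c) ^ (n div m) * \<mu>)))" "arc_sum s (ennreal (A * ((1 - c) ^ (n div m) * \<mu>)))"
        "(\<integral>\<^sup>+x. r x \<partial>lborel) = ennreal ((1 - c) ^ (n div m) * \<mu>)" "(\<integral>\<^sup>+x. s x \<partial>lborel) = ennreal ((1 - c) ^ (n div m) * \<mu>)"
      by blast
    let ?T = "gauss \<gamma> ^^ (n mod m)"
    have "n = n mod m + m * (n div m)" by simp
    then have "gauss \<gamma> ^^ n = ?T \<circ> gauss \<gamma> ^^ (m * (n div m))" by (metis funpow_add)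
    then have "(gauss \<gamma> ^^ n) u = (\<lambda>x. ?T P x + ?T r x)" "(gauss \<gamma> ^^ n) v = (\<lambda>x. ?T P x + ?T s x)"
      by (simp_all add: eq gauss_funpow_add)
    moreover have "?T r \<in> borel_measurable borel" "?T s \<in> borel_measurable borel"
      using arc_sum_measurable arc_sum_gauss_funpow[OF \<gamma>] rs by blast+
    moreover have "(\<integral>\<^sup>+x. ?T r x \<partial>lborel) = ennreal ((1 - c) ^ (n div m) * \<mu>)"
      "(\<integral>\<^sup>+x. ?T s x \<partial>lborel) = ennreal ((1 - c) ^ (n div m) * \<mu>)"
      by (simp_all add: nn_integral_gauss_funpow[OF \<gamma> rs(1)] nn_integral_gauss_funpow[OF \<gamma> rs(2)] rs)
    moreover have "ennreal ((1 - c) ^ (n div m) * \<mu>) \<le> ennreal (1 / (1 - c) * l ^ n * \<mu>)"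
    proof (intro ennreal_leI mult_right_mono \<mu>(1))
      have "n = m * (n div m) + n mod m" by simp
      then have "n \<le> m * (n div m) + m" using mod_less_divisor[OF m, of n] by linarith
      then have "l ^ (m * (n div m) + m) \<le> l ^ n" using l by (intro power_decreasing) auto
      then have "(1 - c) ^ (n div m) * (1 - c) \<le> l ^ n" by (simp add: power_add power_mult l(3))
      then show "(1 - c) ^ (n div m) \<le> 1 / (1 - c) * l ^ n" using c by (simp add: field_simps)
    qed
    ultimately show "\<exists>P r s. (gauss \<gamma> ^^ n) u = (\<lambda>x. P x + r x) \<and> (gauss \<gamma> ^^ n) v = (\<lambda>x. P x + s x) \<and>
        r \<in> borel_measurable borel \<and> s \<in> borel_measurable borel \<and>
        (\<integral>\<^sup>+x. r x \<partial>lborel) \<le> ennreal (1 / (1 - c) * l ^ n * \<mu>) \<and> (\<integral>\<^sup>+x. s x \<partial>lborel) \<le> ennreal (1 / (1 - c) * l ^ n * \<mu>)"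
      by (intro exI[of _ "?T P"] exI[of _ "?T r"] exI[of _ "?T s"] conjI) (simp_all only:)
  qed
qed

section \<open>Complex transfer operators\<close>

definition cper :: "(real \<Rightarrow> complex) \<Rightarrow> real \<Rightarrow> complex" where
  "cper F x = indicator {0..<1} x * (\<Sum>j. F (x + real (Suc j)))"

definition cinv :: "real \<Rightarrow> (real \<Rightarrow> complex) \<Rightarrow> real \<Rightarrow> complex" where
  "cinv \<gamma> v s = v (\<gamma> / s) * of_real (\<gamma> / s\<^sup>2)"

definition cgauss :: "real \<Rightarrow> (real \<Rightarrow> complex) \<Rightarrow> real \<Rightarrow> complex" where
  "cgauss \<gamma> v = cper (cinv \<gamma> v)"

text \<open>Bounds hold at every point, so that the operators act through everywhere convergent
  series and linearity is an equality of functions, not merely one almost everywhere.\<close>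

definition bounded_borel :: "(real \<Rightarrow> complex) \<Rightarrow> bool" where
  "bounded_borel v \<longleftrightarrow> v \<in> borel_measurable borel \<and> (\<exists>B. \<forall>x. norm (v x) \<le> B)"

text \<open>Inverse-square decay is what inversion makes of a bounded function, and it is enough for
  the folded series to converge at every point.\<close>

definition decaying :: "(real \<Rightarrow> complex) \<Rightarrow> bool" where
  "decaying F \<longleftrightarrow> F \<in> borel_measurable borel \<and> (\<exists>B. \<forall>s\<ge>1. norm (F s) \<le> B / s\<^sup>2)"

lemma bounded_borel_measurable: "bounded_borel v \<Longrightarrow> v \<in> borel_measurable borel"
  by (simp add: bounded_borel_def)

lemma decaying_measurable: "decaying F \<Longrightarrow> F \<in> borel_measurable borel"
  by (simp add: decaying_def)

lemma bounded_borel_add: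
  assumes "bounded_borel u" "bounded_borel v" shows "bounded_borel (\<lambda>x. u x + v x)"
proof -
  obtain A B where "norm (u x) \<le> A" "norm (v x) \<le> B" for x using assms unfolding bounded_borel_def by blast
  then have "norm (u x + v x) \<le> A + B" for x by (rule norm_triangle_mono)
  then show ?thesis using assms unfolding bounded_borel_def by auto
qed

lemma bounded_borel_cmult:
  assumes "bounded_borel v" shows "bounded_borel (\<lambda>x. c * v x)"
proof -
  obtain B where "norm (v x) \<le> B" for x using assms unfolding bounded_borel_def by blast
  then have "norm (c * v x) \<le> norm c * B" for x by (simp add: norm_mult mult_left_mono)
  then show ?thesis using assms unfolding bounded_borel_def by auto
qed

lemma bounded_borel_diff:
  "bounded_borel u \<Longrightarrow> bounded_borel v \<Longrightarrow> bounded_borel (\<lambda>x. u x - v x)"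
  using bounded_borel_add[of u "\<lambda>x. (-1) * v x"] bounded_borel_cmult[of v "-1"] by simp

lemma bounded_borel_indicator: "A \<in> sets borel \<Longrightarrow> bounded_borel (indicator A)"
  unfolding bounded_borel_def by (auto intro!: exI[of _ 1] split: split_indicator)

lemma decaying_cinv:
  assumes "bounded_borel v" "0 < \<gamma>" shows "decaying (cinv \<gamma> v)"
proof -
  obtain B where B: "norm (v x) \<le> B" for x using assms unfolding bounded_borel_def by blast
  note [measurable] = bounded_borel_measurable[OF assms(1)]
  have "\<forall>s\<ge>1. norm (cinv \<gamma> v s) \<le> (B * \<gamma>) / s\<^sup>2"
    using B assms(2) by (auto simp: cinv_def norm_mult norm_divide norm_power intro!: divide_right_mono mult_right_mono)
  moreover have "cinv \<gamma> v \<in> borel_measurable borel" unfolding cinv_def[abs_def] by measurable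
  ultimately show ?thesis unfolding decaying_def by blast
qed

lemma decaying_of_bounded_support:
  assumes v: "bounded_borel v" and supp: "\<And>x. c < x \<Longrightarrow> v x = 0"
  shows "decaying v"
proof -
  obtain B where B: "norm (v x) \<le> B" for x using v unfolding bounded_borel_def by blast
  have B0: "0 \<le> B" using B[of 0] norm_ge_zero order_trans by blast
  have "norm (v s) \<le> (B * (max c 0)\<^sup>2) / s\<^sup>2" if "1 \<le> s" for s
  proof (cases "c < s")
    case False
    have "norm (v s) * s\<^sup>2 \<le> B * (max c 0)\<^sup>2"
      using False that B B0 by (intro mult_mono power_mono) auto
    then show ?thesis using that by (simp add: field_simps)
  qed (use supp B0 in simp)
  then show ?thesis using bounded_borel_measurable[OF v] unfolding decaying_def by blast
qed

lemma decaying_bound: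
  assumes "decaying F"
  obtains B where "0 \<le> B" "\<And>x j. 0 \<le> x \<Longrightarrow> norm (F (x + real (Suc j))) \<le> B * (1 / (1 + real j)\<^sup>2)"
proof -
  obtain B where B: "\<And>s. s \<ge> 1 \<Longrightarrow> norm (F s) \<le> B / s\<^sup>2" using assms unfolding decaying_def by blast
  have B0: "0 \<le> B" using order_trans[OF norm_ge_zero B[of 1]] by simp
  have "norm (F (x + real (Suc j))) \<le> B * (1 / (1 + real j)\<^sup>2)" if "0 \<le> x" for x j
  proof -
    have "norm (F (x + real (Suc j))) \<le> B / (x + real (Suc j))\<^sup>2" using that by (intro B) auto
    also have "\<dots> \<le> B / (1 + real j)\<^sup>2" using that B0 by (intro divide_left_mono power_mono) (auto intro!: mult_pos_pos add_nonneg_pos)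
    finally show ?thesis by simp
  qed
  with B0 show thesis by (rule that)
qed

lemma summable_decaying:
  assumes "decaying F" "0 \<le> x"
  shows "summable (\<lambda>j. norm (F (x + real (Suc j))))"
proof -
  obtain B where B: "\<And>x j. 0 \<le> x \<Longrightarrow> norm (F (x + real (Suc j))) \<le> B * (1 / (1 + real j)\<^sup>2)"
    by (rule decaying_bound[OF assms(1)]) blast
  show ?thesis
  proof (rule summable_comparison_test')
    show "summable (\<lambda>j. B * (1 / (1 + real j)\<^sup>2))" by (rule summable_mult[OF summable_zeta2])
    show "norm (norm (F (x + real (Suc j)))) \<le> B * (1 / (1 + real j)\<^sup>2)" for j
      using B[OF assms(2), of j] by simp
  qed
qed

lemma norm_cper_le:
  assumes "decaying F"
  shows "ennreal (norm (cper F x)) \<le> per (\<lambda>s. ennreal (norm (F s))) x"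
proof (cases "x \<in> {0..<1}")
  case True
  then have s: "summable (\<lambda>j. norm (F (x + real (Suc j))))" using assms by (intro summable_decaying) auto
  have "norm (cper F x) \<le> (\<Sum>j. norm (F (x + real (Suc j))))"
    using True summable_norm[OF s] by (simp add: cper_def)
  then have "ennreal (norm (cper F x)) \<le> ennreal (\<Sum>j. norm (F (x + real (Suc j))))" by (rule ennreal_leI)
  also have "\<dots> = (\<Sum>j. ennreal (norm (F (x + real (Suc j)))))" using s by (simp add: suminf_ennreal2)
  finally show ?thesis using True by (simp add: per_def)
qed (simp add: cper_def)

lemma cper_measurable [measurable]:
  assumes [measurable]: "F \<in> borel_measurable borel"
  shows "cper F \<in> borel_measurable borel"
  unfolding cper_def[abs_def] by measurable

lemma bounded_borel_cper:
  assumes "decaying F" shows "bounded_borel (cper F)"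
proof -
  obtain B where B: "0 \<le> B" "\<And>x j. 0 \<le> x \<Longrightarrow> norm (F (x + real (Suc j))) \<le> B * (1 / (1 + real j)\<^sup>2)"
    by (rule decaying_bound[OF assms]) blast
  have "norm (cper F x) \<le> B * zeta2" for x
  proof (cases "x \<in> {0..<1}")
    case True
    then have s: "summable (\<lambda>j. norm (F (x + real (Suc j))))" using assms by (intro summable_decaying) auto
    have "norm (cper F x) \<le> (\<Sum>j. norm (F (x + real (Suc j))))"
      using True summable_norm[OF s] by (simp add: cper_def)
    also have "\<dots> \<le> (\<Sum>j. B * (1 / (1 + real j)\<^sup>2))"
      using True B by (intro suminf_le s summable_mult summable_zeta2) auto
    also have "\<dots> = B * zeta2" unfolding zeta2_def by (rule suminf_mult[OF summable_zeta2])
    finally show ?thesis .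
  qed (use B zeta2_nonneg in \<open>simp add: cper_def\<close>)
  then show ?thesis using decaying_measurable[OF assms] unfolding bounded_borel_def by auto
qed

lemma bounded_borel_cgauss: "bounded_borel v \<Longrightarrow> 0 < \<gamma> \<Longrightarrow> bounded_borel (cgauss \<gamma> v)"
  unfolding cgauss_def by (intro bounded_borel_cper decaying_cinv)

lemma bounded_borel_cgauss_funpow: "bounded_borel v \<Longrightarrow> 0 < \<gamma> \<Longrightarrow> bounded_borel ((cgauss \<gamma> ^^ n) v)"
  by (induction n) (simp_all add: bounded_borel_cgauss)

lemma cper_add:
  assumes "decaying F" "decaying G"
  shows "cper (\<lambda>s. F s + G s) = (\<lambda>x. cper F x + cper G x)"
proof
  fix x
  show "cper (\<lambda>s. F s + G s) x = cper F x + cper G x"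
  proof (cases "x \<in> {0..<1}")
    case True
    then show ?thesis
      using suminf_add[OF summable_norm_cancel[OF summable_decaying[OF assms(1)]]
          summable_norm_cancel[OF summable_decaying[OF assms(2)]], of x x]
      by (simp add: cper_def)
  qed (simp add: cper_def)
qed

lemma cper_cmult:
  assumes "decaying F"
  shows "cper (\<lambda>s. c * F s) = (\<lambda>x. c * cper F x)"
proof
  fix x
  show "cper (\<lambda>s. c * F s) x = c * cper F x"
  proof (cases "x \<in> {0..<1}")
    case True
    then show ?thesis
      using suminf_mult[OF summable_norm_cancel[OF summable_decaying[OF assms]], of x c]
      by (simp add: cper_def)
  qed (simp add: cper_def)
qed

lemma cgauss_add:
  assumes "bounded_borel u" "bounded_borel v" "0 < \<gamma>"
  shows "cgauss \<gamma> (\<lambda>x. u x + v x) = (\<lambda>x. cgauss \<gamma> u x + cgauss \<gamma> v x)"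
proof -
  have "cinv \<gamma> (\<lambda>x. u x + v x) = (\<lambda>s. cinv \<gamma> u s + cinv \<gamma> v s)"
    by (simp add: cinv_def fun_eq_iff distrib_right del: of_real_divide)
  then show ?thesis
    using cper_add[OF decaying_cinv[OF assms(1,3)] decaying_cinv[OF assms(2,3)]] by (simp add: cgauss_def)
qed

lemma cgauss_cmult:
  assumes "bounded_borel v" "0 < \<gamma>"
  shows "cgauss \<gamma> (\<lambda>x. c * v x) = (\<lambda>x. c * cgauss \<gamma> v x)"
  using cper_cmult[OF decaying_cinv[OF assms], of c]
  by (simp add: cgauss_def cinv_def[abs_def] mult_ac)

lemma cgauss_funpow_add:
  assumes "bounded_borel u" "bounded_borel v" "0 < \<gamma>"
  shows "(cgauss \<gamma> ^^ n) (\<lambda>x. u x + v x) = (\<lambda>x. (cgauss \<gamma> ^^ n) u x + (cgauss \<gamma> ^^ n) v x)"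
  by (induction n) (simp_all add: assms cgauss_add bounded_borel_cgauss_funpow)

lemma cgauss_funpow_cmult:
  assumes "bounded_borel v" "0 < \<gamma>"
  shows "(cgauss \<gamma> ^^ n) (\<lambda>x. c * v x) = (\<lambda>x. c * (cgauss \<gamma> ^^ n) v x)"
  by (induction n) (simp_all add: assms cgauss_cmult bounded_borel_cgauss_funpow)

section \<open>The L^1 norm and contraction by the transfer operator\<close>

definition l1 :: "(real \<Rightarrow> complex) \<Rightarrow> ennreal" where
  "l1 v = (\<integral>\<^sup>+x. ennreal (norm (v x)) \<partial>lborel)"

lemma l1_add_le:
  assumes [measurable]: "u \<in> borel_measurable borel" "v \<in> borel_measurable borel"
  shows "l1 (\<lambda>x. u x + v x) \<le> l1 u + l1 v"
proof -
  have "l1 (\<lambda>x. u x + v x) \<le> (\<integral>\<^sup>+x. ennreal (norm (u x)) + ennreal (norm (v x)) \<partial>lborel)"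
    unfolding l1_def by (intro nn_integral_mono) (simp add: norm_triangle_ineq flip: ennreal_plus)
  also have "\<dots> = l1 u + l1 v" unfolding l1_def by (rule nn_integral_add) auto
  finally show ?thesis .
qed

lemma l1_cmult:
  assumes [measurable]: "v \<in> borel_measurable borel"
  shows "l1 (\<lambda>x. c * v x) = ennreal (norm c) * l1 v"
  unfolding l1_def by (simp add: norm_mult ennreal_mult nn_integral_cmult)

lemma l1_cper_le:
  assumes "decaying F"
  shows "l1 (cper F) \<le> (\<integral>\<^sup>+s. ennreal (norm (F s)) * indicator {1..} s \<partial>lborel)"
proof -
  note [measurable] = decaying_measurable[OF assms]
  have "l1 (cper F) \<le> (\<integral>\<^sup>+x. per (\<lambda>s. ennreal (norm (F s))) x \<partial>lborel)"
    unfolding l1_def by (intro nn_integral_mono norm_cper_le assms)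
  then show ?thesis by (simp add: nn_integral_per)
qed

lemma l1_cgauss_le:
  assumes v: "bounded_borel v" and \<gamma>: "0 < \<gamma>"
  shows "l1 (cgauss \<gamma> v) \<le> l1 v"
proof -
  note [measurable] = bounded_borel_measurable[OF v]
  have "l1 (cgauss \<gamma> v) \<le> (\<integral>\<^sup>+s. ennreal (norm (cinv \<gamma> v s)) * indicator {1..} s \<partial>lborel)"
    unfolding cgauss_def by (rule l1_cper_le[OF decaying_cinv[OF v \<gamma>]])
  also have "\<dots> \<le> (\<integral>\<^sup>+s. ennreal (norm (v (\<gamma> / s))) * ennreal (\<gamma> / s\<^sup>2) * indicator {0<..} s \<partial>lborel)"
    using \<gamma> by (intro nn_integral_mono)
      (auto simp: cinv_def norm_mult norm_divide norm_power ennreal_mult[symmetric] split: split_indicator)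
  also have "\<dots> = (\<integral>\<^sup>+x. ennreal (norm (v x)) * indicator {0<..} x \<partial>lborel)"
    by (rule nn_integral_inversion) (use \<gamma> in auto)
  also have "\<dots> \<le> l1 v" unfolding l1_def by (intro nn_integral_mono) (auto split: split_indicator)
  finally show ?thesis .
qed

lemma l1_cgauss_funpow_le: "bounded_borel v \<Longrightarrow> 0 < \<gamma> \<Longrightarrow> l1 ((cgauss \<gamma> ^^ n) v) \<le> l1 v"
  by (induction n) (auto intro: order_trans[OF l1_cgauss_le] bounded_borel_cgauss_funpow)

section \<open>Comparison of the complex operators with the nonnegative ones\<close>

definition cplx :: "(real \<Rightarrow> ennreal) \<Rightarrow> real \<Rightarrow> complex" where
  "cplx u x = of_real (enn2real (u x))"

lemma cplx_measurable [measurable]: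
  assumes [measurable]: "u \<in> borel_measurable borel"
  shows "cplx u \<in> borel_measurable borel"
  unfolding cplx_def[abs_def] by measurable

lemma bounded_borel_cplx:
  assumes "u \<in> borel_measurable borel" "\<And>x. u x \<le> ennreal B"
  shows "bounded_borel (cplx u)"
proof -
  have "enn2real (u x) \<le> max B 0" for x
    using enn2real_mono[OF order_trans[OF assms(2) ennreal_leI[OF max.cobounded1[of B 0]]]] by simp
  then show ?thesis using assms(1) unfolding bounded_borel_def cplx_def[abs_def]
    by (auto intro!: exI[of _ "max B 0"])
qed

lemma cplx_add:
  assumes "u x \<noteq> top" "v x \<noteq> top"
  shows "cplx (\<lambda>x. u x + v x) x = cplx u x + cplx v x"
  using assms by (simp add: cplx_def enn2real_plus less_top)

text \<open>\<open>enn2real\<close> sends \<infinity> to 0, so the values of \<open>F\<close> have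
  to be finite; summability at each point comes from the decay.\<close>

lemma cper_cplx:
  assumes dec: "decaying (cplx F)" and fin: "\<And>s. 1 \<le> s \<Longrightarrow> F s \<noteq> top"
  shows "cper (cplx F) = cplx (per F)"
proof
  fix x
  show "cper (cplx F) x = cplx (per F) x"
  proof (cases "x \<in> {0..<1}")
    case True
    let ?f = "\<lambda>j. enn2real (F (x + real (Suc j)))"
    have s: "summable ?f" using summable_decaying[OF dec, of x] True by (simp add: cplx_def)
    have "(\<Sum>j. F (x + real (Suc j))) = (\<Sum>j. ennreal (?f j))"
      using fin True by (intro suminf_cong) (simp add: less_top)
    also have "\<dots> = ennreal (\<Sum>j. ?f j)" using s by (intro suminf_ennreal2) auto
    finally have "enn2real (\<Sum>j. F (x + real (Suc j))) = (\<Sum>j. ?f j)"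
      using s by (simp add: suminf_nonneg)
    then show ?thesis using True s by (simp add: cper_def cplx_def per_def suminf_of_real)
  qed (auto simp: cper_def cplx_def per_def)
qed

lemma cgauss_cplx:
  assumes u: "u \<in> borel_measurable borel" "\<And>x. u x \<le> ennreal B" and \<gamma>: "0 < \<gamma>"
  shows "cgauss \<gamma> (cplx u) = cplx (gauss \<gamma> u)"
proof -
  have inv: "cinv \<gamma> (cplx u) = cplx (inv_pf \<gamma> u)"
    using \<gamma> by (auto simp: fun_eq_iff cinv_def cplx_def inv_pf_def enn2real_mult)
  have "cper (cplx (inv_pf \<gamma> u)) = cplx (per (inv_pf \<gamma> u))"
  proof (rule cper_cplx)
    show "decaying (cplx (inv_pf \<gamma> u))"
      unfolding inv[symmetric] by (rule decaying_cinv[OF bounded_borel_cplx[OF u] \<gamma>])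
    show "inv_pf \<gamma> u s \<noteq> top" for s
      using u(2)[of "\<gamma> / s"] by (auto simp: inv_pf_def ennreal_mult_eq_top_iff top_unique)
  qed
  then show ?thesis by (simp add: cgauss_def gauss_def inv)
qed

lemma cgauss_funpow_cplx:
  assumes "1 < \<gamma>" "arc_sum u (ennreal S)"
  shows "(cgauss \<gamma> ^^ n) (cplx u) = cplx ((gauss \<gamma> ^^ n) u)"
proof (induction n)
  case (Suc n)
  note K = arc_sum_gauss_funpow[OF assms, of n]
  have "(gauss \<gamma> ^^ n) u x \<le> ennreal (2 * (6 ^ n * S))" for x
    using arc_sum_le[OF K, of x] by (simp add: ennreal_mult' ennreal_power[symmetric])
  from cgauss_cplx[OF arc_sum_measurable[OF K] this] show ?case using assms(1) by (simp add: Suc)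
qed simp

section \<open>The Neumann series\<close>

text \<open>The nonnegative change of variables, applied to indicators, identifies two measures;
  Bochner integrals with respect to them then agree as well.\<close>

lemma integral_inversion:
  fixes g :: "real \<Rightarrow> complex"
  assumes [measurable]: "g \<in> borel_measurable borel" and c: "0 < c"
  shows "(\<integral>x. indicator {0<..} x *\<^sub>R g x \<partial>lborel) = (\<integral>s. (c / s\<^sup>2 * indicator {0<..} s) *\<^sub>R g (c / s) \<partial>lborel)"
proof -
  let ?M = "density lborel (\<lambda>s. ennreal (c / s\<^sup>2 * indicator {0<..} s))"
  have eq: "distr ?M borel (\<lambda>s. c / s) = density lborel (\<lambda>x. ennreal (indicator {0<..} x))"
  proof (rule measure_eqI)
    fix A assume "A \<in> sets (distr ?M borel (\<lambda>s. c / s))"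
    then have [measurable]: "A \<in> sets borel" by simp
    have "emeasure (distr ?M borel (\<lambda>s. c / s)) A
        = (\<integral>\<^sup>+s. ennreal (c / s\<^sup>2 * indicator {0<..} s) * indicator ((\<lambda>s. c / s) -` A) s \<partial>lborel)"
      by (subst emeasure_distr) (auto simp: emeasure_density measurable_sets_borel[of _ borel])
    also have "\<dots> = (\<integral>\<^sup>+s. indicator A (c / s) * ennreal (c / s\<^sup>2) * indicator {0<..} s \<partial>lborel)"
      by (intro nn_integral_cong) (auto split: split_indicator)
    also have "\<dots> = (\<integral>\<^sup>+v. indicator A v * indicator {0<..} v \<partial>lborel)"
      by (rule nn_integral_inversion) (use c in auto)
    also have "\<dots> = emeasure (density lborel (\<lambda>x. ennreal (indicator {0<..} x))) A"
      by (simp add: emeasure_density) (intro nn_integral_cong, auto split: split_indicator)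
    finally show "emeasure (distr ?M borel (\<lambda>s. c / s)) A = emeasure (density lborel (\<lambda>x. ennreal (indicator {0<..} x))) A" .
  qed simp
  have "(\<integral>x. indicator {0<..} x *\<^sub>R g x \<partial>lborel) = integral\<^sup>L (density lborel (\<lambda>x. ennreal (indicator {0<..} x))) g"
    by (rule integral_density[symmetric]) auto
  also have "\<dots> = integral\<^sup>L ?M (\<lambda>s. g (c / s))"
    unfolding eq[symmetric] by (rule integral_distr) auto
  also have "\<dots> = (\<integral>s. (c / s\<^sup>2 * indicator {0<..} s) *\<^sub>R g (c / s) \<partial>lborel)"
    by (rule integral_density) (use c in \<open>auto split: split_indicator\<close>)
  finally show ?thesis .
qed

lemma integrable_of_l1:
  assumes "v \<in> borel_measurable borel" "l1 v \<noteq> top"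
  shows "integrable lborel v"
  using assms by (intro integrableI_bounded) (auto simp: l1_def less_top)

lemma l1_mult_bounded_le:
  assumes [measurable]: "v \<in> borel_measurable borel" and \<phi>: "\<And>x. norm (\<phi> x) \<le> 1"
  shows "l1 (\<lambda>x. v x * \<phi> x) \<le> l1 v"
  unfolding l1_def using \<phi> by (intro nn_integral_mono ennreal_leI) (simp add: norm_mult mult_left_le)

lemma integrable_mult_bounded:
  assumes [measurable]: "v \<in> borel_measurable borel" "\<phi> \<in> borel_measurable borel"
    and "l1 v \<noteq> top" "\<And>x. norm (\<phi> x) \<le> 1"
  shows "integrable lborel (\<lambda>x. v x * \<phi> x)"
  using l1_mult_bounded_le[of v \<phi>] assms by (intro integrable_of_l1) (auto simp: top_unique)

lemma l1_bounded_support: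
  assumes "bounded_borel v" "\<And>x. x \<notin> {a..b} \<Longrightarrow> v x = 0"
  shows "l1 v \<noteq> top"
proof -
  obtain B where B: "norm (v x) \<le> B" for x using assms(1) unfolding bounded_borel_def by blast
  have "l1 v \<le> (\<integral>\<^sup>+x. ennreal B * indicator {a..b} x \<partial>lborel)"
    unfolding l1_def using B assms(2) by (intro nn_integral_mono) (auto split: split_indicator intro: ennreal_leI)
  also have "\<dots> < top" by (auto simp: nn_integral_cmult_indicator ennreal_mult_less_top emeasure_lborel_Icc_eq)
  finally show ?thesis by simp
qed

lemma cper_eq_0: "x \<notin> {0..<1} \<Longrightarrow> cper F x = 0"
  by (simp add: cper_def)

lemma l1_cper_finite: "decaying F \<Longrightarrow> l1 (cper F) \<noteq> top"
  by (rule l1_bounded_support[OF bounded_borel_cper, of F 0 1]) (auto intro: cper_eq_0)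

text \<open>Unfolding: a 1-periodic factor passes through the folding. Both sides are sums over unit
  cells, and the inverse-square decay justifies exchanging sum and integral on each side.\<close>

lemma integral_per:
  assumes F: "decaying F" and \<phi>[measurable]: "\<phi> \<in> borel_measurable borel"
    and bd: "\<And>x. norm (\<phi> x) \<le> 1" and per: "\<And>x. \<phi> (x + 1) = \<phi> x"
  shows "(\<integral>x. cper F x * \<phi> x \<partial>lborel) = (\<integral>s. indicator {1..} s * (F s * \<phi> s) \<partial>lborel)"
proof -
  note [measurable] = decaying_measurable[OF F]
  have \<phi>n: "\<phi> (x + real n) = \<phi> x" for x n
    by (induction n) (use per in \<open>auto simp: add.assoc[symmetric] add.commute[of 1]\<close>)
  obtain B where B: "0 \<le> B" "\<And>x j. 0 \<le> x \<Longrightarrow> norm (F (x + real (Suc j))) \<le> B * (1 / (1 + real j)\<^sup>2)"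
    by (rule decaying_bound[OF F]) blast
  let ?f = "\<lambda>j s. indicator {0..<1} (s - real (Suc j)) * (F s * \<phi> s)"
  let ?g = "\<lambda>j x. indicator {0..<1} x * (F (x + real (Suc j)) * \<phi> x)"
  have g_le: "norm (?g j x) \<le> B * (1 / (1 + real j)\<^sup>2) * indicator {0..<1} x" for j x
    using mult_mono[OF B(2)[of x j] bd[of x]] B(1)
    by (auto simp: norm_mult split: split_indicator simp del: of_nat_Suc)
  have int_g: "integrable lborel (?g j)" for j
  proof (rule integrable_of_l1)
    have "norm (?g j x) \<le> B * (1 / (1 + real j)\<^sup>2)" for x
      using g_le[of x j] B(1) by (auto split: split_indicator_asm simp del: of_nat_Suc)
    then have "bounded_borel (?g j)" unfolding bounded_borel_def by (intro conjI exI allI) measurable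
    then show "l1 (?g j) \<noteq> top" by (rule l1_bounded_support[of _ 0 1]) (auto split: split_indicator)
  qed measurable
  have shift: "?f j (real (Suc j) + 1 * x) = ?g j x" for j x
    using \<phi>n[of x "Suc j"] by (simp add: add.commute del: of_nat_Suc)
  have int_f: "integrable lborel (?f j)" for j
    using int_g[of j] lborel_integrable_real_affine_iff[of 1 "?f j" "real (Suc j)"] unfolding shift by simp
  have eq_fg: "integral\<^sup>L lborel (?f j) = integral\<^sup>L lborel (?g j)" for j
    using lborel_integral_real_affine[of 1 "?f j" "real (Suc j)"] unfolding shift by simp
  have eq_fgn: "(\<integral>x. norm (?f j x) \<partial>lborel) = (\<integral>x. norm (?g j x) \<partial>lborel)" for j
    using lborel_integral_real_affine[of 1 "\<lambda>x. norm (?f j x)" "real (Suc j)"] unfolding shift by simp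
  have summ_int: "summable (\<lambda>j. \<integral>x. norm (?g j x) \<partial>lborel)"
  proof (rule summable_comparison_test')
    show "summable (\<lambda>j. B * (1 / (1 + real j)\<^sup>2))" by (rule summable_mult[OF summable_zeta2])
    fix j
    have "(\<integral>x. norm (?g j x) \<partial>lborel) \<le> (\<integral>x. B * (1 / (1 + real j)\<^sup>2) * indicator {0..<1::real} x \<partial>lborel)"
    proof (rule Bochner_Integration.integral_mono)
      show "integrable lborel (\<lambda>x. norm (?g j x))" by (rule integrable_norm[OF int_g])
      show "integrable lborel (\<lambda>x. B * (1 / (1 + real j)\<^sup>2) * indicator {0..<1::real} x)"
        by (intro integrable_mult_right) (auto simp: integrable_indicator_iff)
    qed (rule g_le)
    also have "\<dots> = B * (1 / (1 + real j)\<^sup>2)" by simp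
    finally show "norm (\<integral>x. norm (?g j x) \<partial>lborel) \<le> B * (1 / (1 + real j)\<^sup>2)" by simp
  qed
  have f_sums: "summable (\<lambda>j. norm (?f j s)) \<and> (\<Sum>j. ?f j s) = indicator {1..} s * (F s * \<phi> s)" for s
  proof -
    define k where "k = nat (\<lfloor>s\<rfloor> - 1)"
    have z: "s - real (Suc j) \<notin> {0..<1}" if "j \<notin> {k}" for j
    proof
      assume a: "s - real (Suc j) \<in> {0..<1}"
      then have "\<lfloor>s\<rfloor> = int j + 1" by (intro floor_unique) auto
      with that show False by (simp add: k_def)
    qed
    have s1: "s - real (Suc k) \<in> {0..<1} \<longleftrightarrow> 1 \<le> s"
    proof
      assume "1 \<le> s"
      then show "s - real (Suc k) \<in> {0..<1}" by (auto simp: k_def) linarith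
    qed auto
    have z0: "?f j s = 0" if "j \<notin> {k}" for j using z[OF that] by (simp del: of_nat_Suc)
    have "(\<Sum>j. ?f j s) = (\<Sum>j\<in>{k}. ?f j s)" by (rule suminf_finite) (use z0 in auto)
    also have "\<dots> = indicator {1..} s * (F s * \<phi> s)" using s1 by (simp add: indicator_def del: of_nat_Suc)
    moreover have "summable (\<lambda>j. norm (?f j s))"
      by (rule summable_finite[of "{k}"]) (use z0 in \<open>auto simp del: of_nat_Suc\<close>)
    ultimately show ?thesis by simp
  qed
  have "summable (\<lambda>j. norm (?g j x))" for x
    by (rule summable_comparison_test'[OF summable_mult[OF summable_zeta2, of "B * indicator {0..<1} x"]])
       (use g_le[of x] in \<open>simp add: mult_ac\<close>)
  moreover have "cper F x * \<phi> x = (\<Sum>j. ?g j x)" for x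
  proof (cases "x \<in> {0..<1}")
    case True
    then have "(\<Sum>j. F (x + real (Suc j)) * \<phi> x) = (\<Sum>j. F (x + real (Suc j))) * \<phi> x"
      by (intro suminf_mult2[symmetric] summable_norm_cancel[OF summable_decaying[OF F]]) auto
    then show ?thesis using True by (simp add: cper_def)
  qed (simp add: cper_def)
  ultimately have "(\<integral>x. cper F x * \<phi> x \<partial>lborel) = (\<Sum>j. integral\<^sup>L lborel (?g j))"
    using integral_suminf[OF int_g _ summ_int] by simp
  also have "\<dots> = (\<Sum>j. integral\<^sup>L lborel (?f j))" by (simp only: eq_fg)
  also have "\<dots> = (\<integral>x. (\<Sum>j. ?f j x) \<partial>lborel)"
    using summ_int f_sums unfolding eq_fgn[symmetric] by (intro integral_suminf[symmetric] int_f) auto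
  also have "\<dots> = (\<integral>s. indicator {1..} s * (F s * \<phi> s) \<partial>lborel)" using f_sums by simp
  finally show ?thesis .
qed

text \<open>The duality that defines a transfer operator; reduction mod 1 is invisible to the
  periodic \<phi>.\<close>

lemma integral_cgauss:
  assumes v: "bounded_borel v" and supp: "\<And>x. x \<notin> {0..\<gamma>} \<Longrightarrow> v x = 0" and \<gamma>: "0 < \<gamma>"
    and \<phi>[measurable]: "\<phi> \<in> borel_measurable borel"
    and bd: "\<And>x. norm (\<phi> x) \<le> 1" and per: "\<And>x. \<phi> (x + 1) = \<phi> x"
  shows "(\<integral>x. cgauss \<gamma> v x * \<phi> x \<partial>lborel) = (\<integral>x. v x * \<phi> (\<gamma> / x) \<partial>lborel)"
proof -
  note [measurable] = bounded_borel_measurable[OF v]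
  have "(\<integral>x. v x * \<phi> (\<gamma> / x) \<partial>lborel) = (\<integral>x. indicator {0<..} x *\<^sub>R (v x * \<phi> (\<gamma> / x)) \<partial>lborel)"
  proof (rule integral_cong_AE)
    show "AE x in lborel. v x * \<phi> (\<gamma> / x) = indicator {0<..} x *\<^sub>R (v x * \<phi> (\<gamma> / x))"
      using AE_lborel_singleton[of 0] by eventually_elim (use supp in \<open>auto split: split_indicator\<close>)
  qed measurable
  also have "\<dots> = (\<integral>s. (\<gamma> / s\<^sup>2 * indicator {0<..} s) *\<^sub>R (v (\<gamma> / s) * \<phi> (\<gamma> / (\<gamma> / s))) \<partial>lborel)"
    by (rule integral_inversion) (use \<gamma> in auto)
  also have "\<dots> = (\<integral>s. indicator {1..} s * (cinv \<gamma> v s * \<phi> s) \<partial>lborel)"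
  proof (intro Bochner_Integration.integral_cong refl)
    fix s :: real
    have "v (\<gamma> / s) = 0" if "0 < s" "s < 1" using that \<gamma> by (intro supp) (auto simp: field_simps)
    then show "(\<gamma> / s\<^sup>2 * indicator {0<..} s) *\<^sub>R (v (\<gamma> / s) * \<phi> (\<gamma> / (\<gamma> / s))) = indicator {1..} s * (cinv \<gamma> v s * \<phi> s)"
      using \<gamma> by (auto simp: cinv_def scaleR_conv_of_real split: split_indicator)
  qed
  also have "\<dots> = (\<integral>x. cgauss \<gamma> v x * \<phi> x \<partial>lborel)"
    unfolding cgauss_def by (rule integral_per[symmetric]) (use v \<gamma> bd per in \<open>auto intro: decaying_cinv\<close>)
  finally show ?thesis by simp
qed

text \<open>With \<open>u\<close> the restriction of \<open>f\<close> to \<open>(0,1)\<close>, \<open>g\<close> the one to \<open>[1,\<gamma>]\<close> and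
  \<open>f s = cinv \<gamma> w s\<close> for \<open>s > \<gamma>\<close>, the two families of orthogonality conditions read
  \<open>u + cper g + cgauss \<gamma> w = 0\<close> and \<open>w + cgauss \<gamma> g + cgauss \<gamma> u = 0\<close>. Eliminating \<open>w\<close>
  gives \<open>u - cgauss \<gamma> (cgauss \<gamma> u) = defect \<gamma> 0 g\<close>, which the Neumann series solves.\<close>

definition defect :: "real \<Rightarrow> nat \<Rightarrow> (real \<Rightarrow> complex) \<Rightarrow> real \<Rightarrow> complex" where
  "defect \<gamma> k g = (cgauss \<gamma> ^^ (2 * k)) (\<lambda>x. cgauss \<gamma> (cgauss \<gamma> g) x - cper g x)"

text \<open>Apart from single points the three summands live on [1,\<gamma>], (0,1) and
  (\<gamma>,\<infinity>): the function in the argument of \<open>cinv\<close> vanishes outside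
  [0,1), and \<open>\<gamma> / x < 1\<close> means \<open>x > \<gamma>\<close>.\<close>

definition extend :: "real \<Rightarrow> (real \<Rightarrow> complex) \<Rightarrow> real \<Rightarrow> complex" where
  "extend \<gamma> g = (\<lambda>x. g x + indicator {0<..} x * ((\<Sum>k. defect \<gamma> k g x)
     + cinv \<gamma> (\<lambda>y. - cgauss \<gamma> g y - (\<Sum>k. cgauss \<gamma> (defect \<gamma> k g) y)) x))"

definition supported_on :: "real set \<Rightarrow> (real \<Rightarrow> complex) \<Rightarrow> bool" where
  "supported_on I g \<longleftrightarrow> bounded_borel g \<and> (\<forall>x. x \<notin> I \<longrightarrow> g x = 0)"

section \<open>Linearity and L^1 bounds for the defects\<close>

lemma supported_onD:
  assumes "supported_on {1..\<gamma>} g"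
  shows "bounded_borel g" "x \<notin> {1..\<gamma>} \<Longrightarrow> g x = 0" "decaying g" "l1 g \<noteq> top"
proof -
  show b: "bounded_borel g" and z: "x \<notin> {1..\<gamma>} \<Longrightarrow> g x = 0" for x using assms by (auto simp: supported_on_def)
  show "decaying g" by (rule decaying_of_bounded_support[OF b, of \<gamma>]) (rule z, simp)
  show "l1 g \<noteq> top" by (rule l1_bounded_support[OF b z])
qed

lemma supported_on_add: "supported_on I g \<Longrightarrow> supported_on I h \<Longrightarrow> supported_on I (\<lambda>x. g x + h x)"
  by (auto simp: supported_on_def intro: bounded_borel_add)

lemma supported_on_cmult: "supported_on I g \<Longrightarrow> supported_on I (\<lambda>x. c * g x)"
  by (auto simp: supported_on_def intro: bounded_borel_cmult)

lemma cgauss_eq_0: "x \<notin> {0..<1} \<Longrightarrow> cgauss \<gamma> v x = 0"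
  by (simp add: cgauss_def cper_eq_0)

lemma bounded_borel_defect:
  assumes "supported_on {1..\<gamma>} g" "0 < \<gamma>" shows "bounded_borel (defect \<gamma> k g)"
  unfolding defect_def
  by (intro bounded_borel_cgauss_funpow bounded_borel_diff bounded_borel_cgauss bounded_borel_cper
      supported_onD[OF assms(1)] assms(2))

lemma defect_eq_0: "x \<notin> {0..<1} \<Longrightarrow> defect \<gamma> k g x = 0"
  by (cases k) (auto simp: defect_def cgauss_eq_0 cper_eq_0)

lemma defect_Suc: "defect \<gamma> (Suc k) g = cgauss \<gamma> (cgauss \<gamma> (defect \<gamma> k g))"
  by (simp add: defect_def)

lemma defect_0: "defect \<gamma> 0 g = (\<lambda>x. cgauss \<gamma> (cgauss \<gamma> g) x - cper g x)"
  by (simp add: defect_def)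

lemma defect_add:
  assumes g: "supported_on {1..\<gamma>} g" and h: "supported_on {1..\<gamma>} h" and \<gamma>: "0 < \<gamma>"
  shows "defect \<gamma> k (\<lambda>x. g x + h x) = (\<lambda>x. defect \<gamma> k g x + defect \<gamma> k h x)"
proof -
  note [simp] = supported_onD(1,3)[OF g] supported_onD(1,3)[OF h] \<gamma>
  have "(\<lambda>x. cgauss \<gamma> (cgauss \<gamma> (\<lambda>x. g x + h x)) x - cper (\<lambda>x. g x + h x) x)
     = (\<lambda>x. (cgauss \<gamma> (cgauss \<gamma> g) x - cper g x) + (cgauss \<gamma> (cgauss \<gamma> h) x - cper h x))"
    by (simp add: cgauss_add cper_add bounded_borel_cgauss algebra_simps)
  then show ?thesis
    unfolding defect_def
    by (simp only:) (intro cgauss_funpow_add bounded_borel_diff bounded_borel_cgauss bounded_borel_cper; simp)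
qed

lemma defect_cmult:
  assumes g: "supported_on {1..\<gamma>} g" and \<gamma>: "0 < \<gamma>"
  shows "defect \<gamma> k (\<lambda>x. c * g x) = (\<lambda>x. c * defect \<gamma> k g x)"
proof -
  note [simp] = supported_onD(1,3)[OF g] \<gamma>
  have "(\<lambda>x. cgauss \<gamma> (cgauss \<gamma> (\<lambda>x. c * g x)) x - cper (\<lambda>x. c * g x) x)
     = (\<lambda>x. c * (cgauss \<gamma> (cgauss \<gamma> g) x - cper g x))"
    by (simp add: cgauss_cmult cper_cmult bounded_borel_cgauss algebra_simps)
  then show ?thesis
    unfolding defect_def
    by (simp only:) (intro cgauss_funpow_cmult bounded_borel_diff bounded_borel_cgauss bounded_borel_cper; simp)
qed

text \<open>There is no decay in \<open>k\<close>, but no regularity of \<open>g\<close> either;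
  this disposes of uniformly small errors and of functions that vanish almost everywhere.\<close>

lemma l1_defect_le:
  assumes g: "supported_on {1..\<gamma>} g" and \<gamma>: "0 < \<gamma>"
  shows "l1 (defect \<gamma> k g) \<le> 2 * l1 g"
proof -
  note g' = supported_onD(1,3)[OF g]
  note [measurable] = bounded_borel_measurable[OF g'(1)] bounded_borel_measurable[OF bounded_borel_cgauss[OF bounded_borel_cgauss[OF g'(1) \<gamma>] \<gamma>]]
  have "l1 (defect \<gamma> k g) \<le> l1 (\<lambda>x. cgauss \<gamma> (cgauss \<gamma> g) x + (-1) * cper g x)"
    unfolding defect_def using l1_cgauss_funpow_le[OF bounded_borel_diff[OF bounded_borel_cgauss[OF bounded_borel_cgauss[OF g'(1) \<gamma>] \<gamma>] bounded_borel_cper[OF g'(2)]] \<gamma>]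
    by simp
  also have "\<dots> \<le> l1 (cgauss \<gamma> (cgauss \<gamma> g)) + l1 (\<lambda>x. (-1) * cper g x)"
    by (rule l1_add_le) measurable
  also have "l1 (\<lambda>x. (-1) * cper g x) = l1 (cper g)" by (simp add: l1_def)
  also have "l1 (cper g) \<le> l1 g"
    using l1_cper_le[OF g'(2)] by (rule order_trans) (auto simp: l1_def intro!: nn_integral_mono split: split_indicator)
  also have "l1 (cgauss \<gamma> (cgauss \<gamma> g)) \<le> l1 g"
    using l1_cgauss_le[OF bounded_borel_cgauss[OF g'(1) \<gamma>] \<gamma>] l1_cgauss_le[OF g'(1) \<gamma>] by (rule order_trans)
  finally show ?thesis by (simp add: mult_2 add_mono)
qed

text \<open>A series whose L^1 norms are summable converges absolutely almost everywhere and may be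
  integrated term by term against bounded functions. Exceptional points remain, which is why the
  extension is linear only almost everywhere.\<close>

lemma l1_series:
  fixes v :: "nat \<Rightarrow> real \<Rightarrow> complex"
  assumes [measurable]: "\<And>k. v k \<in> borel_measurable borel" and fin: "(\<Sum>k. l1 (v k)) \<noteq> top"
  shows "AE x in lborel. summable (\<lambda>k. norm (v k x))"
    and "l1 (\<lambda>x. \<Sum>k. v k x) \<le> (\<Sum>k. l1 (v k))"
    and "(\<lambda>x. \<Sum>k. v k x) \<in> borel_measurable borel"
    and "\<phi> \<in> borel_measurable borel \<Longrightarrow> (\<And>x. norm (\<phi> x) \<le> 1) \<Longrightarrow>
      (\<lambda>k. \<integral>x. v k x * \<phi> x \<partial>lborel) sums (\<integral>x. (\<Sum>k. v k x) * \<phi> x \<partial>lborel)"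
proof -
  have eq: "(\<integral>\<^sup>+x. (\<Sum>k. ennreal (norm (v k x))) \<partial>lborel) = (\<Sum>k. l1 (v k))"
    unfolding l1_def by (rule nn_integral_suminf) measurable
  have "AE x in lborel. (\<Sum>k. ennreal (norm (v k x))) \<noteq> \<infinity>"
    by (rule nn_integral_PInf_AE) (use fin eq in auto)
  then show ae: "AE x in lborel. summable (\<lambda>k. norm (v k x))"
    by eventually_elim (auto intro: summable_suminf_not_top)
  show [measurable]: "(\<lambda>x. \<Sum>k. v k x) \<in> borel_measurable borel" by measurable
  have "l1 (\<lambda>x. \<Sum>k. v k x) \<le> (\<integral>\<^sup>+x. (\<Sum>k. ennreal (norm (v k x))) \<partial>lborel)"
    unfolding l1_def
  proof (rule nn_integral_mono_AE)
    show "AE x in lborel. ennreal (norm (\<Sum>k. v k x)) \<le> (\<Sum>k. ennreal (norm (v k x)))"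
      using ae
    proof eventually_elim
      case (elim x)
      have "ennreal (norm (\<Sum>k. v k x)) \<le> ennreal (\<Sum>k. norm (v k x))" by (intro ennreal_leI summable_norm elim)
      then show ?case using elim by (simp add: suminf_ennreal2)
    qed
  qed
  then show "l1 (\<lambda>x. \<Sum>k. v k x) \<le> (\<Sum>k. l1 (v k))" by (simp only: eq)
  assume \<phi>[measurable]: "\<phi> \<in> borel_measurable borel" and bd: "\<And>x. norm (\<phi> x) \<le> 1"
  have fink: "l1 (v k) \<noteq> top" for k
    using fin sum_le_suminf[OF summableI, of "{k}" "\<lambda>k. l1 (v k)"] by (auto simp: top_unique)
  have int: "integrable lborel (\<lambda>x. v k x * \<phi> x)" for k
    by (rule integrable_mult_bounded[OF _ _ fink bd]) measurable
  have nn: "(\<integral>x. norm (v k x * \<phi> x) \<partial>lborel) = enn2real (l1 (\<lambda>x. v k x * \<phi> x))" for k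
    unfolding l1_def using int[of k] by (subst integral_eq_nn_integral) auto
  have "summable (\<lambda>k. enn2real (l1 (v k)))"
  proof (rule summable_suminf_not_top)
    show "(\<Sum>k. ennreal (enn2real (l1 (v k)))) \<noteq> top" using fin fink by (simp add: less_top)
  qed simp
  then have summ: "summable (\<lambda>k. \<integral>x. norm (v k x * \<phi> x) \<partial>lborel)"
  proof (rule summable_comparison_test'[where N=0])
    fix k
    have "enn2real (l1 (\<lambda>x. v k x * \<phi> x)) \<le> enn2real (l1 (v k))"
      by (rule enn2real_mono[OF l1_mult_bounded_le]) (use fink bd in \<open>auto simp: less_top\<close>)
    then show "norm (\<integral>x. norm (v k x * \<phi> x) \<partial>lborel) \<le> enn2real (l1 (v k))" by (simp add: nn)
  qed
  have ae2: "AE x in lborel. summable (\<lambda>k. norm (v k x * \<phi> x))"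
    using ae
  proof eventually_elim
    case (elim x)
    then show ?case
      by (rule summable_comparison_test'[where N=0]) (use bd in \<open>simp add: norm_mult mult_left_le\<close>)
  qed
  have "(\<lambda>k. \<integral>x. v k x * \<phi> x \<partial>lborel) sums (\<integral>x. (\<Sum>k. v k x * \<phi> x) \<partial>lborel)"
    by (rule sums_integral[OF int ae2 summ])
  also have "(\<integral>x. (\<Sum>k. v k x * \<phi> x) \<partial>lborel) = (\<integral>x. (\<Sum>k. v k x) * \<phi> x \<partial>lborel)"
  proof (rule integral_cong_AE)
    show "AE x in lborel. (\<Sum>k. v k x * \<phi> x) = (\<Sum>k. v k x) * \<phi> x"
      using ae by eventually_elim (rule suminf_mult2[symmetric, OF summable_norm_cancel])
  qed measurable
  finally show "(\<lambda>k. \<integral>x. v k x * \<phi> x \<partial>lborel) sums (\<integral>x. (\<Sum>k. v k x) * \<phi> x \<partial>lborel)" .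
qed

definition tail_part :: "real \<Rightarrow> (real \<Rightarrow> complex) \<Rightarrow> real \<Rightarrow> complex" where
  "tail_part \<gamma> g y = - cgauss \<gamma> g y - (\<Sum>k. cgauss \<gamma> (defect \<gamma> k g) y)"

lemma extend_eq: "extend \<gamma> g = (\<lambda>x. g x + (indicator {0<..} x * (\<Sum>k. defect \<gamma> k g x)
     + indicator {0<..} x * cinv \<gamma> (tail_part \<gamma> g) x))"
  by (simp add: extend_def tail_part_def[abs_def] distrib_left)

text \<open>Inversion preserves the L^1 norm on the half-line.\<close>

lemma l1_indicator_cinv:
  assumes [measurable]: "w \<in> borel_measurable borel" and \<gamma>: "0 < \<gamma>"
  shows "l1 (\<lambda>x. indicator {0<..} x * cinv \<gamma> w x) \<le> l1 w"
proof -
  have "l1 (\<lambda>x. indicator {0<..} x * cinv \<gamma> w x)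
     = (\<integral>\<^sup>+s. ennreal (norm (w (\<gamma> / s))) * ennreal (\<gamma> / s\<^sup>2) * indicator {0<..} s \<partial>lborel)"
    unfolding l1_def using \<gamma> by (intro nn_integral_cong)
      (auto simp: cinv_def norm_mult norm_divide norm_power ennreal_mult[symmetric] split: split_indicator)
  also have "\<dots> = (\<integral>\<^sup>+x. ennreal (norm (w x)) * indicator {0<..} x \<partial>lborel)"
    by (rule nn_integral_inversion) (use \<gamma> in auto)
  also have "\<dots> \<le> l1 w" unfolding l1_def by (intro nn_integral_mono) (auto split: split_indicator)
  finally show ?thesis .
qed

text \<open>Summability of the defects is all the construction asks for; bounded variation enters
  later, to guarantee it.\<close>

locale summable_defect =
  fixes \<gamma> :: real and g :: "real \<Rightarrow> complex"
  assumes \<gamma>: "1 < \<gamma>" and g: "supported_on {1..\<gamma>} g" and fin: "(\<Sum>k. l1 (defect \<gamma> k g)) \<noteq> top"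
begin

lemma \<gamma>0: "0 < \<gamma>"
  using \<gamma> by simp

lemma measurable_g [measurable]: "g \<in> borel_measurable borel"
  and measurable_defect [measurable]: "defect \<gamma> k g \<in> borel_measurable borel"
  and measurable_cgauss_g [measurable]: "cgauss \<gamma> g \<in> borel_measurable borel"
  and measurable_cgauss_defect [measurable]: "cgauss \<gamma> (defect \<gamma> k g) \<in> borel_measurable borel"
  using bounded_borel_measurable bounded_borel_cgauss bounded_borel_defect[OF g] supported_onD(1)[OF g] \<gamma>0 by blast+

lemma fin_cgauss: "(\<Sum>k. l1 (cgauss \<gamma> (defect \<gamma> k g))) \<le> (\<Sum>k. l1 (defect \<gamma> k g))"
  by (intro suminf_le summableI l1_cgauss_le bounded_borel_defect g \<gamma>0)

lemma fin_cgauss': "(\<Sum>k. l1 (cgauss \<gamma> (defect \<gamma> k g))) \<noteq> top"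
  using fin_cgauss fin by (auto simp: top_unique)

lemmas series_defect = l1_series[OF measurable_defect fin]
lemmas series_cgauss = l1_series[OF measurable_cgauss_defect fin_cgauss']

lemma measurable_tail [measurable]: "tail_part \<gamma> g \<in> borel_measurable borel"
  using series_cgauss(3) unfolding tail_part_def[abs_def] by measurable

lemma l1_tail: "l1 (tail_part \<gamma> g) \<le> l1 g + (\<Sum>k. l1 (defect \<gamma> k g))"
proof -
  have "l1 (tail_part \<gamma> g) = l1 (\<lambda>y. cgauss \<gamma> g y + (\<Sum>k. cgauss \<gamma> (defect \<gamma> k g) y))"
    unfolding l1_def tail_part_def by (intro nn_integral_cong) (metis minus_add_distrib norm_minus_cancel uminus_add_conv_diff add.commute)
  also have "\<dots> \<le> l1 (cgauss \<gamma> g) + l1 (\<lambda>y. \<Sum>k. cgauss \<gamma> (defect \<gamma> k g) y)"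
    using series_cgauss(3) by (intro l1_add_le) measurable
  also have "\<dots> \<le> l1 g + (\<Sum>k. l1 (defect \<gamma> k g))"
    by (intro add_mono l1_cgauss_le supported_onD(1)[OF g] \<gamma>0 order_trans[OF series_cgauss(2) fin_cgauss])
  finally show ?thesis .
qed

lemma measurable_extend [measurable]: "extend \<gamma> g \<in> borel_measurable borel"
  using series_defect(3) unfolding extend_eq cinv_def by measurable

lemma l1_extend: "l1 (extend \<gamma> g) \<le> 2 * (l1 g + (\<Sum>k. l1 (defect \<gamma> k g)))"
proof -
  note [measurable] = series_defect(3)
  have [measurable]: "cinv \<gamma> (tail_part \<gamma> g) \<in> borel_measurable borel" unfolding cinv_def[abs_def] by measurable
  have "l1 (extend \<gamma> g) \<le> l1 g + (l1 (\<lambda>x. indicator {0<..} x * (\<Sum>k. defect \<gamma> k g x))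
      + l1 (\<lambda>x. indicator {0<..} x * cinv \<gamma> (tail_part \<gamma> g) x))"
    unfolding extend_eq by (intro order_trans[OF l1_add_le] add_left_mono l1_add_le) measurable
  also have "\<dots> \<le> l1 g + ((\<Sum>k. l1 (defect \<gamma> k g)) + (l1 g + (\<Sum>k. l1 (defect \<gamma> k g))))"
  proof (intro add_left_mono add_mono)
    have "l1 (\<lambda>x. indicator {0<..} x * (\<Sum>k. defect \<gamma> k g x)) \<le> l1 (\<lambda>x. \<Sum>k. defect \<gamma> k g x)"
      unfolding l1_def by (intro nn_integral_mono) (auto simp: norm_mult split: split_indicator)
    also note series_defect(2)
    finally show "l1 (\<lambda>x. indicator {0<..} x * (\<Sum>k. defect \<gamma> k g x)) \<le> (\<Sum>k. l1 (defect \<gamma> k g))" .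
    show "l1 (\<lambda>x. indicator {0<..} x * cinv \<gamma> (tail_part \<gamma> g) x) \<le> l1 g + (\<Sum>k. l1 (defect \<gamma> k g))"
      by (rule order_trans[OF l1_indicator_cinv l1_tail]) (use \<gamma>0 in auto)
  qed
  also have "\<dots> = 2 * (l1 g + (\<Sum>k. l1 (defect \<gamma> k g)))" by (simp add: mult_2 add_ac)
  finally show ?thesis .
qed

lemma l1_extend_finite: "l1 (extend \<gamma> g) \<noteq> top"
  using l1_extend fin supported_onD(4)[OF g] by (auto simp: top_unique ennreal_mult_eq_top_iff ennreal_add_eq_top)

lemma tail_part_eq_0: "y \<notin> {0..<1} \<Longrightarrow> tail_part \<gamma> g y = 0"
  by (simp add: tail_part_def cgauss_eq_0)

lemma extend_on: "x \<in> {1..\<gamma>} \<Longrightarrow> extend \<gamma> g x = g x"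
  by (simp add: extend_eq defect_eq_0 cinv_def tail_part_eq_0)

text \<open>The contribution of (\<gamma>,\<infinity>) is moved back to (0,1) by inversion, which
  replaces \<open>\<phi> x\<close> by \<open>\<phi> (\<gamma> / x)\<close>.\<close>

lemma integral_extend:
  assumes \<phi>[measurable]: "\<phi> \<in> borel_measurable borel" and bd: "\<And>x. norm (\<phi> x) \<le> 1"
  shows "(\<integral>x. indicator {0<..} x * (extend \<gamma> g x * \<phi> x) \<partial>lborel)
    = (\<integral>x. g x * \<phi> x \<partial>lborel) + (\<Sum>k. \<integral>x. defect \<gamma> k g x * \<phi> x \<partial>lborel)
      - (\<integral>x. cgauss \<gamma> g x * \<phi> (\<gamma> / x) \<partial>lborel) - (\<Sum>k. \<integral>x. cgauss \<gamma> (defect \<gamma> k g) x * \<phi> (\<gamma> / x) \<partial>lborel)"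
proof -
  note [measurable] = series_defect(3) series_cgauss(3)
  let ?u = "\<lambda>x. \<Sum>k. defect \<gamma> k g x" and ?w = "tail_part \<gamma> g"
  let ?c = "\<lambda>x. indicator {0<..} x * cinv \<gamma> ?w x"
  have [measurable]: "cinv \<gamma> ?w \<in> borel_measurable borel" unfolding cinv_def[abs_def] by measurable
  have int_g: "integrable lborel (\<lambda>x. g x * \<phi> x)"
    by (rule integrable_mult_bounded[OF _ _ supported_onD(4)[OF g] bd]) measurable
  have "l1 ?u \<noteq> top" using series_defect(2) fin by (auto simp: top_unique)
  then have int_u: "integrable lborel (\<lambda>x. ?u x * \<phi> x)"
    by (intro integrable_mult_bounded bd) measurable
  have fin_w: "l1 ?w \<noteq> top"
    using l1_tail fin supported_onD(4)[OF g] by (auto simp: top_unique)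
  then have "l1 ?c \<noteq> top" using l1_indicator_cinv[OF measurable_tail \<gamma>0] by (auto simp: top_unique)
  then have int_c: "integrable lborel (\<lambda>x. ?c x * \<phi> x)"
    by (intro integrable_mult_bounded bd) measurable
  have g0: "x \<le> 0 \<Longrightarrow> g x = 0" for x using supported_onD(2)[OF g, of x] by auto
  have "(\<integral>x. indicator {0<..} x * (extend \<gamma> g x * \<phi> x) \<partial>lborel) = (\<integral>x. g x * \<phi> x + (?u x * \<phi> x + ?c x * \<phi> x) \<partial>lborel)"
  proof (rule integral_cong_AE)
    show "AE x in lborel. indicator {0<..} x * (extend \<gamma> g x * \<phi> x) = g x * \<phi> x + (?u x * \<phi> x + ?c x * \<phi> x)"
      using AE_lborel_singleton[of 0]
      by eventually_elim (use g0 in \<open>auto simp: extend_eq defect_eq_0 distrib_right split: split_indicator\<close>)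
  qed measurable
  also have "\<dots> = (\<integral>x. g x * \<phi> x \<partial>lborel) + ((\<integral>x. ?u x * \<phi> x \<partial>lborel) + (\<integral>x. ?c x * \<phi> x \<partial>lborel))"
    using int_g int_u int_c by (simp add: Bochner_Integration.integral_add)
  also have "(\<integral>x. ?u x * \<phi> x \<partial>lborel) = (\<Sum>k. \<integral>x. defect \<gamma> k g x * \<phi> x \<partial>lborel)"
    using sums_unique[OF series_defect(4)[OF \<phi> bd]] by simp
  also have "(\<integral>x. ?c x * \<phi> x \<partial>lborel) = (\<integral>s. (\<gamma> / s\<^sup>2 * indicator {0<..} s) *\<^sub>R (?w (\<gamma> / s) * \<phi> (\<gamma> / (\<gamma> / s))) \<partial>lborel)"
    using \<gamma>0 by (intro Bochner_Integration.integral_cong refl) (auto simp: cinv_def scaleR_conv_of_real split: split_indicator)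
  also have "\<dots> = (\<integral>x. indicator {0<..} x *\<^sub>R (?w x * \<phi> (\<gamma> / x)) \<partial>lborel)"
    by (rule integral_inversion[symmetric, OF _ \<gamma>0]) measurable
  also have "\<dots> = (\<integral>x. ?w x * \<phi> (\<gamma> / x) \<partial>lborel)"
  proof (rule integral_cong_AE)
    show "AE x in lborel. indicator {0<..} x *\<^sub>R (?w x * \<phi> (\<gamma> / x)) = ?w x * \<phi> (\<gamma> / x)"
      using AE_lborel_singleton[of 0] by eventually_elim (use tail_part_eq_0 in \<open>auto split: split_indicator\<close>)
  qed measurable
  also have "\<dots> = - (\<integral>x. cgauss \<gamma> g x * \<phi> (\<gamma> / x) \<partial>lborel) - (\<integral>x. (\<Sum>k. cgauss \<gamma> (defect \<gamma> k g) x) * \<phi> (\<gamma> / x) \<partial>lborel)"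
  proof -
    have "l1 (cgauss \<gamma> g) \<noteq> top" "l1 (\<lambda>x. \<Sum>k. cgauss \<gamma> (defect \<gamma> k g) x) \<noteq> top"
      using l1_cgauss_le[OF supported_onD(1)[OF g] \<gamma>0] supported_onD(4)[OF g] series_cgauss(2) fin_cgauss'
      by (auto simp: top_unique)
    then have "integrable lborel (\<lambda>x. cgauss \<gamma> g x * \<phi> (\<gamma> / x))"
      "integrable lborel (\<lambda>x. (\<Sum>k. cgauss \<gamma> (defect \<gamma> k g) x) * \<phi> (\<gamma> / x))"
      by (intro integrable_mult_bounded bd; measurable)+
    then show ?thesis by (simp add: tail_part_def left_diff_distrib)
  qed
  also have "(\<integral>x. (\<Sum>k. cgauss \<gamma> (defect \<gamma> k g) x) * \<phi> (\<gamma> / x) \<partial>lborel)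
      = (\<Sum>k. \<integral>x. cgauss \<gamma> (defect \<gamma> k g) x * \<phi> (\<gamma> / x) \<partial>lborel)"
    using sums_unique[OF series_cgauss(4)[of "\<lambda>x. \<phi> (\<gamma> / x)"]] bd by simp
  finally show ?thesis by (simp add: algebra_simps)
qed

text \<open>By duality the contribution of (\<gamma>,\<infinity>) is minus the integral of the
  second image of \<open>g\<close> and of all defects; the second image of a defect is the next one,
  so the series telescopes to \<open>defect \<gamma> 0 g\<close>, which was chosen to cancel what is
  left.\<close>

lemma pairing_1:
  assumes \<phi>[measurable]: "\<phi> \<in> borel_measurable borel" and bd: "\<And>x. norm (\<phi> x) \<le> 1" and per: "\<And>x. \<phi> (x + 1) = \<phi> x"
  shows "(\<integral>x. indicator {0<..} x * (extend \<gamma> g x * \<phi> x) \<partial>lborel) = 0"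
proof -
  let ?D = "\<lambda>k. \<integral>x. defect \<gamma> k g x * \<phi> x \<partial>lborel"
  have bg: "bounded_borel (cgauss \<gamma> v)" "x \<notin> {0..\<gamma>} \<Longrightarrow> cgauss \<gamma> v x = 0" if "bounded_borel v" for v x
    using that \<gamma> by (auto intro: bounded_borel_cgauss cgauss_eq_0)
  have dual: "(\<integral>x. cgauss \<gamma> v x * \<phi> (\<gamma> / x) \<partial>lborel) = (\<integral>x. cgauss \<gamma> (cgauss \<gamma> v) x * \<phi> x \<partial>lborel)"
    if "bounded_borel v" for v
    by (rule integral_cgauss[symmetric]) (use bg that \<gamma>0 bd per in auto)
  have D: "?D sums (\<integral>x. (\<Sum>k. defect \<gamma> k g x) * \<phi> x \<partial>lborel)" by (rule series_defect(4)[OF \<phi> bd])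
  have f1: "(\<Sum>k. \<integral>x. cgauss \<gamma> (defect \<gamma> k g) x * \<phi> (\<gamma> / x) \<partial>lborel) = (\<Sum>k. ?D (Suc k))"
    by (simp add: dual[OF bounded_borel_defect[OF g \<gamma>0]] defect_Suc)
  have f2: "(\<Sum>k. ?D k) = (\<Sum>k. ?D (Suc k)) + ?D 0"
    using suminf_split_initial_segment[OF sums_summable[OF D], of 1] by simp
  have f3: "?D 0 = (\<integral>x. cgauss \<gamma> (cgauss \<gamma> g) x * \<phi> x \<partial>lborel) - (\<integral>x. cper g x * \<phi> x \<partial>lborel)"
  proof -
    have 1: "l1 (cgauss \<gamma> (cgauss \<gamma> g)) \<noteq> top"
      by (rule l1_bounded_support[OF bg(1)[OF bg(1)[OF supported_onD(1)[OF g]]], of 0 1]) (auto intro: cgauss_eq_0)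
    note 2 = l1_cper_finite[OF supported_onD(3)[OF g]]
    have [measurable]: "cgauss \<gamma> (cgauss \<gamma> g) \<in> borel_measurable borel" "cper g \<in> borel_measurable borel"
      using bounded_borel_measurable[OF bg(1)[OF bg(1)[OF supported_onD(1)[OF g]]]] by auto
    have "integrable lborel (\<lambda>x. cgauss \<gamma> (cgauss \<gamma> g) x * \<phi> x)" "integrable lborel (\<lambda>x. cper g x * \<phi> x)"
      by (intro integrable_mult_bounded bd 1 2; measurable)+
    then show ?thesis by (simp add: defect_0 left_diff_distrib)
  qed
  have f4: "(\<integral>x. cper g x * \<phi> x \<partial>lborel) = (\<integral>x. g x * \<phi> x \<partial>lborel)"
  proof -
    have "(\<integral>x. cper g x * \<phi> x \<partial>lborel) = (\<integral>s. indicator {1..} s * (g s * \<phi> s) \<partial>lborel)"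
      by (rule integral_per[OF supported_onD(3)[OF g] \<phi> bd per])
    also have "\<dots> = (\<integral>x. g x * \<phi> x \<partial>lborel)"
      using supported_onD(2)[OF g] by (intro Bochner_Integration.integral_cong refl) (auto split: split_indicator)
    finally show ?thesis .
  qed
  \<comment> \<open>\<open>a\<close> is the integral of \<open>g\<close>, \<open>s\<close> the
    series of defects from index 1 on, \<open>t\<close> the integral of the second image of
    \<open>g\<close>, all against \<phi>.\<close>
  have "a + (s + (t - a)) - t - s = 0" for a s t :: complex by simp
  then show ?thesis
    unfolding integral_extend[OF \<phi> bd] dual[OF supported_onD(1)[OF g]] f1 f2 f3 f4 .
qed

text \<open>Here the terms cancel in pairs, since \<open>tail_part\<close> was defined from this
  very condition.\<close>

lemma pairing_2:
  assumes \<phi>[measurable]: "\<phi> \<in> borel_measurable borel" and bd: "\<And>x. norm (\<phi> x) \<le> 1" and per: "\<And>x. \<phi> (x + 1) = \<phi> x"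
  shows "(\<integral>x. indicator {0<..} x * (extend \<gamma> g x * \<phi> (\<gamma> / x)) \<partial>lborel) = 0"
proof -
  have dual: "(\<integral>x. v x * \<phi> (\<gamma> / x) \<partial>lborel) = (\<integral>x. cgauss \<gamma> v x * \<phi> x \<partial>lborel)"
    if "bounded_borel v" "\<And>x. x \<notin> {0..\<gamma>} \<Longrightarrow> v x = 0" for v
    by (rule integral_cgauss[symmetric]) (use that \<gamma>0 bd per in auto)
  have "(\<integral>x. defect \<gamma> k g x * \<phi> (\<gamma> / x) \<partial>lborel) = (\<integral>x. cgauss \<gamma> (defect \<gamma> k g) x * \<phi> x \<partial>lborel)" for k
    by (rule dual[OF bounded_borel_defect[OF g \<gamma>0]]) (use \<gamma> in \<open>auto intro: defect_eq_0\<close>)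
  moreover have "(\<integral>x. g x * \<phi> (\<gamma> / x) \<partial>lborel) = (\<integral>x. cgauss \<gamma> g x * \<phi> x \<partial>lborel)"
    by (rule dual[OF supported_onD(1)[OF g]]) (use supported_onD(2)[OF g] in auto)
  \<comment> \<open>True also at \<open>x = 0\<close>, because division by 0 gives 0.\<close>
  moreover have "\<gamma> / (\<gamma> / x) = x" for x using \<gamma>0 by simp
  ultimately show ?thesis
    using integral_extend[of "\<lambda>x. \<phi> (\<gamma> / x)"] bd by simp
qed

end

section \<open>Decay for functions of bounded variation\<close>

text \<open>The two functions to be compared start out as sums of arcs. For the periodization, the
  constant 1 is at most \<open>\<gamma>\<^sup>2 / x\<^sup>2\<close> on [1,\<gamma>], so the decay
  lemma applies with that constant.\<close>

lemma arc_sum_gauss_indicator: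
  assumes \<gamma>: "1 < \<gamma>" and J: "is_interval J" "J \<subseteq> {1..\<gamma>}"
  shows "arc_sum (gauss \<gamma> (indicator J)) (ennreal (\<gamma> * zeta2))"
    and "arc_sum (per (indicator J)) (ennreal (\<gamma>\<^sup>2 * zeta2))"
proof -
  have J1: "1 \<le> x" "x \<le> \<gamma>" if "x \<in> J" for x using subsetD[OF J(2) that] by auto
  have sq: "(x + 1)\<^sup>2 \<le> (y + 1)\<^sup>2" "x\<^sup>2 \<le> y\<^sup>2" if "x \<in> J" "x \<le> y" for x y
    using J1(1)[OF that(1)] that(2) by (auto intro!: power_mono)
  have "J \<subseteq> {0..}" "J \<subseteq> {1..}" using J1 by force+
  have "gauss \<gamma> (\<lambda>v. ennreal 1 * indicator J v)
    = per (\<lambda>s. ennreal (1 * (\<gamma> / s\<^sup>2)) * indicator (inv_set \<gamma> J) s)"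
    by (rule gauss_eq_per) (use \<gamma> in auto)
  moreover have "arc_sum (per (\<lambda>s. ennreal (1 * (\<gamma> / s\<^sup>2)) * indicator (inv_set \<gamma> J) s)) (\<Sum>i. ennreal (\<gamma> / (1 + real i)\<^sup>2))"
  proof (rule arc_sum_per_decay)
    show "ray_density (inv_set \<gamma> J) (\<lambda>s. 1 * (\<gamma> / s\<^sup>2))"
      by (rule ray_density_inversion[OF J(1) \<open>J \<subseteq> {0..}\<close>]) (use \<gamma> sq in simp_all)
  qed (use \<gamma> in simp_all)
  moreover have "(\<Sum>i. ennreal (\<gamma> / (1 + real i)\<^sup>2)) = ennreal (\<gamma> * zeta2)"
    using \<gamma> by (intro suminf_decay) simp
  ultimately show "arc_sum (gauss \<gamma> (indicator J)) (ennreal (\<gamma> * zeta2))" by simp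
  have ray: "ray_density J (\<lambda>_. 1)"
    using J(1) \<open>J \<subseteq> {1..}\<close> sq(2) by (simp add: ray_density_def)
  have "1 \<le> \<gamma>\<^sup>2 / x\<^sup>2" if "x \<in> J" for x
    using power_mono[OF J1(2)[OF that], of 2] J1(1)[OF that] by simp
  then have "arc_sum (per (\<lambda>s. ennreal 1 * indicator J s)) (\<Sum>i. ennreal (\<gamma>\<^sup>2 / (1 + real i)\<^sup>2))"
    by (intro arc_sum_per_decay[OF ray]) auto
  moreover have "(\<Sum>i. ennreal (\<gamma>\<^sup>2 / (1 + real i)\<^sup>2)) = ennreal (\<gamma>\<^sup>2 * zeta2)" by (rule suminf_decay) simp
  ultimately show "arc_sum (per (indicator J)) (ennreal (\<gamma>\<^sup>2 * zeta2))" by simp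
qed

lemma norm_cplx_diff_le:
  assumes "u = (\<lambda>x. P x + r x)" "v = (\<lambda>x. P x + s x)" "u x \<noteq> top" "v x \<noteq> top"
  shows "ennreal (norm (cplx u x - cplx v x)) \<le> r x + s x"
proof -
  have fin: "P x < top" "r x < top" "s x < top" using assms by (auto simp: ennreal_add_eq_top less_top)
  then have "cplx u x - cplx v x = of_real (enn2real (r x) - enn2real (s x))"
    by (simp add: cplx_def assms(1,2) enn2real_plus)
  then have "norm (cplx u x - cplx v x) = \<bar>enn2real (r x) - enn2real (s x)\<bar>"
    by (simp only: norm_of_real)
  also have "\<dots> \<le> enn2real (r x) + enn2real (s x)" by (simp add: abs_le_iff)
  finally have "ennreal (norm (cplx u x - cplx v x)) \<le> ennreal (enn2real (r x) + enn2real (s x))" by (rule ennreal_leI)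
  also have "\<dots> = r x + s x" using fin by (subst ennreal_plus) auto
  finally show ?thesis .
qed

lemma cplx_indicator: "cplx (indicator J) = indicator J"
  by (auto simp: cplx_def fun_eq_iff split: split_indicator)

lemma supported_on_indicator:
  "J \<in> sets borel \<Longrightarrow> J \<subseteq> I \<Longrightarrow> supported_on I (indicator J)"
  unfolding supported_on_def by (auto simp: bounded_borel_indicator split: split_indicator)

text \<open>The second image and the periodization of \<open>indicator J\<close> have the same mass,
  the length of \<open>J\<close>; their difference is the initial defect, and coupling makes it
  decay. The rate must not depend on \<open>J\<close>.\<close>

lemma defect_indicator_bound:
  assumes \<gamma>: "1 < \<gamma>"
  obtains C l where "0 \<le> C" "0 \<le> l" "l < 1"
    "\<And>J k. is_interval J \<Longrightarrow> J \<subseteq> {1..\<gamma>} \<Longrightarrow> l1 (defect \<gamma> k (indicator J)) \<le> ennreal (C * l ^ k)"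
proof -
  \<comment> \<open>The summands are the weights of the second image, where one further step costs
    the factor 6, of the periodization, and of \<open>unif\<close>.\<close>
  define B where "B = 6 * \<gamma> * zeta2 + \<gamma>\<^sup>2 * zeta2 + 1"
  have B1: "0 \<le> 6 * \<gamma> * zeta2" "0 \<le> \<gamma>\<^sup>2 * zeta2" using \<gamma> zeta2_nonneg by auto
  obtain C l where C: "0 \<le> C" "0 \<le> l" "l < 1" and main:
    "\<And>u v \<mu> n. 0 \<le> \<mu> \<Longrightarrow> (\<integral>\<^sup>+x. u x \<partial>lborel) = ennreal \<mu> \<Longrightarrow> (\<integral>\<^sup>+x. v x \<partial>lborel) = ennreal \<mu> \<Longrightarrow>
      arc_sum u (ennreal (B * \<mu>)) \<Longrightarrow> arc_sum v (ennreal (B * \<mu>)) \<Longrightarrow>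
      \<exists>P r s. (gauss \<gamma> ^^ n) u = (\<lambda>x. P x + r x) \<and> (gauss \<gamma> ^^ n) v = (\<lambda>x. P x + s x) \<and>
        r \<in> borel_measurable borel \<and> s \<in> borel_measurable borel \<and>
        (\<integral>\<^sup>+x. r x \<partial>lborel) \<le> ennreal (C * l ^ n * \<mu>) \<and> (\<integral>\<^sup>+x. s x \<partial>lborel) \<le> ennreal (C * l ^ n * \<mu>)"
    by (rule gauss_coupling[OF \<gamma>, of B]) blast
  \<comment> \<open>Index \<open>k\<close> stands for \<open>2 * k\<close> steps, hence the rate
    \<open>l\<^sup>2\<close>; \<open>\<gamma> + 1\<close> bounds the mass used in the
    coupling.\<close>
  have "l1 (defect \<gamma> k (indicator J)) \<le> ennreal (2 * C * (\<gamma> + 1) * (l\<^sup>2) ^ k)"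
    if J: "is_interval J" "J \<subseteq> {1..\<gamma>}" for J k
  proof -
    note [measurable] = is_interval_borel[OF J(1)]
    have "emeasure lborel J \<le> emeasure lborel {1..\<gamma>}" using J(2) by (intro emeasure_mono) auto
    also have "\<dots> = ennreal (\<gamma> - 1)" using \<gamma> by simp
    finally have emJ: "emeasure lborel J \<le> ennreal (\<gamma> - 1)" .
    then obtain m where m: "emeasure lborel J = ennreal m" "0 \<le> m"
      by (cases "emeasure lborel J") (auto simp: top_unique)
    have m\<gamma>: "m \<le> \<gamma>" using emJ m \<gamma> by simp
    define a b where "a = gauss \<gamma> (gauss \<gamma> (indicator J))" and "b = per (indicator J)"
    \<comment> \<open>Adding \<open>unif\<close> to both functions leaves the difference unchanged
      and keeps the mass at least 1. Without it the ratio of weight to mass would have no bound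
      uniform in short intervals \<open>J\<close>.\<close>
    define u v where "u x = a x + unif x" and "v x = b x + unif x" for x
    note K0 = arc_sum_gauss_indicator[OF \<gamma> J]
    have "arc_sum a (6 ^ 1 * ennreal (\<gamma> * zeta2))"
      using arc_sum_gauss_funpow[OF \<gamma> K0(1), of 1] by (simp add: a_def)
    then have Ka: "arc_sum a (ennreal (6 * \<gamma> * zeta2))" by (simp add: ennreal_mult' mult.assoc)
    have Kb: "arc_sum b (ennreal (\<gamma>\<^sup>2 * zeta2))" using K0(2) by (simp add: b_def)
    note [measurable] = arc_sum_measurable[OF Ka] arc_sum_measurable[OF Kb] arc_sum_measurable[OF arc_sum_unif]
    have "0 \<le> B" using B1 by (simp add: B_def)
    then have Bm: "B \<le> B * (m + 1)" using m mult_left_mono[of 1 "m + 1" B] by simp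
    have BB: "6 * \<gamma> * zeta2 + 1 \<le> B" "\<gamma>\<^sup>2 * zeta2 + 1 \<le> B" using B1 by (auto simp: B_def)
    have Ku: "arc_sum u (ennreal (B * (m + 1)))"
    proof (rule arc_sum_mono)
      show "arc_sum u (ennreal (6 * \<gamma> * zeta2) + 1)"
        unfolding u_def[abs_def] by (rule arc_sum_add[OF Ka arc_sum_unif])
      have "ennreal (6 * \<gamma> * zeta2) + 1 = ennreal (6 * \<gamma> * zeta2 + 1)" using B1 by (simp add: ennreal_plus)
      also have "\<dots> \<le> ennreal (B * (m + 1))" by (rule ennreal_leI[OF order_trans[OF BB(1) Bm]])
      finally show "ennreal (6 * \<gamma> * zeta2) + 1 \<le> ennreal (B * (m + 1))" .
    qed
    have Kv: "arc_sum v (ennreal (B * (m + 1)))"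
    proof (rule arc_sum_mono)
      show "arc_sum v (ennreal (\<gamma>\<^sup>2 * zeta2) + 1)"
        unfolding v_def[abs_def] by (rule arc_sum_add[OF Kb arc_sum_unif])
      have "ennreal (\<gamma>\<^sup>2 * zeta2) + 1 = ennreal (\<gamma>\<^sup>2 * zeta2 + 1)" using B1 by (simp add: ennreal_plus)
      also have "\<dots> \<le> ennreal (B * (m + 1))" by (rule ennreal_leI[OF order_trans[OF BB(2) Bm]])
      finally show "ennreal (\<gamma>\<^sup>2 * zeta2) + 1 \<le> ennreal (B * (m + 1))" .
    qed
    have "(\<integral>\<^sup>+x. gauss \<gamma> (indicator J) x \<partial>lborel) = (\<integral>\<^sup>+x. indicator J x \<partial>lborel)"
      by (rule nn_integral_gauss) (use \<gamma> J in \<open>auto split: split_indicator\<close>)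
    then have mass_a: "(\<integral>\<^sup>+x. a x \<partial>lborel) = ennreal m"
      using nn_integral_gauss_funpow[OF \<gamma> K0(1), of 1] m by (simp add: a_def)
    have "(\<integral>\<^sup>+x. b x \<partial>lborel) = (\<integral>\<^sup>+s. indicator J s * indicator {1..} s \<partial>lborel)"
      unfolding b_def by (rule nn_integral_per) measurable
    also have "\<dots> = (\<integral>\<^sup>+s. indicator J s \<partial>lborel)"
      using J(2) by (intro nn_integral_cong) (auto split: split_indicator)
    finally have mass_b: "(\<integral>\<^sup>+x. b x \<partial>lborel) = ennreal m" using m by simp
    have mass: "(\<integral>\<^sup>+x. u x \<partial>lborel) = ennreal (m + 1)" "(\<integral>\<^sup>+x. v x \<partial>lborel) = ennreal (m + 1)"
      using m unfolding u_def v_def by (simp_all add: nn_integral_add mass_a mass_b nn_integral_unif ennreal_plus)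
    have "0 \<le> m + 1" using m by simp
    from main[OF this mass Ku Kv, of "2 * k"] obtain P r s where
      eq: "(gauss \<gamma> ^^ (2 * k)) u = (\<lambda>x. P x + r x)" "(gauss \<gamma> ^^ (2 * k)) v = (\<lambda>x. P x + s x)"
      and [measurable]: "r \<in> borel_measurable borel" "s \<in> borel_measurable borel"
      and rs: "(\<integral>\<^sup>+x. r x \<partial>lborel) \<le> ennreal (C * l ^ (2 * k) * (m + 1))" "(\<integral>\<^sup>+x. s x \<partial>lborel) \<le> ennreal (C * l ^ (2 * k) * (m + 1))"
      by blast
    have bdd: "bounded_borel (cplx w)" "w x \<noteq> top" if "arc_sum w (ennreal S)" for w S x
    proof -
      have le: "w x \<le> ennreal (2 * S)" for x using arc_sum_le[OF that, of x] by (simp add: ennreal_mult')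
      show "bounded_borel (cplx w)" by (rule bounded_borel_cplx[OF arc_sum_measurable[OF that] le])
      show "w x \<noteq> top" using le[of x] by (auto simp: top_unique)
    qed
    have unif_fin: "arc_sum unif (ennreal 1)" using arc_sum_unif by simp
    have \<gamma>0: "0 < \<gamma>" using \<gamma> by simp
    have cg: "cgauss \<gamma> (cgauss \<gamma> (indicator J)) = cplx a"
    proof -
      have "cgauss \<gamma> (cplx (indicator J)) = cplx (gauss \<gamma> (indicator J))"
        by (rule cgauss_cplx[where B=1]) (use \<gamma>0 in \<open>auto split: split_indicator\<close>)
      then show ?thesis using cgauss_funpow_cplx[OF \<gamma> K0(1), of 1] by (simp add: a_def cplx_indicator)
    qed
    have cp: "cper (indicator J) = cplx b"
    proof -
      have "decaying (indicator J)" by (rule supported_onD(3)[OF supported_on_indicator[OF _ J(2)]]) measurable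
      then show ?thesis
        using cper_cplx[of "indicator J"] unfolding b_def by (simp add: cplx_indicator split: split_indicator)
    qed
    have cu: "cplx u x = cplx a x + cplx unif x" "cplx v x = cplx b x + cplx unif x" for x
      unfolding u_def[abs_def] v_def[abs_def] using bdd(2)[OF Ka] bdd(2)[OF Kb] bdd(2)[OF unif_fin] by (simp_all add: cplx_add)
    have "defect \<gamma> k (indicator J) = (cgauss \<gamma> ^^ (2 * k)) (\<lambda>x. cplx u x + (-1) * cplx v x)"
      by (simp add: defect_def cg cp cu)
    also have "\<dots> = (\<lambda>x. (cgauss \<gamma> ^^ (2 * k)) (cplx u) x + (-1) * (cgauss \<gamma> ^^ (2 * k)) (cplx v) x)"
      using bdd(1)[OF Ku] bdd(1)[OF Kv] \<gamma>0
      by (subst cgauss_funpow_add) (auto intro: bounded_borel_cmult simp only: cgauss_funpow_cmult)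
    also have "\<dots> = (\<lambda>x. cplx ((gauss \<gamma> ^^ (2 * k)) u) x - cplx ((gauss \<gamma> ^^ (2 * k)) v) x)"
      by (simp add: cgauss_funpow_cplx[OF \<gamma> Ku] cgauss_funpow_cplx[OF \<gamma> Kv])
    finally have "l1 (defect \<gamma> k (indicator J)) \<le> (\<integral>\<^sup>+x. r x + s x \<partial>lborel)"
      unfolding l1_def
    proof (simp only:, intro nn_integral_mono norm_cplx_diff_le[OF eq])
      have S: "6 ^ (2 * k) * ennreal (B * (m + 1)) = ennreal (6 ^ (2 * k) * (B * (m + 1)))"
        by (simp add: ennreal_mult' ennreal_power[symmetric])
      show "(gauss \<gamma> ^^ (2 * k)) u x \<noteq> top" "(gauss \<gamma> ^^ (2 * k)) v x \<noteq> top" for x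
        using bdd(2)[OF arc_sum_gauss_funpow[OF \<gamma> Ku, of "2 * k", unfolded S]]
          bdd(2)[OF arc_sum_gauss_funpow[OF \<gamma> Kv, of "2 * k", unfolded S]] by blast+
    qed
    also have "\<dots> = (\<integral>\<^sup>+x. r x \<partial>lborel) + (\<integral>\<^sup>+x. s x \<partial>lborel)" by (rule nn_integral_add) auto
    also have "\<dots> \<le> ennreal (C * l ^ (2 * k) * (m + 1)) + ennreal (C * l ^ (2 * k) * (m + 1))" by (intro add_mono rs)
    also have "\<dots> = ennreal (2 * (C * l ^ (2 * k) * (m + 1)))"
      using C m by (subst ennreal_plus[symmetric]) auto
    also have "\<dots> \<le> ennreal (2 * C * (\<gamma> + 1) * (l\<^sup>2) ^ k)"
    proof (rule ennreal_leI)
      have "C * l ^ (2 * k) * (m + 1) \<le> C * l ^ (2 * k) * (\<gamma> + 1)" using C m\<gamma> by (intro mult_left_mono) auto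
      moreover have "(l\<^sup>2) ^ k = l ^ (2 * k)" by (simp only: power_mult)
      then have "2 * C * (\<gamma> + 1) * (l\<^sup>2) ^ k = 2 * (C * l ^ (2 * k) * (\<gamma> + 1))" by (simp only: mult_ac)
      ultimately show "2 * (C * l ^ (2 * k) * (m + 1)) \<le> 2 * C * (\<gamma> + 1) * (l\<^sup>2) ^ k" by linarith
    qed
    finally show ?thesis .
  qed
  moreover have "0 \<le> 2 * C * (\<gamma> + 1)" "0 \<le> l\<^sup>2" "l\<^sup>2 < 1" using C \<gamma> by (auto simp: power_less_one_iff abs_square_less_1)
  ultimately show thesis using that by blast
qed

lemma defect_sum_le:
  assumes "finite A" "\<And>i. i \<in> A \<Longrightarrow> supported_on {1..\<gamma>} (h i)" "0 < \<gamma>"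
  shows "supported_on {1..\<gamma>} (\<lambda>x. \<Sum>i\<in>A. c i * h i x)"
    and "l1 (defect \<gamma> k (\<lambda>x. \<Sum>i\<in>A. c i * h i x)) \<le> (\<Sum>i\<in>A. ennreal (norm (c i)) * l1 (defect \<gamma> k (h i)))"
proof -
  have z: "supported_on {1..\<gamma>} (\<lambda>x. 0)" by (auto simp: supported_on_def bounded_borel_def)
  have "supported_on {1..\<gamma>} (\<lambda>x. \<Sum>i\<in>A. c i * h i x) \<and>
    l1 (defect \<gamma> k (\<lambda>x. \<Sum>i\<in>A. c i * h i x)) \<le> (\<Sum>i\<in>A. ennreal (norm (c i)) * l1 (defect \<gamma> k (h i)))"
    using assms(1,2)
  proof (induction A)
    case empty
    then show ?case using z defect_cmult[OF z assms(3), of k 0] by (simp add: l1_def)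
  next
    case (insert i A)
    let ?S = "\<lambda>x. \<Sum>i\<in>A. c i * h i x"
    have hi: "supported_on {1..\<gamma>} (h i)" "supported_on {1..\<gamma>} (\<lambda>x. c i * h i x)"
      using insert.prems by (auto intro: supported_on_cmult)
    have S: "supported_on {1..\<gamma>} ?S" "l1 (defect \<gamma> k ?S) \<le> (\<Sum>i\<in>A. ennreal (norm (c i)) * l1 (defect \<gamma> k (h i)))"
      using insert.IH insert.prems by auto
    have eq: "(\<lambda>x. \<Sum>i\<in>insert i A. c i * h i x) = (\<lambda>x. c i * h i x + ?S x)" using insert.hyps by auto
    have "l1 (defect \<gamma> k (\<lambda>x. c i * h i x + ?S x)) \<le> l1 (defect \<gamma> k (\<lambda>x. c i * h i x)) + l1 (defect \<gamma> k ?S)"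
      unfolding defect_add[OF hi(2) S(1) assms(3)]
      by (intro l1_add_le bounded_borel_measurable bounded_borel_defect hi S assms)
    also have "l1 (defect \<gamma> k (\<lambda>x. c i * h i x)) = ennreal (norm (c i)) * l1 (defect \<gamma> k (h i))"
      unfolding defect_cmult[OF hi(1) assms(3)]
      by (intro l1_cmult bounded_borel_measurable bounded_borel_defect hi assms)
    finally have "l1 (defect \<gamma> k (\<lambda>x. c i * h i x + ?S x))
        \<le> (\<Sum>i\<in>insert i A. ennreal (norm (c i)) * l1 (defect \<gamma> k (h i)))"
      using S(2) insert.hyps by (auto intro: order_trans add_left_mono)
    then show ?case using eq supported_on_add[OF hi(2) S(1)] by simp
  qed
  then show "supported_on {1..\<gamma>} (\<lambda>x. \<Sum>i\<in>A. c i * h i x)"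
    "l1 (defect \<gamma> k (\<lambda>x. \<Sum>i\<in>A. c i * h i x)) \<le> (\<Sum>i\<in>A. ennreal (norm (c i)) * l1 (defect \<gamma> k (h i)))" by auto
qed

lemma supported_on_mono_on:
  fixes \<phi> :: "real \<Rightarrow> real"
  assumes mono: "mono_on {a..b} \<phi>" and ab: "a \<le> b"
  shows "supported_on {a..b} (\<lambda>x. of_real (\<phi> x) * indicator {a..b} x)"
    and "(\<lambda>x. \<phi> x * indicator {a..b} x) \<in> borel_measurable borel"
proof -
  \<comment> \<open>Clamping the argument extends \<phi> to an increasing function on the line,
    which is Borel.\<close>
  define \<psi> where "\<psi> x = \<phi> (max a (min b x))" for x
  have "mono \<psi>" unfolding \<psi>_def by (rule monoI, rule mono_onD[OF mono]) (use ab in auto)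
  then have [measurable]: "\<psi> \<in> borel_measurable borel" by (rule borel_measurable_mono)
  have eq: "\<phi> x * indicator {a..b} x = \<psi> x * indicator {a..b} x" for x
    by (auto simp: \<psi>_def split: split_indicator)
  show meas: "(\<lambda>x. \<phi> x * indicator {a..b} x) \<in> borel_measurable borel" unfolding eq by measurable
  have "(\<lambda>x. complex_of_real (\<phi> x * indicator {a..b} x)) \<in> borel_measurable borel" using meas by measurable
  also have "(\<lambda>x. complex_of_real (\<phi> x * indicator {a..b} x)) = (\<lambda>x. of_real (\<phi> x) * indicator {a..b} x)"
    by (auto split: split_indicator)
  finally have "(\<lambda>x. complex_of_real (\<phi> x) * indicator {a..b} x) \<in> borel_measurable borel" .
  moreover have "norm (complex_of_real (\<phi> x) * indicator {a..b} x) \<le> \<bar>\<phi> a\<bar> + \<bar>\<phi> b\<bar>" for x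
    using mono_onD[OF mono, of a x] mono_onD[OF mono, of x b] ab by (auto simp: norm_mult split: split_indicator)
  ultimately show "supported_on {a..b} (\<lambda>x. of_real (\<phi> x) * indicator {a..b} x)"
    unfolding supported_on_def bounded_borel_def by auto
qed

text \<open>Layer-cake argument: up to an error of at most \<open>\<delta> = B / (N + 1)\<close>,
  \<phi> is \<delta> times the sum of the indicators of \<open>N + 1\<close> superlevel sets, which
  are intervals by monotonicity. Their bounds add up to \<open>B * C\<close>; the error is estimated
  without decay and vanishes as \<open>N\<close> grows.\<close>

lemma defect_mono_on_bound:
  fixes \<phi> :: "real \<Rightarrow> real"
  assumes \<gamma>: "1 < \<gamma>" and C: "0 \<le> C"
    and ind: "\<And>J. is_interval J \<Longrightarrow> J \<subseteq> {1..\<gamma>} \<Longrightarrow> l1 (defect \<gamma> k (indicator J)) \<le> ennreal C"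
    and mono: "mono_on {1..\<gamma>} \<phi>" and \<phi>: "\<And>x. x \<in> {1..\<gamma>} \<Longrightarrow> 0 \<le> \<phi> x \<and> \<phi> x \<le> B"
  shows "l1 (defect \<gamma> k (\<lambda>x. of_real (\<phi> x) * indicator {1..\<gamma>} x)) \<le> ennreal (B * C)"
proof -
  let ?I = "{1..\<gamma>}"
  define g where "g x = complex_of_real (\<phi> x) * indicator ?I x" for x
  have \<gamma>0: "0 < \<gamma>" and \<gamma>1: "1 \<le> \<gamma>" using \<gamma> by auto
  have g: "supported_on ?I g" unfolding g_def[abs_def] by (rule supported_on_mono_on(1)[OF mono \<gamma>1])
  have "0 \<le> B" using \<phi>[of 1] \<gamma> by auto
  show ?thesis
  proof (cases "B = 0")
    case True
    have "g = (\<lambda>x. 0 * g x)" using \<phi> True by (force simp: g_def fun_eq_iff split: split_indicator)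
    then have "defect \<gamma> k g = (\<lambda>x. 0 * defect \<gamma> k g x)" using defect_cmult[OF g \<gamma>0, of k 0] by simp
    then have "l1 (defect \<gamma> k g) = 0" by (simp add: l1_def)
    then show ?thesis by (simp add: g_def[abs_def])
  next
    case False
    with \<open>0 \<le> B\<close> have B: "0 < B" by simp
    have approx: "l1 (defect \<gamma> k g) \<le> ennreal (B * C + 2 * B * \<gamma> / real (Suc N))" for N
    proof -
      let ?N = "real (Suc N)"
      define \<delta> where "\<delta> = B / ?N"
      have \<delta>: "0 < \<delta>" "\<delta> * ?N = B" using B by (auto simp: \<delta>_def)
      define J where "J i = {x \<in> ?I. \<delta> * real i \<le> \<phi> x}" for i
      have J: "is_interval (J i)" "J i \<subseteq> ?I" for i
      proof -
        show "is_interval (J i)"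
          unfolding is_interval_1
        proof safe
          fix a b x assume *: "a \<in> J i" "b \<in> J i" "a \<le> x" "x \<le> b"
          then have "x \<in> ?I" "a \<in> ?I" "\<delta> * real i \<le> \<phi> a" by (auto simp: J_def)
          with mono_onD[OF mono \<open>a \<in> ?I\<close> \<open>x \<in> ?I\<close> *(3)] show "x \<in> J i" by (simp add: J_def)
        qed
      qed (auto simp: J_def)
      define s where "s x = (\<Sum>i\<in>{1..Suc N}. complex_of_real \<delta> * indicator (J i) x)" for x
      have sJ: "supported_on ?I (indicator (J i))" for i
        by (rule supported_on_indicator[OF is_interval_borel[OF J(1)] J(2)])
      have s: "supported_on ?I s"
        unfolding s_def[abs_def] by (rule defect_sum_le(1)) (use sJ \<gamma>0 in auto)
      have "l1 (defect \<gamma> k s) \<le> (\<Sum>i\<in>{1..Suc N}. ennreal (norm (complex_of_real \<delta>)) * l1 (defect \<gamma> k (indicator (J i))))"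
        unfolding s_def[abs_def] by (rule defect_sum_le(2)) (use sJ \<gamma>0 in auto)
      also have "\<dots> \<le> (\<Sum>i\<in>{1..Suc N}. ennreal \<delta> * ennreal C)"
        using \<delta> J by (intro sum_mono mult_mono ind) auto
      also have "\<dots> = ennreal (B * C)"
      proof -
        have "(\<Sum>i\<in>{1..Suc N}. ennreal \<delta> * ennreal C) = ennreal ?N * (ennreal \<delta> * ennreal C)"
          by (simp add: ennreal_of_nat_eq_real_of_nat del: of_nat_Suc)
        also have "\<dots> = ennreal (?N * (\<delta> * C))" using \<delta> C by (simp add: ennreal_mult del: of_nat_Suc)
        also have "?N * (\<delta> * C) = B * C" using \<delta>(2) by (simp add: mult_ac del: of_nat_Suc)
        finally show ?thesis .
      qed
      finally have ls: "l1 (defect \<gamma> k s) \<le> ennreal (B * C)" .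
      define e where "e x = g x + (-1) * s x" for x
      have e: "supported_on ?I e" unfolding e_def[abs_def] by (intro supported_on_add supported_on_cmult g s)
      have e_le: "norm (e x) \<le> \<delta> * indicator ?I x" for x
      proof (cases "x \<in> ?I")
        case True
        \<comment> \<open>\<open>x\<close> belongs to exactly the first \<open>m\<close> superlevel
          sets, so \<open>s x\<close> is \<phi> rounded down to a multiple of \<delta>.\<close>
        define m where "m = nat \<lfloor>\<phi> x / \<delta>\<rfloor>"
        have "0 \<le> \<phi> x / \<delta>" "\<phi> x / \<delta> \<le> ?N" using \<phi>[OF True] \<delta> by (auto simp: field_simps)
        then have "\<lfloor>\<phi> x / \<delta>\<rfloor> \<le> \<lfloor>?N\<rfloor>" by (intro floor_mono)
        then have mN: "m \<le> Suc N" unfolding m_def by (simp add: nat_le_iff)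
        have m: "real m \<le> \<phi> x / \<delta>" "\<phi> x / \<delta> < real m + 1"
          using \<open>0 \<le> \<phi> x / \<delta>\<close> by (auto simp: m_def)
        have "x \<in> J i \<longleftrightarrow> i \<le> m" for i
        proof -
          have "x \<in> J i \<longleftrightarrow> real i \<le> \<phi> x / \<delta>" using True \<delta>(1) by (simp add: J_def field_simps)
          also have "\<dots> \<longleftrightarrow> i \<le> m" using m by linarith
          finally show ?thesis .
        qed
        then have "s x = (\<Sum>i\<in>{1..Suc N}. if i \<le> m then complex_of_real \<delta> else 0)"
          unfolding s_def by (intro sum.cong) (auto split: split_indicator)
        also have "\<dots> = (\<Sum>i\<in>{1..m}. complex_of_real \<delta>)"
          using mN by (intro sum.mono_neutral_cong_right) auto
        finally have "s x = complex_of_real (real m * \<delta>)" by simp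
        then have "e x = complex_of_real (\<phi> x - real m * \<delta>)" using True by (simp add: e_def g_def)
        moreover have "\<bar>\<phi> x - real m * \<delta>\<bar> \<le> \<delta>" using m \<delta>(1) by (auto simp: field_simps abs_le_iff)
        ultimately show ?thesis using True by (simp only: norm_of_real) simp
      next
        case False
        then show ?thesis using e by (simp add: supported_on_def)
      qed
      have "l1 e \<le> (\<integral>\<^sup>+x. ennreal \<delta> * indicator ?I x \<partial>lborel)"
        unfolding l1_def
      proof (rule nn_integral_mono)
        show "ennreal (norm (e x)) \<le> ennreal \<delta> * indicator ?I x" for x
          using ennreal_leI[OF e_le[of x]] by (cases "x \<in> ?I") simp_all
      qed
      also have "\<dots> = ennreal (\<delta> * (\<gamma> - 1))"
        using \<gamma> \<delta> by (simp add: nn_integral_cmult_indicator ennreal_mult)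
      also have "\<dots> \<le> ennreal (\<delta> * \<gamma>)" using \<delta> by (intro ennreal_leI) auto
      finally have "l1 e \<le> ennreal (\<delta> * \<gamma>)" .
      then have "2 * l1 e \<le> 2 * ennreal (\<delta> * \<gamma>)" by (rule mult_left_mono) simp
      then have le: "l1 (defect \<gamma> k e) \<le> ennreal (2 * (\<delta> * \<gamma>))"
      proof -
        have "l1 (defect \<gamma> k e) \<le> 2 * l1 e" by (rule l1_defect_le[OF e \<gamma>0])
        also have "\<dots> \<le> 2 * ennreal (\<delta> * \<gamma>)" by fact
        also have "\<dots> = ennreal (2 * (\<delta> * \<gamma>))" by (simp add: ennreal_mult')
        finally show ?thesis .
      qed
      have "g = (\<lambda>x. s x + e x)" by (simp add: e_def)
      then have "l1 (defect \<gamma> k g) = l1 (\<lambda>x. defect \<gamma> k s x + defect \<gamma> k e x)"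
        using defect_add[OF s e \<gamma>0, of k] by simp
      also have "\<dots> \<le> l1 (defect \<gamma> k s) + l1 (defect \<gamma> k e)"
        by (intro l1_add_le bounded_borel_measurable bounded_borel_defect s e \<gamma>0)
      also have "\<dots> \<le> ennreal (B * C) + ennreal (2 * (\<delta> * \<gamma>))" by (intro add_mono ls le)
      also have "\<dots> = ennreal (B * C + 2 * B * \<gamma> / ?N)"
        using B C \<delta> \<gamma>0 by (subst ennreal_plus[symmetric]) (auto simp: \<delta>_def)
      finally show ?thesis .
    qed
    from approx[of 0] obtain X where X: "l1 (defect \<gamma> k g) = ennreal X" "0 \<le> X"
      by (cases "l1 (defect \<gamma> k g)") (auto simp: top_unique)
    have "X \<le> B * C"
    proof (rule LIMSEQ_le_const)
      have "(\<lambda>N. B * C + 2 * B * \<gamma> * inverse (real (Suc N))) \<longlonglongrightarrow> B * C + 2 * B * \<gamma> * 0"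
        by (intro tendsto_intros LIMSEQ_inverse_real_of_nat)
      then show "(\<lambda>N. B * C + 2 * B * \<gamma> / real (Suc N)) \<longlonglongrightarrow> B * C" by (simp add: divide_inverse)
      have "X \<le> B * C + 2 * B * \<gamma> / real (Suc N)" for N
      proof -
        have "0 \<le> B * C + 2 * B * \<gamma> / real (Suc N)" using B C \<gamma>0 by auto
        then show ?thesis using approx[of N] X by (simp add: ennreal_le_iff del: of_nat_Suc)
      qed
      then show "\<exists>N. \<forall>n\<ge>N. X \<le> B * C + 2 * B * \<gamma> / real (Suc n)" by blast
    qed
    then have "l1 (defect \<gamma> k g) \<le> ennreal (B * C)" using X by (simp add: ennreal_leI)
    then show ?thesis by (simp add: g_def[abs_def])
  qed
qed

section \<open>Total variation and decomposition into monotone functions\<close>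

lemma total_variation_append:
  assumes "a \<le> x" "x \<le> y"
  shows "total_variation_on {a..x} g + ennreal (norm (g y - g x)) \<le> total_variation_on {a..y} g"
proof -
  let ?P = "\<lambda>x. {(n :: nat, t :: nat \<Rightarrow> real). mono_on {..n} t \<and> t ` {..n} \<subseteq> {a..x}}"
  let ?f = "\<lambda>(n :: nat, t :: nat \<Rightarrow> real). \<Sum>i<n. ennreal (norm (g (t (Suc i)) - g (t i)))"
  have ne: "?P x \<noteq> {}"
  proof -
    have "(0, \<lambda>_. a) \<in> ?P x" using assms by (auto simp: mono_on_def)
    then show ?thesis by blast
  qed
  have "total_variation_on {a..x} g + ennreal (norm (g y - g x)) = (SUP p \<in> ?P x. ?f p + ennreal (norm (g y - g x)))"
    unfolding total_variation_on_def by (rule ennreal_SUP_add_left[symmetric, OF ne])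
  also have "\<dots> \<le> total_variation_on {a..y} g"
  proof (rule SUP_least, clarify)
    fix n :: nat and t :: "nat \<Rightarrow> real" assume t: "mono_on {..n} t" "t ` {..n} \<subseteq> {a..x}"
    \<comment> \<open>The node \<open>x\<close> is inserted before \<open>y\<close> because the last
      node of \<open>t\<close> may lie to the left of \<open>x\<close>; the increment this creates
      is dropped afterwards.\<close>
    define t' where "t' i = (if i \<le> n then t i else if i = Suc n then x else y)" for i
    have tx: "t i \<in> {a..x}" if "i \<le> n" for i using t(2) that by auto
    have "mono_on {..Suc (Suc n)} t'"
      unfolding mono_on_def t'_def using t(1) tx assms(2) by (force simp: mono_on_def)
    moreover have "t' ` {..Suc (Suc n)} \<subseteq> {a..y}" using tx assms by (force simp: t'_def)
    ultimately have "(Suc (Suc n), t') \<in> ?P y" by simp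
    then have "?f (Suc (Suc n), t') \<le> total_variation_on {a..y} g"
      unfolding total_variation_on_def by (rule SUP_upper)
    moreover have "(\<Sum>i<n. ennreal (norm (g (t' (Suc i)) - g (t' i)))) = (\<Sum>i<n. ennreal (norm (g (t (Suc i)) - g (t i))))"
      by (intro sum.cong) (auto simp: t'_def)
    moreover have "norm (g (t' (Suc (Suc n))) - g (t' (Suc n))) = norm (g y - g x)" by (simp add: t'_def)
    ultimately have "(\<Sum>i<n. ennreal (norm (g (t (Suc i)) - g (t i)))) + ennreal (norm (g (t' (Suc n)) - g (t' n)))
        + ennreal (norm (g y - g x)) \<le> total_variation_on {a..y} g" by (simp del: sum_ennreal)
    then show "(\<Sum>i<n. ennreal (norm (g (t (Suc i)) - g (t i)))) + ennreal (norm (g y - g x)) \<le> total_variation_on {a..y} g"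
      by (rule order_trans[rotated]) (intro add_right_mono, simp)
  qed
  finally show ?thesis .
qed

lemma BV_jordan_decomposition:
  fixes g :: "real \<Rightarrow> complex"
  assumes ab: "a \<le> b" and tv: "total_variation_on {a..b} g = ennreal V" "0 \<le> V"
  obtains v where "mono_on {a..b} v" "\<And>x. x \<in> {a..b} \<Longrightarrow> 0 \<le> v x \<and> v x \<le> V"
    "\<And>x y. x \<in> {a..b} \<Longrightarrow> y \<in> {a..b} \<Longrightarrow> x \<le> y \<Longrightarrow> norm (g y - g x) \<le> v y - v x"
proof -
  define v where "v x = enn2real (total_variation_on {a..x} g)" for x
  have le: "total_variation_on {a..x} g \<le> ennreal V" if "x \<in> {a..b}" for x
  proof -
    have "total_variation_on {a..x} g \<le> total_variation_on {a..x} g + ennreal (norm (g b - g x))" by simp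
    also have "\<dots> \<le> total_variation_on {a..b} g" using that by (intro total_variation_append) auto
    finally show ?thesis by (simp add: tv)
  qed
  have fin: "total_variation_on {a..x} g = ennreal (v x)" if "x \<in> {a..b}" for x
  proof -
    have "total_variation_on {a..x} g < top" using le[OF that] by (rule order.strict_trans1) simp
    then show ?thesis by (simp add: v_def)
  qed
  have v0: "0 \<le> v x" for x by (simp add: v_def)
  have diff: "norm (g y - g x) \<le> v y - v x" if "x \<in> {a..b}" "y \<in> {a..b}" "x \<le> y" for x y
  proof -
    have "ennreal (v x) + ennreal (norm (g y - g x)) \<le> ennreal (v y)"
      using total_variation_append[of a x y g] fin that by auto
    then show ?thesis using v0 by (simp add: ennreal_plus[symmetric] del: ennreal_plus)
  qed
  show thesis
  proof (rule that[of v])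
    show "mono_on {a..b} v"
    proof (rule mono_onI)
      fix x y assume "x \<in> {a..b}" "y \<in> {a..b}" "x \<le> y"
      from diff[OF this] show "v x \<le> v y" using norm_ge_zero[of "g y - g x"] by linarith
    qed
    show "0 \<le> v x \<and> v x \<le> V" if "x \<in> {a..b}" for x
      using le[OF that] fin[OF that] v0[of x] tv(2) by simp
  qed (rule diff)
qed

text \<open>The constant 6 is 2 + 2 + 2, from \<open>(1 + \<i>) * v\<close> and the two functions
  \<open>p Re\<close> and \<open>p Im\<close> with range in \<open>[0, 2 * V]\<close>; the geometric
  series supplies \<open>1 / (1 - l)\<close>.\<close>

lemma defect_BV_bound:
  assumes \<gamma>: "1 < \<gamma>"
  obtains K where "0 < K"
    "\<And>g V. 0 \<le> V \<Longrightarrow> total_variation_on {1..\<gamma>} g = ennreal V \<Longrightarrow> (\<And>x. x \<notin> {1..\<gamma>} \<Longrightarrow> g x = 0) \<Longrightarrow>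
      supported_on {1..\<gamma>} g \<and> (\<Sum>k. l1 (defect \<gamma> k g)) \<le> ennreal (K * (norm (g 1) + V))"
proof -
  let ?I = "{1..\<gamma>}"
  have \<gamma>0: "0 < \<gamma>" and \<gamma>1: "1 \<le> \<gamma>" using \<gamma> by auto
  obtain C l where C: "0 \<le> C" "0 \<le> l" "l < 1" and ind:
    "\<And>J k. is_interval J \<Longrightarrow> J \<subseteq> ?I \<Longrightarrow> l1 (defect \<gamma> k (indicator J)) \<le> ennreal (C * l ^ k)"
    by (rule defect_indicator_bound[OF \<gamma>]) blast
  show thesis
  proof (rule that[of "6 * (C / (1 - l)) + 1"])
    show "0 < 6 * (C / (1 - l)) + 1" using C by (simp add: add_nonneg_pos)
    fix g :: "real \<Rightarrow> complex" and V
    assume V: "0 \<le> V" and tv: "total_variation_on ?I g = ennreal V" and g0: "\<And>x. x \<notin> ?I \<Longrightarrow> g x = 0"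
    obtain v where v: "mono_on ?I v" "\<And>x. x \<in> ?I \<Longrightarrow> 0 \<le> v x \<and> v x \<le> V"
      "\<And>x y. x \<in> ?I \<Longrightarrow> y \<in> ?I \<Longrightarrow> x \<le> y \<Longrightarrow> norm (g y - g x) \<le> v y - v x"
      by (rule BV_jordan_decomposition[OF \<gamma>1 tv V]) blast
    \<comment> \<open>The increments of \<open>v\<close> dominate those of \<open>F\<close> composed
      with \<open>g\<close> for every 1-Lipschitz \<open>F\<close>, so \<open>p F\<close> is
      nondecreasing; subtracting the value at 1 keeps it between 0 and \<open>2 * V\<close>.\<close>
    define p where "p F x = v x - (F (g x) - F (g 1))" for F :: "complex \<Rightarrow> real" and x
    have p: "mono_on ?I (p F) \<and> (\<forall>x\<in>?I. 0 \<le> p F x \<and> p F x \<le> 2 * V)"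
      if F: "\<And>z w. \<bar>F z - F w\<bar> \<le> norm (z - w)" for F
    proof
      show "mono_on ?I (p F)"
      proof (rule mono_onI)
        fix x y assume "x \<in> ?I" "y \<in> ?I" "x \<le> y"
        from v(3)[OF this] F[of "g y" "g x"] show "p F x \<le> p F y" unfolding p_def by linarith
      qed
      show "\<forall>x\<in>?I. 0 \<le> p F x \<and> p F x \<le> 2 * V"
      proof
        fix x assume x: "x \<in> ?I"
        have "1 \<in> ?I" using \<gamma> by simp
        from v(3)[OF this x] v(2)[OF x] v(2)[OF this] F[of "g x" "g 1"] x
        show "0 \<le> p F x \<and> p F x \<le> 2 * V" unfolding p_def by auto
      qed
    qed
    have pR: "mono_on ?I (p Re)" "\<And>x. x \<in> ?I \<Longrightarrow> 0 \<le> p Re x \<and> p Re x \<le> 2 * V"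
      using p[of Re] abs_Re_le_cmod[of "_ - _"] by auto
    have pI: "mono_on ?I (p Im)" "\<And>x. x \<in> ?I \<Longrightarrow> 0 \<le> p Im x \<and> p Im x \<le> 2 * V"
      using p[of Im] abs_Im_le_cmod[of "_ - _"] by auto
    \<comment> \<open>On the interval \<open>g\<close> equals
      \<open>g 1 + (1 + \<i>) * v - p Re - \<i> * p Im\<close>.\<close>
    define c where "c = (\<lambda>i::nat. if i = 0 then g 1 else if i = 1 then 1 + \<i> else if i = 2 then -1 else - \<i>)"
    define M where "M = (\<lambda>\<phi> :: real \<Rightarrow> real. \<lambda>x. complex_of_real (\<phi> x) * indicator ?I x)"
    define h where "h = (\<lambda>i::nat. if i = 0 then indicator ?I else if i = 1 then M v else if i = 2 then M (p Re) else M (p Im))"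
    have sM: "supported_on ?I (M \<phi>)" if "mono_on ?I \<phi>" for \<phi>
      unfolding M_def by (rule supported_on_mono_on(1)[OF that \<gamma>1])
    have sh: "supported_on ?I (h i)" for i
      by (simp add: h_def sM v(1) pR(1) pI(1) supported_on_indicator)
    have g_eq: "g = (\<lambda>x. \<Sum>i\<in>{0,1,2,3}. c i * h i x)"
    proof
      fix x
      have "g x = g 1 + (1 + \<i>) * of_real (v x) - of_real (p Re x) - \<i> * of_real (p Im x)"
        by (simp add: p_def complex_eq_iff)
      then show "g x = (\<Sum>i\<in>{0,1,2,3}. c i * h i x)"
        using g0[of x] by (cases "x \<in> ?I") (simp_all add: c_def h_def M_def)
    qed
    have fin: "finite {0,1,2,3::nat}" by simp
    show "supported_on ?I g \<and> (\<Sum>k. l1 (defect \<gamma> k g)) \<le> ennreal ((6 * (C / (1 - l)) + 1) * (norm (g 1) + V))"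
    proof
      show "supported_on ?I g" by (subst g_eq) (rule defect_sum_le(1)[OF fin sh \<gamma>0])
      have bM: "l1 (defect \<gamma> k (M \<phi>)) \<le> ennreal (B * (C * l ^ k))"
        if "mono_on ?I \<phi>" "\<And>x. x \<in> ?I \<Longrightarrow> 0 \<le> \<phi> x \<and> \<phi> x \<le> B" for \<phi> B k
        unfolding M_def by (rule defect_mono_on_bound[OF \<gamma> _ ind that]) (use C in auto)
      have bound: "l1 (defect \<gamma> k g) \<le> ennreal ((norm (g 1) + 6 * V) * C * l ^ k)" for k
      proof -
        let ?q = "C * l ^ k"
        have q: "0 \<le> ?q" using C by simp
        have "l1 (defect \<gamma> k g) \<le> (\<Sum>i\<in>{0,1,2,3}. ennreal (norm (c i)) * l1 (defect \<gamma> k (h i)))"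
          by (subst g_eq) (rule defect_sum_le(2)[OF fin sh \<gamma>0])
        also have "\<dots> = ennreal (norm (g 1)) * l1 (defect \<gamma> k (indicator ?I)) + (ennreal (norm (1 + \<i>)) * l1 (defect \<gamma> k (M v))
            + (l1 (defect \<gamma> k (M (p Re))) + l1 (defect \<gamma> k (M (p Im)))))"
          by (simp add: c_def h_def)
        also have "\<dots> \<le> ennreal (norm (g 1)) * ennreal ?q + (ennreal 2 * ennreal (V * ?q)
            + (ennreal (2 * V * ?q) + ennreal (2 * V * ?q)))"
        proof (intro add_mono mult_mono bM v pR pI ind)
          show "ennreal (norm (1 + \<i>)) \<le> ennreal 2"
            using norm_triangle_ineq[of 1 \<i>] by (intro ennreal_leI) simp
        qed (auto simp: is_interval_1)
        also have "\<dots> = ennreal ((norm (g 1) + 6 * V) * C * l ^ k)"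
        proof -
          have "ennreal n * ennreal q + (ennreal 2 * ennreal (V * q) + (ennreal (2 * V * q) + ennreal (2 * V * q)))
              = ennreal ((n + 6 * V) * q)" if "0 \<le> n" "0 \<le> q" for n q
          proof -
            have "0 \<le> n * q" "0 \<le> V * q" using that V by auto
            then have "ennreal n * ennreal q = ennreal (n * q)" "ennreal 2 * ennreal (V * q) = ennreal (2 * (V * q))"
              using that by (auto simp: ennreal_mult)
            then show ?thesis
              using \<open>0 \<le> n * q\<close> \<open>0 \<le> V * q\<close> by (simp add: ennreal_plus[symmetric] algebra_simps del: ennreal_plus)
          qed
          from this[OF norm_ge_zero q] show ?thesis by (simp add: mult.assoc)
        qed
        finally show ?thesis .
      qed
      have sl: "summable (\<lambda>k. l ^ k)" using C by (intro summable_geometric) simp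
      have "(\<Sum>k. l1 (defect \<gamma> k g)) \<le> (\<Sum>k. ennreal ((norm (g 1) + 6 * V) * C * l ^ k))"
        by (intro suminf_le bound summableI)
      also have "\<dots> = ennreal (\<Sum>k. (norm (g 1) + 6 * V) * C * l ^ k)"
        using C V sl by (intro suminf_ennreal2 summable_mult) auto
      also have "(\<Sum>k. (norm (g 1) + 6 * V) * C * l ^ k) = (norm (g 1) + 6 * V) * C * (1 / (1 - l))"
        using C sl by (simp add: suminf_mult suminf_geometric)
      also have "\<dots> = (norm (g 1) + 6 * V) * (C / (1 - l))" by simp
      also have "\<dots> \<le> (6 * (norm (g 1) + V)) * (C / (1 - l))"
        using C V by (intro mult_right_mono) auto
      also have "\<dots> \<le> (6 * (C / (1 - l)) + 1) * (norm (g 1) + V)"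
      proof -
        have "6 * z * d \<le> (6 * d + 1) * z" if "0 \<le> z" for z d :: real using that by (simp add: algebra_simps)
        from this[of "norm (g 1) + V" "C / (1 - l)"] show ?thesis using V by (simp only: add_nonneg_nonneg norm_ge_zero)
      qed
      finally show "(\<Sum>k. l1 (defect \<gamma> k g)) \<le> ennreal ((6 * (C / (1 - l)) + 1) * (norm (g 1) + V))"
        by (simp add: ennreal_leI)
    qed
  qed
qed

section \<open>Linearity of the extension up to null sets\<close>

lemma summable_defect_lincomb:
  assumes "summable_defect \<gamma> g" "summable_defect \<gamma> h"
  shows "summable_defect \<gamma> (\<lambda>x. a * g x + b * h x)"
    and "defect \<gamma> k (\<lambda>x. a * g x + b * h x) = (\<lambda>x. a * defect \<gamma> k g x + b * defect \<gamma> k h x)"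
proof -
  interpret g: summable_defect \<gamma> g by fact
  interpret h: summable_defect \<gamma> h by fact
  note sg = supported_on_cmult[OF g.g, of a] and sh = supported_on_cmult[OF h.g, of b]
  have eq: "defect \<gamma> k (\<lambda>x. a * g x + b * h x) = (\<lambda>x. a * defect \<gamma> k g x + b * defect \<gamma> k h x)" for k
    by (simp add: defect_add[OF sg sh g.\<gamma>0] defect_cmult[OF g.g g.\<gamma>0] defect_cmult[OF h.g g.\<gamma>0])
  then show "defect \<gamma> k (\<lambda>x. a * g x + b * h x) = (\<lambda>x. a * defect \<gamma> k g x + b * defect \<gamma> k h x)" .
  show "summable_defect \<gamma> (\<lambda>x. a * g x + b * h x)"
  proof
    show "1 < \<gamma>" by (rule g.\<gamma>)
    show "supported_on {1..\<gamma>} (\<lambda>x. a * g x + b * h x)" by (rule supported_on_add[OF sg sh])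
    have "l1 (\<lambda>x. a * defect \<gamma> k g x + b * defect \<gamma> k h x)
        \<le> ennreal (norm a) * l1 (defect \<gamma> k g) + ennreal (norm b) * l1 (defect \<gamma> k h)" for k
      using l1_add_le[of "\<lambda>x. a * defect \<gamma> k g x" "\<lambda>x. b * defect \<gamma> k h x"] by (simp add: l1_cmult)
    then have "(\<Sum>k. l1 (defect \<gamma> k (\<lambda>x. a * g x + b * h x)))
        \<le> (\<Sum>k. ennreal (norm a) * l1 (defect \<gamma> k g) + ennreal (norm b) * l1 (defect \<gamma> k h))"
      unfolding eq by (intro suminf_le summableI)
    also have "\<dots> = ennreal (norm a) * (\<Sum>k. l1 (defect \<gamma> k g)) + ennreal (norm b) * (\<Sum>k. l1 (defect \<gamma> k h))"
      by (simp add: suminf_add[symmetric])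
    also have "\<dots> < top" using g.fin h.fin by (simp add: less_top[symmetric] ennreal_mult_eq_top_iff)
    finally show "(\<Sum>k. l1 (defect \<gamma> k (\<lambda>x. a * g x + b * h x))) \<noteq> top" by simp
  qed
qed

lemma l1_eq_0_iff:
  assumes [measurable]: "v \<in> borel_measurable borel"
  shows "l1 v = 0 \<longleftrightarrow> (AE x in lborel. v x = 0)"
  unfolding l1_def by (subst nn_integral_0_iff_AE) auto

lemma extend_lincomb:
  assumes "summable_defect \<gamma> g" "summable_defect \<gamma> h"
  shows "AE x in lborel. extend \<gamma> (\<lambda>x. a * g x + b * h x) x = a * extend \<gamma> g x + b * extend \<gamma> h x"
proof -
  let ?f = "\<lambda>x. a * g x + b * h x"
  interpret g: summable_defect \<gamma> g by fact
  interpret h: summable_defect \<gamma> h by fact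
  interpret f: summable_defect \<gamma> ?f by (rule summable_defect_lincomb(1)[OF assms])
  note eq = summable_defect_lincomb(2)[OF assms, of _ a b]
  have bb: "bounded_borel (\<lambda>x. a * defect \<gamma> k g x)" "bounded_borel (\<lambda>x. b * defect \<gamma> k h x)" for k
    by (intro bounded_borel_cmult bounded_borel_defect g.g h.g g.\<gamma>0)+
  have ceq: "cgauss \<gamma> (defect \<gamma> k ?f) = (\<lambda>x. a * cgauss \<gamma> (defect \<gamma> k g) x + b * cgauss \<gamma> (defect \<gamma> k h) x)" for k
    unfolding eq cgauss_add[OF bb g.\<gamma>0]
    by (simp add: cgauss_cmult bounded_borel_defect[OF g.g g.\<gamma>0] bounded_borel_defect[OF h.g g.\<gamma>0] g.\<gamma>0)
  have cf: "cgauss \<gamma> ?f = (\<lambda>x. a * cgauss \<gamma> g x + b * cgauss \<gamma> h x)"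
    using cgauss_add[OF bounded_borel_cmult[OF supported_onD(1)[OF g.g], of a] bounded_borel_cmult[OF supported_onD(1)[OF h.g], of b] g.\<gamma>0]
    by (simp add: cgauss_cmult supported_onD(1)[OF g.g] supported_onD(1)[OF h.g] g.\<gamma>0)
  have lin: "(\<Sum>k. a * p k + b * q k) = a * (\<Sum>k. p k) + b * (\<Sum>k. q k)"
    if "summable (\<lambda>k. norm (p k))" "summable (\<lambda>k. norm (q k))" for p q :: "nat \<Rightarrow> complex"
    using summable_norm_cancel[OF that(1)] summable_norm_cancel[OF that(2)]
    by (simp add: suminf_add[symmetric] suminf_mult summable_mult)
  have u: "AE x in lborel. (\<Sum>k. defect \<gamma> k ?f x) = a * (\<Sum>k. defect \<gamma> k g x) + b * (\<Sum>k. defect \<gamma> k h x)"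
    using g.series_defect(1) h.series_defect(1) by eventually_elim (simp add: eq lin)
  \<comment> \<open>The failure of linearity of the tail. It is null, and
    \<open>l1_indicator_cinv\<close> carries this through the inversion.\<close>
  define w where "w y = tail_part \<gamma> ?f y - (a * tail_part \<gamma> g y + b * tail_part \<gamma> h y)" for y
  have [measurable]: "w \<in> borel_measurable borel" unfolding w_def[abs_def] by measurable
  have "AE y in lborel. w y = 0"
    using g.series_cgauss(1) h.series_cgauss(1)
    by eventually_elim (simp add: w_def tail_part_def ceq cf lin algebra_simps)
  then have "l1 w = 0" by (subst l1_eq_0_iff) auto
  then have "l1 (\<lambda>x. indicator {0<..} x * cinv \<gamma> w x) = 0"
    using l1_indicator_cinv[of w \<gamma>] g.\<gamma>0 by simp
  moreover have [measurable]: "cinv \<gamma> w \<in> borel_measurable borel" unfolding cinv_def[abs_def] by measurable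
  ultimately have "AE x in lborel. indicator {0<..} x * cinv \<gamma> w x = 0"
    by (subst (asm) l1_eq_0_iff) auto
  with u show ?thesis
  proof eventually_elim
    case (elim x)
    have "indicator {0<..} x * cinv \<gamma> (tail_part \<gamma> ?f) x - (a * (indicator {0<..} x * cinv \<gamma> (tail_part \<gamma> g) x)
        + b * (indicator {0<..} x * cinv \<gamma> (tail_part \<gamma> h) x)) = indicator {0<..} x * cinv \<gamma> w x"
      by (simp add: cinv_def w_def left_diff_distrib right_diff_distrib distrib_left distrib_right mult_ac del: of_real_divide)
    then have "indicator {0<..} x * cinv \<gamma> (tail_part \<gamma> ?f) x = a * (indicator {0<..} x * cinv \<gamma> (tail_part \<gamma> g) x)
        + b * (indicator {0<..} x * cinv \<gamma> (tail_part \<gamma> h) x)" using elim(2) by simp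
    then show ?case unfolding extend_eq elim(1) by (simp add: algebra_simps)
  qed
qed

text \<open>The difference has L^1 norm 0, hence so do all its defects and its extension; linearity
  does the rest.\<close>

lemma extend_cong_AE:
  assumes "summable_defect \<gamma> g" "summable_defect \<gamma> h" "AE x in lborel. g x = h x"
  shows "AE x in lborel. extend \<gamma> g x = extend \<gamma> h x"
proof -
  let ?d = "\<lambda>x. 1 * g x + (-1) * h x"
  interpret d: summable_defect \<gamma> ?d by (rule summable_defect_lincomb(1)[OF assms(1,2)])
  have "AE x in lborel. ?d x = 0" using assms(3) by eventually_elim simp
  then have l0: "l1 ?d = 0" by (simp only: l1_eq_0_iff[OF d.measurable_g])
  then have "l1 (defect \<gamma> k ?d) = 0" for k using l1_defect_le[OF d.g d.\<gamma>0, of k] by simp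
  then have "l1 (extend \<gamma> ?d) = 0" using d.l1_extend l0 by simp
  then have "AE x in lborel. extend \<gamma> ?d x = 0" by (simp only: l1_eq_0_iff[OF d.measurable_extend])
  with extend_lincomb[OF assms(1,2), of 1 "-1"] show ?thesis by eventually_elim simp
qed

section \<open>The extension operator\<close>

text \<open>Replaces the value at 1, which is not defined for classes, by the norm:
  \<open>norm (g x)\<close> is at least \<open>norm (g 1) - V\<close> on an interval of length
  \<open>\<gamma> - 1\<close>.\<close>

lemma l1_lower_bound:
  assumes \<gamma>: "1 < \<gamma>" and tv: "total_variation_on {1..\<gamma>} g = ennreal V" "0 \<le> V" and M: "l1 g = ennreal M" "0 \<le> M"
  shows "norm (g 1) \<le> V + M / (\<gamma> - 1)"
proof -
  obtain v where v: "\<And>x. x \<in> {1..\<gamma>} \<Longrightarrow> 0 \<le> v x \<and> v x \<le> V"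
    "\<And>x y. x \<in> {1..\<gamma>} \<Longrightarrow> y \<in> {1..\<gamma>} \<Longrightarrow> x \<le> y \<Longrightarrow> norm (g y - g x) \<le> v y - v x"
    by (rule BV_jordan_decomposition[OF less_imp_le[OF \<gamma>] tv]) blast
  have low: "norm (g 1) - V \<le> norm (g x)" if "x \<in> {1..\<gamma>}" for x
  proof -
    have "norm (g 1) \<le> norm (g x) + norm (g x - g 1)" using norm_triangle_ineq4[of "g x" "g x - g 1"] by simp
    moreover have "norm (g x - g 1) \<le> V" using v(2)[of 1 x] v(1)[OF that] v(1)[of 1] that \<gamma> by auto
    ultimately show ?thesis by simp
  qed
  have "ennreal ((norm (g 1) - V) * (\<gamma> - 1)) = (\<integral>\<^sup>+x. ennreal (norm (g 1) - V) * indicator {1..\<gamma>} x \<partial>lborel)"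
    using \<gamma> by (simp add: nn_integral_cmult_indicator ennreal_mult'')
  also have "\<dots> \<le> l1 g"
    unfolding l1_def using low by (intro nn_integral_mono) (auto split: split_indicator intro: ennreal_leI)
  finally have "(norm (g 1) - V) * (\<gamma> - 1) \<le> M" using M by simp
  then show ?thesis using \<gamma> by (simp add: field_simps)
qed

lemma total_variation_on_cong:
  assumes "\<And>x. x \<in> I \<Longrightarrow> f x = g x"
  shows "total_variation_on I f = total_variation_on I g"
  unfolding total_variation_on_def
proof (intro SUP_cong refl, clarify)
  fix n :: nat and t :: "nat \<Rightarrow> real" assume "mono_on {..n} t" "t ` {..n} \<subseteq> I"
  then show "(\<Sum>i<n. ennreal (norm (f (t (Suc i)) - f (t i)))) = (\<Sum>i<n. ennreal (norm (g (t (Suc i)) - g (t i))))"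
    by (intro sum.cong) (auto simp: assms image_subset_iff)
qed

lemma total_variation_on_lincomb_le:
  "total_variation_on I (\<lambda>x. a * f x + b * g x)
    \<le> ennreal (norm a) * total_variation_on I f + ennreal (norm b) * total_variation_on I g"
proof -
  let ?P = "{(n :: nat, t :: nat \<Rightarrow> real). mono_on {..n} t \<and> t ` {..n} \<subseteq> I}"
  have upper: "(\<Sum>i<n. ennreal (norm (h (t (Suc i)) - h (t i)))) \<le> total_variation_on I h"
    if "(n, t) \<in> ?P" for n t h
    unfolding total_variation_on_def by (rule SUP_upper2[OF that]) simp
  show ?thesis
    unfolding total_variation_on_def[of I "\<lambda>x. a * f x + b * g x"]
  proof (rule SUP_least, clarify)
    fix n :: nat and t :: "nat \<Rightarrow> real" assume "mono_on {..n} t" "t ` {..n} \<subseteq> I"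
    then have t: "(n, t) \<in> ?P" by simp
    have "ennreal (norm (a * f y + b * g y - (a * f x + b * g x)))
        \<le> ennreal (norm a) * ennreal (norm (f y - f x)) + ennreal (norm b) * ennreal (norm (g y - g x))" for x y
    proof -
      have "a * f y + b * g y - (a * f x + b * g x) = a * (f y - f x) + b * (g y - g x)"
        by (simp add: algebra_simps)
      then have "norm (a * f y + b * g y - (a * f x + b * g x)) \<le> norm a * norm (f y - f x) + norm b * norm (g y - g x)"
        using norm_triangle_ineq[of "a * (f y - f x)" "b * (g y - g x)"] by (simp add: norm_mult)
      then show ?thesis by (simp add: ennreal_mult[symmetric] ennreal_plus[symmetric] ennreal_leI del: ennreal_plus)
    qed
    then have "(\<Sum>i<n. ennreal (norm (a * f (t (Suc i)) + b * g (t (Suc i)) - (a * f (t i) + b * g (t i)))))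
        \<le> (\<Sum>i<n. ennreal (norm a) * ennreal (norm (f (t (Suc i)) - f (t i))) + ennreal (norm b) * ennreal (norm (g (t (Suc i)) - g (t i))))"
      by (intro sum_mono)
    also have "\<dots> = ennreal (norm a) * (\<Sum>i<n. ennreal (norm (f (t (Suc i)) - f (t i))))
        + ennreal (norm b) * (\<Sum>i<n. ennreal (norm (g (t (Suc i)) - g (t i))))"
      by (simp add: sum.distrib sum_distrib_left del: sum_ennreal)
    also have "\<dots> \<le> ennreal (norm a) * total_variation_on I f + ennreal (norm b) * total_variation_on I g"
      by (intro add_mono mult_left_mono upper t) auto
    finally show "(\<Sum>i<n. ennreal (norm (a * f (t (Suc i)) + b * g (t (Suc i)) - (a * f (t i) + b * g (t i)))))
      \<le> ennreal (norm a) * total_variation_on I f + ennreal (norm b) * total_variation_on I g" .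
  qed
qed

text \<open>The increments along an increasing sequence are nonnegative, so their norms
  telescope.\<close>

lemma total_variation_on_step:
  "total_variation_on I (\<lambda>x. if p \<le> x then 1 else 0) \<le> 1"
  unfolding total_variation_on_def
proof (rule SUP_least, clarify)
  fix n :: nat and t :: "nat \<Rightarrow> real" assume t: "mono_on {..n} t"
  define s where "s x = (if p \<le> x then 1 else 0 :: real)" for x
  have s: "norm ((if p \<le> t (Suc i) then 1 else 0) - (if p \<le> t i then 1 else 0 :: complex)) = s (t (Suc i)) - s (t i)"
    if "i < n" for i
    using mono_onD[OF t, of i "Suc i"] that by (auto simp: s_def)
  have "(\<Sum>i<n. ennreal (norm ((if p \<le> t (Suc i) then 1 else 0) - (if p \<le> t i then 1 else 0 :: complex))))
      = ennreal (\<Sum>i<n. norm ((if p \<le> t (Suc i) then 1 else 0) - (if p \<le> t i then 1 else 0 :: complex)))"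
    by (rule sum_ennreal) simp
  also have "(\<Sum>i<n. norm ((if p \<le> t (Suc i) then 1 else 0) - (if p \<le> t i then 1 else 0 :: complex))) = s (t n) - s (t 0)"
    using s sum_lessThan_telescope[of "\<lambda>i. s (t i)" n] by simp
  also have "ennreal (s (t n) - s (t 0)) \<le> ennreal 1" by (rule ennreal_leI) (simp add: s_def)
  finally show "(\<Sum>i<n. ennreal (norm ((if p \<le> t (Suc i) then 1 else 0) - (if p \<le> t i then 1 else 0 :: complex)))) \<le> 1"
    by simp
qed

text \<open>Fewer homogeneous equations than unknowns, by Gaussian elimination: an unknown with
  nonzero coefficient in equation \<open>b\<close> is expressed through the others.\<close>

lemma nontrivial_solution:
  fixes c :: "'a \<Rightarrow> 'b \<Rightarrow> complex"
  assumes "finite B" "finite A" "card B < card A"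
  shows "\<exists>l. (\<exists>a\<in>A. l a \<noteq> 0) \<and> (\<forall>b\<in>B. (\<Sum>a\<in>A. l a * c a b) = 0)"
  using assms
proof (induction B arbitrary: A c)
  case empty
  then have "A \<noteq> {}" by auto
  then show ?case by (intro exI[of _ "\<lambda>_. 1"]) auto
next
  case (insert b B)
  show ?case
  proof (cases "\<forall>a\<in>A. c a b = 0")
    case True
    have "card B < card A" using insert by simp
    from insert.IH[OF insert.prems(1) this, of c] True show ?thesis by auto
  next
    case False
    then obtain a0 where a0: "a0 \<in> A" "c a0 b \<noteq> 0" by blast
    let ?A = "A - {a0}"
    let ?c = "\<lambda>a b'. c a b' - c a b / c a0 b * c a0 b'"
    have "card B < card ?A" using insert a0 by simp
    from insert.IH[OF _ this, of ?c] insert.prems obtain l where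
      l: "\<exists>a\<in>?A. l a \<noteq> 0" "\<And>b'. b' \<in> B \<Longrightarrow> (\<Sum>a\<in>?A. l a * ?c a b') = 0" by auto
    \<comment> \<open>The value at the eliminated unknown is dictated by equation
      \<open>b\<close>.\<close>
    define m where "m a = (if a = a0 then - (\<Sum>a\<in>?A. l a * (c a b / c a0 b)) else l a)" for a
    have sum_m: "(\<Sum>a\<in>A. m a * c a b') = (\<Sum>a\<in>?A. l a * ?c a b')" for b'
    proof -
      have "(\<Sum>a\<in>A. m a * c a b') = m a0 * c a0 b' + (\<Sum>a\<in>?A. l a * c a b')"
        using insert.prems(1) a0(1) by (subst sum.remove[of A a0]) (auto simp: m_def intro!: sum.cong)
      also have "\<dots> = (\<Sum>a\<in>?A. l a * ?c a b')"
        by (simp add: m_def sum_distrib_right right_diff_distrib sum_subtractf mult.assoc)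
      finally show ?thesis .
    qed
    have "(\<Sum>a\<in>A. m a * c a b') = 0" if "b' \<in> insert b B" for b'
    proof (cases "b' = b")
      case True
      then show ?thesis unfolding sum_m using a0(2) by simp
    next
      case False
      then show ?thesis unfolding sum_m using l(2) that by simp
    qed
    moreover have "\<exists>a\<in>A. m a \<noteq> 0" using l(1) by (auto simp: m_def)
    ultimately show ?thesis by blast
  qed
qed

section \<open>The operator on classes of functions of bounded variation\<close>

locale BV_extension =
  fixes \<gamma> :: real
  assumes \<gamma>: "1 < \<gamma>"
begin

definition I :: "real set" where "I = {1..\<gamma>}"

text \<open>The choice of representative need not be linear in \<open>f\<close>. Linearity of the
  operator is recovered because \<open>extend\<close> respects equality almost everywhere.\<close>

definition rep :: "(real \<Rightarrow> complex) \<Rightarrow> real \<Rightarrow> complex" where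
  "rep f x = (SOME g. ae_eq_on I g f \<and> total_variation_on I g < \<infinity>) x * indicator I x"

definition reps :: "(real \<Rightarrow> complex) set" where
  "reps = {h. total_variation_on I h < \<infinity> \<and> (\<forall>x. x \<notin> I \<longrightarrow> h x = 0)}"

lemma restrict_in_reps:
  assumes "total_variation_on I g < \<infinity>"
  shows "(\<lambda>x. g x * indicator I x) \<in> reps"
proof -
  have "total_variation_on I (\<lambda>x. g x * indicator I x) = total_variation_on I g"
    by (rule total_variation_on_cong) simp
  then show ?thesis using assms by (simp add: reps_def)
qed

lemma rep:
  assumes "f \<in> BV I"
  shows "rep f \<in> reps" "AE x in lborel. x \<in> I \<longrightarrow> rep f x = f x"
proof -
  let ?g = "SOME g. ae_eq_on I g f \<and> total_variation_on I g < \<infinity>"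
  have "\<exists>g. ae_eq_on I g f \<and> total_variation_on I g < \<infinity>" using assms by (simp add: BV_def)
  then have *: "ae_eq_on I ?g f \<and> total_variation_on I ?g < \<infinity>" by (rule someI_ex)
  then show "rep f \<in> reps" using restrict_in_reps[of ?g] by (simp add: rep_def[abs_def])
  have "AE x in lborel. x \<in> I \<longrightarrow> ?g x = f x" using * by (simp add: ae_eq_on_def AE_completion_iff)
  then show "AE x in lborel. x \<in> I \<longrightarrow> rep f x = f x" by eventually_elim (simp add: rep_def)
qed

lemma rep_outside: "x \<notin> I \<Longrightarrow> rep f x = 0"
  by (simp add: rep_def)

text \<open>Stated for every representative and not only for the chosen one, since the norm takes an
  infimum over all of them.\<close>

lemma reps_bound:
  obtains K where "0 < K" "\<And>h. h \<in> reps \<Longrightarrow> summable_defect \<gamma> h"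
    "\<And>h M V. h \<in> reps \<Longrightarrow> l1 h = ennreal M \<Longrightarrow> 0 \<le> M \<Longrightarrow> total_variation_on I h = ennreal V \<Longrightarrow> 0 \<le> V \<Longrightarrow>
      l1 (extend \<gamma> h) \<le> ennreal (K * (M + V))"
proof -
  obtain K where K: "0 < K" and b: "\<And>g V. 0 \<le> V \<Longrightarrow> total_variation_on {1..\<gamma>} g = ennreal V \<Longrightarrow> (\<And>x. x \<notin> {1..\<gamma>} \<Longrightarrow> g x = 0) \<Longrightarrow>
      supported_on {1..\<gamma>} g \<and> (\<Sum>k. l1 (defect \<gamma> k g)) \<le> ennreal (K * (norm (g 1) + V))"
    by (rule defect_BV_bound[OF \<gamma>]) blast
  have sd: "summable_defect \<gamma> h" if hr: "h \<in> reps" for h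
  proof
    obtain V where V: "total_variation_on {1..\<gamma>} h = ennreal V" "0 \<le> V"
      using hr by (cases "total_variation_on {1..\<gamma>} h") (auto simp: reps_def I_def)
    from b[OF V(2,1)] hr have *: "supported_on {1..\<gamma>} h \<and> (\<Sum>k. l1 (defect \<gamma> k h)) \<le> ennreal (K * (norm (h 1) + V))"
      by (auto simp: reps_def I_def)
    show "supported_on {1..\<gamma>} h" using * by simp
    show "(\<Sum>k. l1 (defect \<gamma> k h)) \<noteq> top" using * by (auto simp: top_unique)
  qed (rule \<gamma>)
  \<comment> \<open>The factor \<open>2 + 1 / (\<gamma> - 1)\<close> comes from inserting
    \<open>l1_lower_bound\<close> into \<open>norm (h 1) + V\<close>, the outer 2 from
    \<open>l1_extend\<close>.\<close>
  define L where "L = 2 * (1 + K * (2 + 1 / (\<gamma> - 1)))"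
  have K2: "0 \<le> K * (2 + 1 / (\<gamma> - 1))" using K \<gamma> by (auto intro!: mult_nonneg_nonneg add_nonneg_nonneg)
  show thesis
  proof (rule that[of L])
    show "0 < L" using K2 by (simp add: L_def)
    fix h M V assume h: "h \<in> reps" and M: "l1 h = ennreal M" "0 \<le> M" and V: "total_variation_on I h = ennreal V" "0 \<le> V"
    interpret summable_defect \<gamma> h by (rule sd) fact
    have V': "total_variation_on {1..\<gamma>} h = ennreal V" using V by (simp add: I_def)
    have "(\<Sum>k. l1 (defect \<gamma> k h)) \<le> ennreal (K * (norm (h 1) + V))"
      using b[OF V(2) V'] h by (auto simp: reps_def I_def)
    also have "\<dots> \<le> ennreal (K * (2 + 1 / (\<gamma> - 1)) * (M + V))"
    proof (rule ennreal_leI)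
      have "norm (h 1) + V \<le> 2 * V + M / (\<gamma> - 1)" using l1_lower_bound[OF \<gamma> V' V(2) M] by simp
      also have "\<dots> \<le> (2 + 1 / (\<gamma> - 1)) * (M + V)"
      proof -
        have 1: "M / (\<gamma> - 1) \<le> (M + V) / (\<gamma> - 1)" using V \<gamma> by (intro divide_right_mono) auto
        have 2: "(2 + 1 / (\<gamma> - 1)) * (M + V) = 2 * (M + V) + (M + V) / (\<gamma> - 1)" by (simp add: distrib_right)
        have "2 * V + z \<le> 2 * (M + V) + w" if "z \<le> w" for z w :: real using that M(2) by simp
        from this[OF 1] show ?thesis unfolding 2 .
      qed
      finally have "K * (norm (h 1) + V) \<le> K * ((2 + 1 / (\<gamma> - 1)) * (M + V))" using K by (intro mult_left_mono) auto
      then show "K * (norm (h 1) + V) \<le> K * (2 + 1 / (\<gamma> - 1)) * (M + V)" by (simp only: mult.assoc)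
    qed
    finally have S: "(\<Sum>k. l1 (defect \<gamma> k h)) \<le> ennreal (K * (2 + 1 / (\<gamma> - 1)) * (M + V))" .
    have "l1 (extend \<gamma> h) \<le> 2 * (l1 h + (\<Sum>k. l1 (defect \<gamma> k h)))" by (rule l1_extend)
    also have "\<dots> \<le> 2 * (ennreal (M + V) + ennreal (K * (2 + 1 / (\<gamma> - 1)) * (M + V)))"
      using S M V by (intro mult_left_mono add_mono) (auto intro: ennreal_leI)
    also have "\<dots> = ennreal (L * (M + V))"
    proof -
      have "0 \<le> M + V" "0 \<le> K * (2 + 1 / (\<gamma> - 1)) * (M + V)" using M V K2 by auto
      moreover have "2 * (ennreal y + ennreal z) = ennreal (2 * (y + z))" if "0 \<le> y" "0 \<le> z" for y z
        using that ennreal_mult'[of 2 "y + z"] by simp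
      ultimately have "2 * (ennreal (M + V) + ennreal (K * (2 + 1 / (\<gamma> - 1)) * (M + V)))
          = ennreal (2 * (M + V + K * (2 + 1 / (\<gamma> - 1)) * (M + V)))"
        by blast
      also have "2 * (M + V + K * (2 + 1 / (\<gamma> - 1)) * (M + V)) = L * (M + V)"
        by (simp only: L_def distrib_left distrib_right mult_1 mult_1_right mult.assoc)
      finally show ?thesis .
    qed
    finally show "l1 (extend \<gamma> h) \<le> ennreal (L * (M + V))" .
  qed (rule sd)
qed

lemma summable_reps: "h \<in> reps \<Longrightarrow> summable_defect \<gamma> h"
  using reps_bound by blast

lemma extend_lincomb_reps:
  assumes "h \<in> reps" "h1 \<in> reps" "h2 \<in> reps" "AE x in lborel. x \<in> I \<longrightarrow> h x = a * h1 x + b * h2 x"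
  shows "AE x in lborel. extend \<gamma> h x = a * extend \<gamma> h1 x + b * extend \<gamma> h2 x"
proof -
  note s = summable_reps[OF assms(1)] summable_reps[OF assms(2)] summable_reps[OF assms(3)]
  have "AE x in lborel. h x = a * h1 x + b * h2 x"
    using assms(4) by eventually_elim (use assms(1-3) in \<open>auto simp: reps_def\<close>)
  from extend_cong_AE[OF s(1) summable_defect_lincomb(1)[OF s(2,3)] this] extend_lincomb[OF s(2,3), of a b]
  show ?thesis by eventually_elim simp
qed

definition E :: "(real \<Rightarrow> complex) \<Rightarrow> real \<Rightarrow> complex" where
  "E f = extend \<gamma> (rep f)"

lemma E_on:
  assumes "f \<in> BV I"
  shows "AE x in lborel. x \<in> I \<longrightarrow> E f x = f x"
proof -
  interpret summable_defect \<gamma> "rep f" by (rule summable_reps[OF rep(1)[OF assms]])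
  show ?thesis
    using rep(2)[OF assms] by eventually_elim (auto simp: E_def I_def extend_on)
qed

lemma E_lincomb:
  assumes "f \<in> BV I" "f1 \<in> BV I" "f2 \<in> BV I" "AE x in lborel. x \<in> I \<longrightarrow> f x = a * f1 x + b * f2 x"
  shows "AE x in lborel. E f x = a * E f1 x + b * E f2 x"
  unfolding E_def
proof (rule extend_lincomb_reps)
  show "AE x in lborel. x \<in> I \<longrightarrow> rep f x = a * rep f1 x + b * rep f2 x"
    using rep(2)[OF assms(1)] rep(2)[OF assms(2)] rep(2)[OF assms(3)] assms(4) by eventually_elim simp
qed (use rep assms in auto)

lemma summable_rep: "f \<in> BV I \<Longrightarrow> summable_defect \<gamma> (rep f)"
  by (rule summable_reps[OF rep(1)])

lemma E_measurable: "f \<in> BV I \<Longrightarrow> E f \<in> borel_measurable borel"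
  unfolding E_def by (rule summable_defect.measurable_extend[OF summable_rep])

lemma l1_E_finite: "f \<in> BV I \<Longrightarrow> l1 (E f) \<noteq> top"
  unfolding E_def by (rule summable_defect.l1_extend_finite[OF summable_rep])

lemma E_in_L1:
  assumes "f \<in> BV I" "S \<in> sets borel"
  shows "E f \<in> L1 S"
proof -
  note [measurable] = E_measurable[OF assms(1)] assms(2)
  have "integrable lborel (\<lambda>x. indicator S x *\<^sub>R E f x)"
    by (intro integrable_mult_indicator integrable_of_l1 l1_E_finite assms) auto
  then show ?thesis by (simp add: L1_def set_integrable_def integrable_completion)
qed

lemma L1_norm_E_le:
  assumes "f \<in> BV I" "S \<in> sets borel"
  shows "L1_norm S (E f) \<le> enn2real (l1 (E f))"
proof -
  note [measurable] = E_measurable[OF assms(1)] assms(2)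
  have "L1_norm S (E f) = (\<integral>x. indicator S x *\<^sub>R norm (E f x) \<partial>lborel)"
    by (simp add: L1_norm_def set_lebesgue_integral_def integral_completion)
  also have "\<dots> = enn2real (\<integral>\<^sup>+x. ennreal (indicator S x *\<^sub>R norm (E f x)) \<partial>lborel)"
    by (rule integral_eq_nn_integral) auto
  also have "\<dots> \<le> enn2real (l1 (E f))"
  proof (rule enn2real_mono)
    show "(\<integral>\<^sup>+x. ennreal (indicator S x *\<^sub>R norm (E f x)) \<partial>lborel) \<le> l1 (E f)"
      unfolding l1_def by (intro nn_integral_mono) (auto split: split_indicator)
  qed (use l1_E_finite[OF assms(1)] in \<open>simp add: less_top\<close>)
  finally show ?thesis .
qed

lemma L1_norm_eq_rep:
  assumes "f \<in> BV I"
  shows "L1_norm I f = enn2real (l1 (rep f))"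
proof -
  interpret summable_defect \<gamma> "rep f" by (rule summable_rep[OF assms])
  have [measurable]: "I \<in> sets borel" by (simp add: I_def)
  have "integrable lebesgue (\<lambda>x. indicator I x *\<^sub>R f x)" using assms by (simp add: BV_def L1_def set_integrable_def)
  then have "(\<lambda>x. norm (indicator I x *\<^sub>R f x)) \<in> borel_measurable lebesgue" by measurable
  then have m: "(\<lambda>x. indicator I x *\<^sub>R norm (f x)) \<in> borel_measurable lebesgue" by simp
  have "L1_norm I f = (\<integral>x. indicator I x *\<^sub>R norm (f x) \<partial>lebesgue)"
    by (simp add: L1_norm_def set_lebesgue_integral_def)
  also have "\<dots> = (\<integral>x. norm (rep f x) \<partial>lebesgue)"
  proof (rule integral_cong_AE[OF m])
    show "(\<lambda>x. norm (rep f x)) \<in> borel_measurable lebesgue" by (intro measurable_completion) measurable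
    have "AE x in lborel. indicator I x *\<^sub>R norm (f x) = norm (rep f x)"
      using rep(2)[OF assms] by eventually_elim (auto simp: rep_outside split: split_indicator)
    then show "AE x in lebesgue. indicator I x *\<^sub>R norm (f x) = norm (rep f x)" by (rule AE_completion)
  qed
  also have "\<dots> = (\<integral>x. norm (rep f x) \<partial>lborel)" by (rule integral_completion) measurable
  also have "\<dots> = enn2real (l1 (rep f))" unfolding l1_def by (rule integral_eq_nn_integral) auto
  finally show ?thesis .
qed

lemma E_bounded: "\<exists>C. \<forall>f\<in>BV I. L1_norm {0..} (E f) \<le> C * BV_norm I f"
proof -
  obtain K where K: "0 < K" and bound:
    "\<And>h M V. h \<in> reps \<Longrightarrow> l1 h = ennreal M \<Longrightarrow> 0 \<le> M \<Longrightarrow> total_variation_on I h = ennreal V \<Longrightarrow> 0 \<le> V \<Longrightarrow>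
      l1 (extend \<gamma> h) \<le> ennreal (K * (M + V))"
    by (rule reps_bound) blast
  have "L1_norm {0..} (E f) \<le> K * BV_norm I f" if f: "f \<in> BV I" for f
  proof -
    interpret r: summable_defect \<gamma> "rep f" by (rule summable_rep[OF f])
    let ?N = "INF g \<in> {g. ae_eq_on I g f}. total_variation_on I g"
    define M X where "M = enn2real (l1 (rep f))" and "X = enn2real (l1 (E f))"
    have M: "l1 (rep f) = ennreal M" "0 \<le> M" using supported_onD(4)[OF r.g] by (auto simp: M_def less_top)
    have X: "l1 (E f) = ennreal X" "0 \<le> X" using l1_E_finite[OF f] by (auto simp: X_def less_top)
    \<comment> \<open>Solving the bound for the variation gives a left-hand side independent of the
      representative \<open>g\<close>, so the infimum can be taken on the right.\<close>
    have "ennreal ((X - K * M) / K) \<le> total_variation_on I g" if g: "ae_eq_on I g f" for g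
    proof (cases "total_variation_on I g")
      case (real V)
      define h where "h x = g x * indicator I x" for x
      have h: "h \<in> reps" unfolding h_def[abs_def] by (rule restrict_in_reps) (simp add: real)
      have "AE x in lborel. x \<in> I \<longrightarrow> g x = f x" using g by (simp add: ae_eq_on_def AE_completion_iff)
      then have ae: "AE x in lborel. h x = rep f x"
        using rep(2)[OF f] by eventually_elim (auto simp: h_def rep_outside split: split_indicator)
      have "l1 h = l1 (rep f)"
        unfolding l1_def by (rule nn_integral_cong_AE) (use ae in eventually_elim, simp)
      moreover have "l1 (extend \<gamma> h) = l1 (E f)"
        unfolding l1_def E_def
        by (rule nn_integral_cong_AE) (use extend_cong_AE[OF summable_reps[OF h] summable_rep[OF f] ae] in eventually_elim, simp)
      moreover have "total_variation_on I h = ennreal V"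
        using real total_variation_on_cong[of I h g] by (simp add: h_def)
      ultimately have "ennreal X \<le> ennreal (K * (M + V))" using bound[OF h] M X real by metis
      then have "X \<le> K * (M + V)" using K M real by simp
      then have "(X - K * M) / K \<le> V" using K by (simp add: field_simps)
      then show ?thesis using real by (simp add: ennreal_leI)
    qed simp
    then have le: "ennreal ((X - K * M) / K) \<le> ?N" by (intro INF_greatest) auto
    obtain g where "ae_eq_on I g f" "total_variation_on I g < \<infinity>" using f by (auto simp: BV_def)
    then have "?N < \<infinity>" by (intro order.strict_trans1[OF INF_lower]) auto
    then have "ennreal ((X - K * M) / K) \<le> ennreal (enn2real ?N)" using le by simp
    then have "(X - K * M) / K \<le> enn2real ?N"
    proof (cases "0 \<le> (X - K * M) / K")
      case False
      then show ?thesis using enn2real_nonneg[of ?N] by linarith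
    qed simp
    then have "X \<le> K * (M + enn2real ?N)" using K by (simp add: field_simps)
    also have "M + enn2real ?N = BV_norm I f" by (simp add: BV_norm_def L1_norm_eq_rep[OF f] M_def)
    finally show ?thesis using L1_norm_E_le[OF f, of "{0..}"] by (simp add: X_def)
  qed
  then show ?thesis by blast
qed

lemma BV_lincomb:
  assumes "f \<in> BV I" "g \<in> BV I"
  shows "(\<lambda>x. a * f x + b * g x) \<in> BV I"
proof -
  obtain f' g' where f': "ae_eq_on I f' f" "total_variation_on I f' < \<infinity>"
    and g': "ae_eq_on I g' g" "total_variation_on I g' < \<infinity>"
    using assms by (auto simp: BV_def)
  have "(\<lambda>x. a * f x + b * g x) \<in> L1 I"
    using assms by (simp add: BV_def L1_def set_integral_add(1))
  moreover have "ae_eq_on I (\<lambda>x. a * f' x + b * g' x) (\<lambda>x. a * f x + b * g x)"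
    using f'(1) g'(1) unfolding ae_eq_on_def by eventually_elim simp
  moreover have "ennreal (norm a) * total_variation_on I f' + ennreal (norm b) * total_variation_on I g' < \<infinity>"
    using f'(2) g'(2) by (simp add: ennreal_mult_less_top)
  then have "total_variation_on I (\<lambda>x. a * f' x + b * g' x) < \<infinity>"
    using total_variation_on_lincomb_le by (rule order.strict_trans1[rotated])
  ultimately show ?thesis unfolding BV_def by blast
qed

lemma step_in_BV: "(\<lambda>x. if p \<le> x then 1 else 0) \<in> BV I"
proof -
  let ?s = "\<lambda>x. if p \<le> x then 1 else 0 :: complex"
  have "total_variation_on I ?s < \<infinity>"
    by (rule order.strict_trans1[OF total_variation_on_step]) simp
  moreover have "?s \<in> L1 I"
  proof -
    have "?s = indicator {p..}" by (auto split: split_indicator)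
    then have "integrable lborel (\<lambda>x. indicator I x *\<^sub>R ?s x)"
      using bounded_borel_indicator[of "{p..}"]
      by (intro integrable_of_l1 l1_bounded_support[where a=1 and b=\<gamma>])
         (auto simp: bounded_borel_def I_def norm_mult intro!: exI[of _ 1] split: split_indicator)
    moreover have "(\<lambda>x. indicator I x *\<^sub>R ?s x) \<in> borel_measurable borel"
      unfolding \<open>?s = indicator {p..}\<close> I_def by measurable
    ultimately show ?thesis by (simp add: L1_def set_integrable_def integrable_completion)
  qed
  moreover have "ae_eq_on I ?s ?s" by (simp add: ae_eq_on_def)
  ultimately show ?thesis unfolding BV_def by blast
qed

lemma E_bounded_linear: "bounded_linear_BV_L1 I {0..} E"
  unfolding bounded_linear_BV_L1_def
proof (intro conjI ballI allI impI)
  show "E f \<in> L1 {0..}" if "f \<in> BV I" for f using that by (rule E_in_L1) simp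
  show "ae_eq_on {0..} (E f) (E g)" if fg: "f \<in> BV I" "g \<in> BV I" "ae_eq_on I f g" for f g
  proof -
    have "AE x in lborel. x \<in> I \<longrightarrow> f x = 1 * g x + 0 * g x" using fg(3) by (simp add: ae_eq_on_def AE_completion_iff)
    from E_lincomb[OF fg(1,2,2) this] have "AE x in lborel. x \<in> {0..} \<longrightarrow> E f x = E g x" by eventually_elim simp
    then show ?thesis unfolding ae_eq_on_def by (rule AE_completion)
  qed
  show "ae_eq_on {0..} (E (\<lambda>x. f x + g x)) (\<lambda>x. E f x + E g x)" if fg: "f \<in> BV I" "g \<in> BV I" for f g
  proof -
    have "(\<lambda>x. f x + g x) \<in> BV I" using BV_lincomb[OF fg, of 1 1] by simp
    then have "AE x in lborel. E (\<lambda>x. f x + g x) x = 1 * E f x + 1 * E g x" by (rule E_lincomb[OF _ fg]) simp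
    then have "AE x in lborel. x \<in> {0..} \<longrightarrow> E (\<lambda>x. f x + g x) x = E f x + E g x" by eventually_elim simp
    then show ?thesis unfolding ae_eq_on_def by (rule AE_completion)
  qed
  show "ae_eq_on {0..} (E (\<lambda>x. c * f x)) (\<lambda>x. c * E f x)" if f: "f \<in> BV I" for c f
  proof -
    have "(\<lambda>x. c * f x) \<in> BV I" using BV_lincomb[OF f f, of c 0] by simp
    then have "AE x in lborel. E (\<lambda>x. c * f x) x = c * E f x + 0 * E f x" by (rule E_lincomb[OF _ f f]) simp
    then have "AE x in lborel. x \<in> {0..} \<longrightarrow> E (\<lambda>x. c * f x) x = c * E f x" by eventually_elim simp
    then show ?thesis unfolding ae_eq_on_def by (rule AE_completion)
  qed
qed (rule E_bounded)

text \<open>Step functions with one more jump than \<open>B\<close> has elements. On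
  \<open>I\<close> they coincide with their extensions, so a linear relation among their
  coefficients would be one among the steps themselves, which evaluation at sample points
  excludes.\<close>

lemma E_infinite_dimensional: "infinite_dimensional_ae {0..} (E ` BV I)"
  unfolding infinite_dimensional_ae_def
proof
  assume "\<exists>B. finite B \<and> B \<subseteq> E ` BV I \<and>
      (\<forall>f\<in>E ` BV I. \<exists>c :: (real \<Rightarrow> complex) \<Rightarrow> complex. ae_eq_on {0..} f (\<lambda>x. \<Sum>b\<in>B. c b * b x))"
  then obtain B where B: "finite B"
    and span: "\<And>f. f \<in> E ` BV I \<Longrightarrow> \<exists>c :: (real \<Rightarrow> complex) \<Rightarrow> complex. ae_eq_on {0..} f (\<lambda>x. \<Sum>b\<in>B. c b * b x)"
    by blast
  define N where "N = Suc (card B)"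
  define p where "p i = 1 + (\<gamma> - 1) * (real i / real N)" for i
  define s where "s i = (\<lambda>x. if p i \<le> x then 1 else 0 :: complex)" for i
  have p_less: "p i < p (Suc i)" for i using \<gamma> by (simp add: p_def N_def divide_strict_right_mono)
  then have "strict_mono p" by (rule strict_monoI_Suc)
  have p0: "1 \<le> p i" for i using \<gamma> by (simp add: p_def)
  have pN: "p N = \<gamma>" by (simp add: p_def N_def del: of_nat_Suc)
  have "\<forall>i. \<exists>c :: (real \<Rightarrow> complex) \<Rightarrow> complex. ae_eq_on {0..} (E (s i)) (\<lambda>x. \<Sum>b\<in>B. c b * b x)"
    using span step_in_BV by (auto simp: s_def)
  from choice[OF this] obtain c :: "nat \<Rightarrow> (real \<Rightarrow> complex) \<Rightarrow> complex" where
    c: "\<And>i. ae_eq_on {0..} (E (s i)) (\<lambda>x. \<Sum>b\<in>B. c i b * b x)" by blast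
  have "AE x in lborel. x \<in> I \<longrightarrow> s i x = (\<Sum>b\<in>B. c i b * b x)" for i
  proof -
    have "AE x in lborel. x \<in> {0..} \<longrightarrow> E (s i) x = (\<Sum>b\<in>B. c i b * b x)"
      using c[of i] by (simp add: ae_eq_on_def AE_completion_iff)
    moreover have "AE x in lborel. x \<in> I \<longrightarrow> E (s i) x = s i x"
      by (rule E_on) (simp add: s_def step_in_BV)
    ultimately show ?thesis by eventually_elim (auto simp: I_def)
  qed
  then have ae: "AE x in lborel. \<forall>i. x \<in> I \<longrightarrow> s i x = (\<Sum>b\<in>B. c i b * b x)"
    unfolding AE_all_countable by blast
  \<comment> \<open>Each cell has positive length and so meets the set of full measure on which all
    the countably many identities hold; one such point per cell makes the matrix
    \<open>s i (x j)\<close> triangular.\<close>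
  have "\<exists>x. p j \<le> x \<and> x < p (Suc j) \<and> (\<forall>i. x \<in> I \<longrightarrow> s i x = (\<Sum>b\<in>B. c i b * b x))" for j
  proof (rule ccontr)
    assume "\<not> ?thesis"
    with ae have "AE x in lborel. x \<notin> {p j..<p (Suc j)}" by (auto elim!: eventually_mono)
    then have "emeasure lborel {p j..<p (Suc j)} = 0"
      by (subst (asm) AE_iff_measurable[where N="{p j..<p (Suc j)}"]) auto
    then show False using p_less[of j] by simp
  qed
  then obtain x where x: "\<And>j. p j \<le> x j \<and> x j < p (Suc j)"
    and xs: "\<And>i j. x j \<in> I \<Longrightarrow> s i (x j) = (\<Sum>b\<in>B. c i b * b (x j))" by metis
  have xI: "x j \<in> I" if "j < N" for j
  proof -
    have "p (Suc j) \<le> p N" using that \<open>strict_mono p\<close> by (simp add: strict_mono_less_eq)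
    then show ?thesis using x[of j] p0[of j] pN by (simp add: I_def)
  qed
  have sx: "s i (x j) = (if i \<le> j then 1 else 0)" for i j
  proof (cases "i \<le> j")
    case True
    then have "p i \<le> p j" using \<open>strict_mono p\<close> by (simp add: strict_mono_less_eq)
    then show ?thesis using x[of j] True by (simp add: s_def)
  next
    case False
    then have "p (Suc j) \<le> p i" using \<open>strict_mono p\<close> by (simp add: strict_mono_less_eq)
    then show ?thesis using x[of j] False by (simp add: s_def)
  qed
  have "card B < card {..<N}" by (simp add: N_def)
  from nontrivial_solution[OF B _ this, of c] obtain l where
    l: "\<exists>i\<in>{..<N}. l i \<noteq> 0" "\<And>b. b \<in> B \<Longrightarrow> (\<Sum>i<N. l i * c i b) = 0" by auto
  define m where "m = (LEAST i. i < N \<and> l i \<noteq> 0)"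
  have m: "m < N" "l m \<noteq> 0" using l(1) LeastI_ex[of "\<lambda>i. i < N \<and> l i \<noteq> 0"] by (auto simp: m_def)
  have before: "l i = 0" if "i < m" for i
    using not_less_Least[of i "\<lambda>i. i < N \<and> l i \<noteq> 0"] that m(1) by (auto simp: m_def)
  \<comment> \<open>At \<open>x m\<close> the steps with \<open>i > m\<close> vanish, and the
    coefficients with \<open>i < m\<close> vanish because \<open>m\<close> is minimal.\<close>
  have "l m = (\<Sum>i<N. l i * s i (x m))"
  proof -
    have "(\<Sum>i<N. l i * s i (x m)) = (\<Sum>i\<in>{m}. l i * s i (x m))"
      using m(1) before by (intro sum.mono_neutral_right) (auto simp: sx not_le nat_neq_iff)
    then show ?thesis by (simp add: sx)
  qed
  also have "\<dots> = (\<Sum>i<N. \<Sum>b\<in>B. l i * c i b * b (x m))"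
    by (simp add: xs[OF xI[OF m(1)]] sum_distrib_left mult.assoc)
  also have "\<dots> = (\<Sum>b\<in>B. (\<Sum>i<N. l i * c i b) * b (x m))"
    by (subst sum.swap) (simp add: sum_distrib_right)
  also have "\<dots> = 0" using l(2) by simp
  finally show False using m(2) by simp
qed

text \<open>For the parameter \<open>2 * \<gamma>\<close> both families of exponentials come from
  the same 1-periodic character \<phi>, evaluated at \<open>x\<close> and at
  \<open>\<gamma> / x\<close>.\<close>

lemma E_in_N_perp:
  assumes f: "f \<in> BV I"
  shows "E f \<in> N_perp (2 * \<gamma>)"
  unfolding N_perp_def
proof (intro CollectI conjI allI)
  interpret summable_defect \<gamma> "rep f" by (rule summable_rep[OF f])
  note [measurable] = E_measurable[OF f]
  show "E f \<in> L1 {0<..}" using f by (rule E_in_L1) simp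
  fix n :: int
  define \<phi> where "\<phi> x = cis (2 * of_int n * pi * x)" for x
  have \<phi>: "\<phi> \<in> borel_measurable borel" "norm (\<phi> x) \<le> 1" "\<phi> (x + 1) = \<phi> x" for x
  proof -
    show "\<phi> \<in> borel_measurable borel"
      unfolding \<phi>_def[abs_def] cis_conv_exp by measurable
    show "norm (\<phi> x) \<le> 1" by (simp add: \<phi>_def)
    have "\<phi> (x + 1) = cis (2 * of_int n * pi * x) * cis (2 * pi * of_int n)"
      by (simp add: \<phi>_def cis_mult algebra_simps)
    then show "\<phi> (x + 1) = \<phi> x" by (simp add: \<phi>_def cis_multiple_2pi)
  qed
  note [measurable] = \<phi>(1)
  have conv: "(LINT x:{0<..}|lebesgue. E f x * \<psi> x) = (\<integral>x. indicator {0<..} x * (extend \<gamma> (rep f) x * \<psi> x) \<partial>lborel)"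
    if [measurable]: "\<psi> \<in> borel_measurable borel" for \<psi>
  proof -
    have "(LINT x:{0<..}|lebesgue. E f x * \<psi> x) = (\<integral>x. indicator {0<..} x *\<^sub>R (E f x * \<psi> x) \<partial>lborel)"
      unfolding set_lebesgue_integral_def by (rule integral_completion) measurable
    also have "\<dots> = (\<integral>x. indicator {0<..} x * (extend \<gamma> (rep f) x * \<psi> x) \<partial>lborel)"
      by (intro Bochner_Integration.integral_cong refl) (auto simp: E_def split: split_indicator)
    finally show ?thesis .
  qed
  have 1: "exp (\<i> * of_real (2 * of_int n * pi * x)) = \<phi> x" for x
    by (simp add: \<phi>_def cis_conv_exp)
  show "(LINT x:{0<..}|lebesgue. E f x * exp (\<i> * of_real (2 * of_int n * pi * x))) = 0"
    unfolding 1 conv[OF \<phi>(1)] by (rule pairing_1[OF \<phi>])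
  have "of_int n * pi * (2 * \<gamma>) / x = 2 * of_int n * pi * (\<gamma> / x)" for x by simp
  then have 2: "exp (\<i> * of_real (of_int n * pi * (2 * \<gamma>) / x)) = \<phi> (\<gamma> / x)" for x
    by (simp only: \<phi>_def cis_conv_exp)
  have "(\<lambda>x. \<phi> (\<gamma> / x)) \<in> borel_measurable borel" by measurable
  from conv[OF this] show "(LINT x:{0<..}|lebesgue. E f x * exp (\<i> * of_real (of_int n * pi * (2 * \<gamma>) / x))) = 0"
    unfolding 2 using pairing_2[OF \<phi>] by simp
qed

end

theorem theorem8p6:
  fixes \<gamma> :: real
  assumes "1 < \<gamma>"
  shows "\<exists>E :: (real \<Rightarrow> complex) \<Rightarrow> (real \<Rightarrow> complex).
    bounded_linear_BV_L1 {1..\<gamma>} {0..} E \<and>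
    (\<forall>f \<in> BV {1..\<gamma>}. AE x in lebesgue. x \<in> {1..\<gamma>} \<longrightarrow> E f x = f x) \<and>
    infinite_dimensional_ae {0..} (E ` BV {1..\<gamma>}) \<and>
    E ` BV {1..\<gamma>} \<subseteq> N_perp (2 * \<gamma>)"
proof -
  interpret BV_extension \<gamma> by unfold_locales (rule assms)
  have "\<forall>f\<in>BV I. AE x in lebesgue. x \<in> I \<longrightarrow> E f x = f x"
    using E_on by (simp add: AE_completion_iff)
  then show ?thesis
    using E_bounded_linear E_infinite_dimensional E_in_N_perp unfolding I_def by blast
qed

end
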